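(* Let $\xi$ be a spectrally positive Lévy process with Lévy triplet $(b,c,\nu)$, $b\ge0$, $c>0$, with scale function $W$. For each $p\ge1$ there exists a constant $C>0$ such that for all $\zeta,x\ge0$, $$\mathbf E\big[|L^\xi_\zeta(x)|^p\big]\le C\,(\zeta\vee\zeta^p)\,(1+W(x))^{2p-2}.$$
   Context: $\nu$ is a measure on $(0,\infty)$ with $\int_0^\infty(y\wedge y^2)\nu(dy)<\infty$. $\xi$ is the Lévy process started at $0$ with $\mathbf E[e^{-\lambda\xi(t)}]=e^{t\Phi(\lambda)}$, $\Phi(\lambda)=b\lambda+c\lambda^2+\int_0^\infty(e^{-\lambda y}-1+\lambda y)\nu(dy)$, $\lambda\ge0$. $W$ is $0$ on $(-\infty,0)$ and on $[0,\infty)$ is the continuous strictly increasing function with $\int_0^\infty e^{-\lambda x}W(x)dx=1/\Phi(\lambda)$, $\lambda>0$. Local times: $L_\xi(x,t)$ is the a.s. jointly continuous occupation density: $\int_0^tf(\xi(r))dr=\int_{\mathbb R}f(x)L_\xi(x,t)dx$. Put $\tau^L_\xi(\zeta)=\inf\{s\ge0:L_\xi(0,s)\ge\zeta\}$ if $\zeta\le L_\xi(0,\infty)$ and $=\infty$ otherwise. $L^\xi_\zeta=\{L^\xi_\zeta(x):x\ge0\}$ is the process $\{L_\xi(x,\tau^L_\xi(\zeta)):x\ge0\}$ under $\mathbf P(\cdot\,|\,\tau^L_\xi(\zeta)<\infty)$, and $\mathbf E$ of its functionals is the corresponding expectation. *)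

theory Defs
  imports "HOL-Probability.Probability"
begin

definition cadlag :: "(real \<Rightarrow> real) \<Rightarrow> bool" where
  "cadlag g \<longleftrightarrow>
    (\<forall>t\<ge>0. (g \<longlongrightarrow> g t) (at_right t)) \<and>
    (\<forall>t>0. \<exists>l. (g \<longlongrightarrow> l) (at_left t))"

text \<open>Time runs through \<open>[0,\<infinity>)\<close>; the values of \<open>X t\<close> for negative \<open>t\<close> are irrelevant.\<close>

definition levy_process :: "'a measure \<Rightarrow> (real \<Rightarrow> 'a \<Rightarrow> real) \<Rightarrow> bool" where
  "levy_process M X \<longleftrightarrow>
    prob_space M \<and>
    (\<forall>t\<ge>0. X t \<in> borel_measurable M) \<and>
    (AE \<omega> in M. X 0 \<omega> = 0) \<and>
    (\<forall>(n::nat) t. 0 \<le> t 0 \<and> mono_on {..n} t \<longrightarrow>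
       prob_space.indep_vars M (\<lambda>_. borel) (\<lambda>i \<omega>. X (t (Suc i)) \<omega> - X (t i) \<omega>) {..<n}) \<and>
    (\<forall>s\<ge>0. \<forall>h\<ge>0. distr M borel (\<lambda>\<omega>. X (s + h) \<omega> - X s \<omega>) = distr M borel (X h)) \<and>
    (AE \<omega> in M. cadlag (\<lambda>t. X t \<omega>))"

definition jump_measure :: "real measure \<Rightarrow> bool" where
  "jump_measure \<nu> \<longleftrightarrow>
    sets \<nu> = sets (restrict_space borel {0<..}) \<and>
    (\<integral>\<^sup>+ y. ennreal (min y (y\<^sup>2)) \<partial>\<nu>) < \<infinity>"

definition laplace_exponent :: "real \<Rightarrow> real \<Rightarrow> real measure \<Rightarrow> real \<Rightarrow> real" where
  "laplace_exponent b c \<nu> q =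
    b * q + c * q\<^sup>2 + (\<integral> y. (exp (- q * y) - 1 + q * y) \<partial>\<nu>)"

definition spectrally_positive_levy ::
    "'a measure \<Rightarrow> real \<Rightarrow> real \<Rightarrow> real measure \<Rightarrow> (real \<Rightarrow> 'a \<Rightarrow> real) \<Rightarrow> bool" where
  "spectrally_positive_levy M b c \<nu> \<xi> \<longleftrightarrow>
    jump_measure \<nu> \<and> levy_process M \<xi> \<and>
    (\<forall>t\<ge>0. \<forall>q\<ge>0. has_bochner_integral M (\<lambda>\<omega>. exp (- q * \<xi> t \<omega>))
       (exp (t * laplace_exponent b c \<nu> q)))"

definition scale_function :: "real \<Rightarrow> real \<Rightarrow> real measure \<Rightarrow> (real \<Rightarrow> real) \<Rightarrow> bool" where
  "scale_function b c \<nu> W \<longleftrightarrow>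
    (\<forall>x<0. W x = 0) \<and>
    continuous_on {0..} W \<and> strict_mono_on {0..} W \<and>
    (\<forall>q>0. set_integrable lborel {0..} (\<lambda>x. exp (- q * x) * W x) \<and>
       (LBINT x:{0..}. exp (- q * x) * W x) = 1 / laplace_exponent b c \<nu> q)"

text \<open>
  \<open>L x t \<omega>\<close> is the local time at level \<open>x\<close> up to time \<open>t\<close>. Only almost every path is
  required to be good, so measurability is taken with respect to the completion of \<open>M\<close>; it is
  then no restriction, because \<open>L x t\<close> is a.s. the limit of normalized occupation times of
  shrinking neighbourhoods of \<open>x\<close>. Nonnegativity is stated separately since \<open>ennreal\<close> truncates
  negative numbers to 0.
\<close>

definition local_times ::
    "'a measure \<Rightarrow> (real \<Rightarrow> 'a \<Rightarrow> real) \<Rightarrow> (real \<Rightarrow> real \<Rightarrow> 'a \<Rightarrow> real) \<Rightarrow> bool" where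
  "local_times M \<xi> L \<longleftrightarrow>
    (\<forall>x. \<forall>t\<ge>0. L x t \<in> borel_measurable (completion M)) \<and>
    (AE \<omega> in M.
       continuous_on (UNIV \<times> {0..}) (\<lambda>(x, t). L x t \<omega>) \<and>
       (\<forall>x. \<forall>t\<ge>0. 0 \<le> L x t \<omega>) \<and>
       (\<forall>t\<ge>0. \<forall>f::real \<Rightarrow> ennreal. f \<in> borel_measurable borel \<longrightarrow>
          (\<integral>\<^sup>+ r\<in>{0..t}. f (\<xi> r \<omega>) \<partial>lborel) = (\<integral>\<^sup>+ x. f x * ennreal (L x t \<omega>) \<partial>lborel)))"

text \<open>As \<open>L 0\<close> is a.s. nondecreasing in time, the supremum below is \<open>L(0,\<infinity>)\<close>. The infimum is
  taken in the extended reals, so that it is \<open>\<infinity>\<close> on the empty set.\<close>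

definition inverse_local_time :: "(real \<Rightarrow> real \<Rightarrow> 'a \<Rightarrow> real) \<Rightarrow> real \<Rightarrow> 'a \<Rightarrow> ereal" where
  "inverse_local_time L \<zeta> \<omega> =
    (if ereal \<zeta> \<le> (SUP s\<in>{0..}. ereal (L 0 s \<omega>))
     then Inf (ereal ` {s. 0 \<le> s \<and> \<zeta> \<le> L 0 s \<omega>}) else \<infinity>)"

definition stopped_local_time ::
    "(real \<Rightarrow> real \<Rightarrow> 'a \<Rightarrow> real) \<Rightarrow> real \<Rightarrow> real \<Rightarrow> 'a \<Rightarrow> real" where
  "stopped_local_time L \<zeta> x \<omega> = L x (real_of_ereal (inverse_local_time L \<zeta> \<omega>)) \<omega>"

text \<open>The probability measure conditioned on the inverse local time at \<open>\<zeta>\<close> being finite. The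
  completion makes the conditioning event measurable although paths are only a.s. continuous.\<close>

definition conditioned_measure ::
    "'a measure \<Rightarrow> (real \<Rightarrow> real \<Rightarrow> 'a \<Rightarrow> real) \<Rightarrow> real \<Rightarrow> 'a measure" where
  "conditioned_measure M L \<zeta> =
    uniform_measure (completion M) {\<omega> \<in> space M. inverse_local_time L \<zeta> \<omega> < \<infinity>}"

end

theory Submission
  imports Defs "HOL-Complex_Analysis.Complex_Analysis" "HOL-Real_Asymp.Real_Asymp"
begin

text \<open>
  Fix \<open>q > 0\<close> and let \<open>U\<close> be the \<open>q\<close>-resolvent measure of \<open>\<xi>\<close> started at \<open>0\<close>. Comparing
  two-sided Laplace transforms on the strip \<open>0 < \<Phi>(\<lambda>) < q\<close> gives \<open>U + W dx = q (W * U) dx\<close>, so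
  \<open>U\<close> has the density \<open>u = q W * U - W\<close>. Since \<open>W\<close> is subadditive, \<open>u\<close> is continuous, maximal at
  \<open>0\<close>, and \<open>u(0) - u(\<plusminus>x) \<le> W(x)\<close> for \<open>x \<ge> 0\<close>, uniformly in \<open>q\<close>.

  Only the Markov property at fixed times is needed. It yields the Kac moment formula for the local
  times at \<open>0\<close> and \<open>x\<close>, hence \<open>E[exp(-q \<tau>(\<zeta>) + \<beta> L(x, \<tau>(\<zeta>)))] = exp(-\<zeta> / u(0) + \<zeta> \<theta>(\<beta>))\<close> for small
  \<open>\<beta>\<close>, where \<open>\<theta>(\<beta>) = a \<beta> / (1 - m \<beta>)\<close> with \<open>a \<le> 1\<close> and \<open>m = u(0) - u(x) u(-x) / u(0) \<le> 2 W(x)\<close>: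
  under the discounted measure \<open>L(x, \<tau>(\<zeta>))\<close> is compound Poisson with exponential summands. Analytic
  continuation extends this to all \<open>\<beta> < 1 / m\<close>. Taking \<open>\<beta>\<close> of order \<open>1 / ((1 + m) max(1, \<zeta>))\<close> bounds the
  \<open>p\<close>-th moment by a multiple of \<open>exp(-\<zeta> / u(0))\<close>, which is at most \<open>P(\<tau>(\<zeta>) < \<infinity>)\<close>. Then let \<open>q\<close>
  tend to \<open>0\<close>.
\<close>

section \<open>Uniqueness of Laplace transforms\<close>

text \<open>The obstacle is uniformity in \<open>q\<close>. The Kac series at the levels 0 and
  \<open>x\<close> converges for \<open>(\<alpha> + \<beta>) * u 0 < 1\<close>, and
  \<open>u 0\<close> need not stay bounded as \<open>q\<close> tends to 0, so a bound read off the
  series degenerates in the limit. The exponent \<open>rate x \<beta>\<close> extracted from it,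
  however, is singular at most at \<open>1 / scl x\<close>, and \<open>scl x\<close> is made of
  increments of \<open>u\<close>, which \<open>W\<close> bounds for every \<open>q\<close>; hence
  the detour through analytic continuation. At fixed times the level \<zeta> of the inverse local
  time is out of reach. It is integrated out against \<open>exp (\<alpha> * \<zeta>)\<close>, and
  uniqueness of Laplace transforms inverts \<alpha> afterwards. Such inversions, also for
  \<open>W\<close> and \<open>u\<close>, give identities almost everywhere, and continuity or
  monotonicity has to restore the missing points. Subadditivity of \<open>W\<close> comes from a
  Volterra equation: \<open>c\<close> times \<open>W\<close> plus the convolution of
  \<open>W\<close> with a decreasing kernel, \<open>b\<close> plus the integrated tail of \<nu>, is
  the identity. Near 0 the positive \<open>c\<close> outweighs the mass of the kernel.\<close>

lemma integral_exp_sums: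
  fixes g :: "'b \<Rightarrow> complex" and Y :: "'b \<Rightarrow> real" and w :: complex
  assumes [measurable]: "g \<in> borel_measurable N" "Y \<in> borel_measurable N"
    and int: "integrable N (\<lambda>x. norm (g x) * exp (r * \<bar>Y x\<bar>))" and w: "norm w \<le> r"
  shows "(\<lambda>n. (\<integral>x. g x * (of_real (Y x) ^ n / fact n) \<partial>N) * w ^ n) sums (\<integral>x. g x * exp (w * Y x) \<partial>N)"
proof -
  let ?t = "\<lambda>n x. g x * (of_real (Y x) ^ n / fact n) * w ^ n"
  have bound: "norm (\<Sum>i<n. ?t i x) \<le> norm (g x) * exp (r * \<bar>Y x\<bar>)" for n x
  proof -
    have "norm (\<Sum>i<n. ?t i x) \<le> (\<Sum>i<n. norm (?t i x))"
      by (rule norm_sum)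
    also have "\<dots> = norm (g x) * (\<Sum>i<n. (norm w * \<bar>Y x\<bar>) ^ i / fact i)"
      by (simp add: sum_distrib_left norm_mult norm_divide norm_power power_mult_distrib mult_ac)
    also have "\<dots> \<le> norm (g x) * (\<Sum>i<n. (r * \<bar>Y x\<bar>) ^ i / fact i)"
      by (intro mult_left_mono sum_mono divide_right_mono power_mono mult_right_mono w) auto
    also have "\<dots> \<le> norm (g x) * exp (r * \<bar>Y x\<bar>)"
    proof (intro mult_left_mono)
      have s: "(\<lambda>i. (r * \<bar>Y x\<bar>) ^ i / fact i) sums exp (r * \<bar>Y x\<bar>)"
        using exp_converges[of "r * \<bar>Y x\<bar>"] by (simp add: field_simps)
      have "0 \<le> r" using w norm_ge_zero[of w] by linarith
      then show "(\<Sum>i<n. (r * \<bar>Y x\<bar>) ^ i / fact i) \<le> exp (r * \<bar>Y x\<bar>)"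
        using sum_le_suminf[OF sums_summable[OF s], of "{..<n}"] sums_unique[OF s]
        by (auto intro!: divide_nonneg_nonneg)
    qed simp
    finally show ?thesis .
  qed
  have meas [measurable]: "?t n \<in> borel_measurable N" for n by measurable
  \<comment> \<open>A term is the difference of two partial sums, so the domination of partial sums
    also gives the integrability of each term.\<close>
  have single: "norm (?t n x) \<le> 2 * (norm (g x) * exp (r * \<bar>Y x\<bar>))" for n x
  proof -
    have "norm (?t n x) = norm ((\<Sum>i<Suc n. ?t i x) - (\<Sum>i<n. ?t i x))" by simp
    also have "\<dots> \<le> norm (\<Sum>i<Suc n. ?t i x) + norm (\<Sum>i<n. ?t i x)"
      by (rule norm_triangle_ineq4)
    finally show ?thesis using bound[where n = "Suc n" and x = x] bound[where n = n and x = x] by linarith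
  qed
  have int_t: "integrable N (?t n)" for n
    by (rule Bochner_Integration.integrable_bound[OF integrable_mult_right[OF int, of 2] meas])
      (use single in auto)
  have "(\<lambda>n. \<integral>x. (\<Sum>i<n. ?t i x) \<partial>N) \<longlonglongrightarrow> (\<integral>x. g x * exp (w * Y x) \<partial>N)"
  proof (rule integral_dominated_convergence[OF _ _ int])
    show "AE x in N. (\<lambda>n. \<Sum>i<n. ?t i x) \<longlonglongrightarrow> g x * exp (w * Y x)"
    proof (intro AE_I2)
      fix x
      have "(\<lambda>n. (w * Y x) ^ n /\<^sub>R fact n) sums exp (w * Y x)"
        by (rule exp_converges)
      then have "(\<lambda>n. g x * ((w * Y x) ^ n /\<^sub>R fact n)) sums (g x * exp (w * Y x))"
        by (rule sums_mult)
      moreover have "g x * ((w * Y x) ^ n /\<^sub>R fact n) = ?t n x" for n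
        by (simp add: scaleR_conv_of_real power_mult_distrib field_simps)
      ultimately show "(\<lambda>n. \<Sum>i<n. ?t i x) \<longlonglongrightarrow> g x * exp (w * Y x)"
        by (simp add: sums_def)
    qed
  qed (use bound in auto)
  moreover have "(\<integral>x. (\<Sum>i<n. ?t i x) \<partial>N) = (\<Sum>i<n. (\<integral>x. g x * (of_real (Y x) ^ i / fact i) \<partial>N) * w ^ i)" for n
    using int_t by (subst Bochner_Integration.integral_sum) auto
  ultimately show ?thesis
    by (simp add: sums_def)
qed

lemma laplace_transform_integrable:
  fixes l :: real
  assumes [measurable_cong]: "sets M = sets borel"
    and "(\<integral>\<^sup>+ x. ennreal (exp (- l * x)) \<partial>M) < \<infinity>"
  shows "integrable M (\<lambda>x. exp (- l * x))"
  using assms(2) by (intro integrableI_nonneg) auto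

text \<open>Expands in a power series about each point of the strip. The growth
  \<open>exp (r * \<bar>x\<bar>)\<close> that the expansion costs is absorbed by moving the real
  part by \<open>r\<close> to either side, where the transform is still finite.\<close>

lemma laplace_transform_holomorphic:
  fixes M :: "real measure"
  assumes [measurable_cong]: "sets M = sets borel"
    and fin: "\<And>l. a < l \<Longrightarrow> l < b \<Longrightarrow> (\<integral>\<^sup>+ x. ennreal (exp (- l * x)) \<partial>M) < \<infinity>"
  shows "(\<lambda>z. \<integral>x. exp (- z * complex_of_real x) \<partial>M) holomorphic_on {z. a < Re z \<and> Re z < b}"
proof -
  let ?S = "{z. a < Re z \<and> Re z < b}"
  let ?F = "\<lambda>z. \<integral>x. exp (- z * complex_of_real x) \<partial>M"
  have "\<exists>r>0. ?F holomorphic_on ball z0 r" if z0: "z0 \<in> ?S" for z0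
  proof -
    define r where "r = min (Re z0 - a) (b - Re z0) / 2"
    have r: "0 < r" "a < Re z0 - r" "Re z0 + r < b" using z0 by (auto simp: r_def min_def field_simps)
    have "?F holomorphic_on ball z0 r"
    proof (rule power_series_holomorphic)
      fix w assume w: "w \<in> ball z0 r"
      have int: "integrable M (\<lambda>x. norm (exp (- z0 * complex_of_real x)) * exp (r * \<bar>- x\<bar>))"
      proof (rule Bochner_Integration.integrable_bound)
        show "integrable M (\<lambda>x. exp (- (Re z0 - r) * x) + exp (- (Re z0 + r) * x))"
          using r z0 by (intro Bochner_Integration.integrable_add laplace_transform_integrable fin assms) auto
        show "AE x in M. norm (norm (exp (- z0 * complex_of_real x)) * exp (r * \<bar>- x\<bar>))
          \<le> norm (exp (- (Re z0 - r) * x) + exp (- (Re z0 + r) * x))"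
        proof (intro AE_I2)
          fix x :: real
          have "norm (exp (- z0 * complex_of_real x)) * exp (r * \<bar>- x\<bar>) = exp (- Re z0 * x + r * \<bar>x\<bar>)"
            by (simp add: exp_add[symmetric])
          also have "\<dots> \<le> exp (- (Re z0 - r) * x) + exp (- (Re z0 + r) * x)"
            by (cases "0 \<le> x") (auto simp: algebra_simps intro: add_increasing add_increasing2)
          finally show "norm (norm (exp (- z0 * complex_of_real x)) * exp (r * \<bar>- x\<bar>))
            \<le> norm (exp (- (Re z0 - r) * x) + exp (- (Re z0 + r) * x))"
            by simp
        qed
      qed auto
      have "(\<lambda>n. (\<integral>x. exp (- z0 * complex_of_real x) * (of_real (- x) ^ n / fact n) \<partial>M) * (w - z0) ^ n)
          sums (\<integral>x. exp (- z0 * complex_of_real x) * exp ((w - z0) * of_real (- x)) \<partial>M)"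
        using w by (intro integral_exp_sums[OF _ _ int]) (auto simp: dist_norm norm_minus_commute)
      also have "(\<integral>x. exp (- z0 * complex_of_real x) * exp ((w - z0) * of_real (- x)) \<partial>M) = ?F w"
        by (simp add: exp_add[symmetric] algebra_simps)
      finally show "(\<lambda>n. (\<integral>x. exp (- z0 * complex_of_real x) * (of_real (- x) ^ n / fact n) \<partial>M) * (w - z0) ^ n)
          sums ?F w" .
    qed
    with r show ?thesis by blast
  qed
  then have "?F field_differentiable at z0 within ?S" if "z0 \<in> ?S" for z0
    using that by (meson centre_in_ball field_differentiable_at_within holomorphic_on_imp_differentiable_at open_ball)
  then show ?thesis
    by (simp add: holomorphic_on_def)
qed

lemma open_strip: "open {z. a < Re z \<and> Re z < b}"
  by (intro open_Collect_conj open_Collect_less continuous_intros)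

lemma connected_strip: "connected {z. a < Re z \<and> Re z < b}"
proof -
  have "convex ({z. Re z > a} \<inter> {z. Re z < b})"
    by (intro convex_Int convex_halfspace_Re_gt convex_halfspace_Re_lt)
  then show ?thesis
    by (simp add: convex_connected Int_def)
qed

text \<open>Analytic continuation carries equality from a real segment to the strip. On a vertical
  line the transform is, up to normalisation, the characteristic function of the measure tilted by
  \<open>exp (- l0 * x)\<close>, so Levy's uniqueness theorem applies; the tilt is undone at the
  end. Tilting first is necessary because the measures themselves may be infinite.\<close>

lemma laplace_transform_unique:
  fixes M N :: "real measure"
  assumes sM [measurable_cong]: "sets M = sets borel" and sN [measurable_cong]: "sets N = sets borel"
    and ab: "a < b"
    and fin: "\<And>l. a < l \<Longrightarrow> l < b \<Longrightarrow> (\<integral>\<^sup>+ x. ennreal (exp (- l * x)) \<partial>M) < \<infinity>"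
    and eq: "\<And>l. a < l \<Longrightarrow> l < b \<Longrightarrow>
      (\<integral>\<^sup>+ x. ennreal (exp (- l * x)) \<partial>M) = (\<integral>\<^sup>+ x. ennreal (exp (- l * x)) \<partial>N)"
  shows "M = N"
proof -
  define S where "S = {z. a < Re z \<and> Re z < b}"
  define F where "F M z = (\<integral>x. exp (- z * complex_of_real x) \<partial>M)" for M :: "real measure" and z
  have finN: "(\<integral>\<^sup>+ x. ennreal (exp (- l * x)) \<partial>N) < \<infinity>" if "a < l" "l < b" for l
    using fin[OF that] eq[OF that] by simp
  have F_real: "F M (of_real l) = F N (of_real l)" if "a < l" "l < b" for l
  proof -
    have "F M (of_real l) = of_real (\<integral>x. exp (- l * x) \<partial>M)" for M
      unfolding F_def integral_complex_of_real[symmetric] by (simp flip: exp_of_real)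
    moreover have "(\<integral>x. exp (- l * x) \<partial>M) = (\<integral>x. exp (- l * x) \<partial>N)"
      using eq[OF that] by (simp add: integral_eq_nn_integral)
    ultimately show ?thesis by metis
  qed
  define l0 where "l0 = (a + b) / 2"
  have l0: "a < l0" "l0 < b" using ab by (auto simp: l0_def)
  have F_eq: "F M z - F N z = 0" if "z \<in> S" for z
  proof (rule analytic_continuation[of "\<lambda>z. F M z - F N z" S "of_real ` {a<..<b}" "of_real l0"])
    show "(\<lambda>z. F M z - F N z) holomorphic_on S"
      unfolding F_def S_def
      by (intro holomorphic_intros laplace_transform_holomorphic fin finN sM sN)
    show "open S" "connected S" unfolding S_def by (rule open_strip connected_strip)+
    show "(of_real ` {a<..<b} :: complex set) \<subseteq> S" "complex_of_real l0 \<in> S" using l0 by (auto simp: S_def)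
    show "complex_of_real l0 islimpt of_real ` {a<..<b}"
    proof (rule islimptI)
      fix T assume T: "complex_of_real l0 \<in> T" "open T"
      then obtain e where e: "e > 0" "ball (complex_of_real l0) e \<subseteq> T" by (meson openE)
      define y where "y = l0 + min e (b - l0) / 2"
      have "y \<noteq> l0" "y \<in> {a<..<b}" "dist l0 y < e" using e l0 by (auto simp: y_def dist_real_def min_def field_simps)
      moreover have "dist (complex_of_real l0) (of_real y) = dist l0 y"
        by (simp add: dist_norm flip: of_real_diff)
      ultimately show "\<exists>y\<in>of_real ` {a<..<b}. y \<in> T \<and> y \<noteq> complex_of_real l0"
        using e by (intro bexI[of _ "of_real y"]) auto
    qed
    show "F M z - F N z = 0" if "z \<in> of_real ` {a<..<b}" for z using that F_real by auto
  qed fact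
  define C where "C = (\<integral>\<^sup>+ x. ennreal (exp (- l0 * x)) \<partial>M)"
  have C: "C < \<infinity>" "C = (\<integral>\<^sup>+ x. ennreal (exp (- l0 * x)) \<partial>N)"
    using fin eq l0 by (auto simp: C_def)
  have recover: "A = density (density A (\<lambda>x. ennreal (exp (- l0 * x)))) (\<lambda>x. ennreal (exp (l0 * x)))"
    if sA [measurable_cong]: "sets A = sets borel" for A
    by (subst density_density_eq) (auto simp: ennreal_mult[symmetric] exp_add[symmetric] density_1)
  have "density M (\<lambda>x. ennreal (exp (- l0 * x))) = density N (\<lambda>x. ennreal (exp (- l0 * x)))"
  proof (cases "C = 0")
    \<comment> \<open>With tilted mass 0 no normalisation is possible, but then both tilted measures
      vanish.\<close>
    case True
    show ?thesis
    proof (rule measure_eqI)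
      fix B assume "B \<in> sets (density M (\<lambda>x. ennreal (exp (- l0 * x))))"
      then have [measurable]: "B \<in> sets borel" by (simp add: sM)
      have "emeasure (density A (\<lambda>x. ennreal (exp (- l0 * x)))) B \<le> (\<integral>\<^sup>+ x. ennreal (exp (- l0 * x)) \<partial>A)"
        if sA [measurable_cong]: "sets A = sets borel" for A
        by (subst emeasure_density) (auto intro!: nn_integral_mono simp: indicator_def)
      from this[OF sM] this[OF sN] show "emeasure (density M (\<lambda>x. ennreal (exp (- l0 * x)))) B =
          emeasure (density N (\<lambda>x. ennreal (exp (- l0 * x)))) B"
        using C True by (simp add: C_def)
    qed (simp add: sM sN)
  next
    case False
    define c where "c = enn2real C"
    have c: "0 < c" "C = ennreal c" using False C(1)
      by (auto simp: c_def enn2real_positive_iff less_top zero_less_iff_neq_zero)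
    define T where "T A = density A (\<lambda>x. ennreal (exp (- l0 * x) / c))" for A :: "real measure"
    have rd: "real_distribution (T A)"
      if sA [measurable_cong]: "sets A = sets borel" and "(\<integral>\<^sup>+ x. ennreal (exp (- l0 * x)) \<partial>A) = C" for A
    proof -
      have "emeasure (T A) (space (T A)) = (\<integral>\<^sup>+ x. ennreal (exp (- l0 * x)) / ennreal c \<partial>A)"
        unfolding T_def using c by (subst emeasure_density) (auto simp: divide_ennreal cong: nn_integral_cong)
      also have "\<dots> = C / ennreal c" using that by (subst nn_integral_divide) auto
      also have "\<dots> = 1" using c by (simp add: divide_ennreal)
      finally have "prob_space (T A)" by (rule prob_spaceI)
      then show ?thesis
        by (auto simp: real_distribution_def real_distribution_axioms_def T_def sA sets_eq_imp_space_eq[OF sA])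
    qed
    have ch: "char (T A) t = F A (of_real l0 - \<i> * of_real t) / c" if sA [measurable_cong]: "sets A = sets borel" for A t
    proof -
      have "char (T A) t = (\<integral>x. (exp (- l0 * x) / c) *\<^sub>R iexp (t * x) \<partial>A)"
        unfolding char_def T_def using c by (subst integral_density) auto
      also have "\<dots> = (\<integral>x. exp (- (of_real l0 - \<i> * of_real t) * complex_of_real x) / c \<partial>A)"
        by (intro Bochner_Integration.integral_cong)
          (auto simp: scaleR_conv_of_real exp_of_real[symmetric] exp_add[symmetric] algebra_simps)
      finally show ?thesis by (simp add: F_def)
    qed
    have "char (T M) = char (T N)"
      using F_eq l0 by (auto simp: ch sM sN S_def)
    then have "T M = T N"
      using rd[OF sM] rd[OF sN] C by (intro Levy_uniqueness) (auto simp: C_def)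
    moreover have "density A (\<lambda>x. ennreal (exp (- l0 * x))) = density (T A) (\<lambda>_. ennreal c)"
      if sA [measurable_cong]: "sets A = sets borel" for A
      unfolding T_def using c by (subst density_density_eq) (auto simp: ennreal_mult[symmetric])
    ultimately show ?thesis using sM sN by metis
  qed
  then show ?thesis using recover[OF sM] recover[OF sN] by metis
qed

text \<open>The moment formula is assumed along a null sequence \<open>t\<close> only, because in
  the application each exponent costs a null set of levels. The identity theorem still determines
  all Taylor coefficients at 0, so they agree with those of \<open>g\<close>. Since the coefficients
  \<open>\<mu> n\<close> are nonnegative, monotone convergence then gives the exponential moment,
  including its finiteness, up to the radius \<open>R\<close> of \<open>g\<close>.\<close>

lemma exp_moment_continuation:
  fixes Y :: "'b \<Rightarrow> real" and g :: "complex \<Rightarrow> complex"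
  assumes [measurable]: "Y \<in> borel_measurable N" and Y: "\<And>x. x \<in> space N \<Longrightarrow> 0 \<le> Y x"
    and hol: "g holomorphic_on ball 0 R"
    and t: "\<And>j. 0 < t j" "t \<longlonglongrightarrow> 0" "\<And>j. t j < R"
    and eq: "\<And>j. (\<integral>\<^sup>+ x. ennreal (exp (t j * Y x)) \<partial>N) = ennreal (G (t j))"
    and G: "\<And>s. 0 < s \<Longrightarrow> s < R \<Longrightarrow> g (of_real s) = of_real (G s)" "\<And>s. 0 < s \<Longrightarrow> s < R \<Longrightarrow> 0 \<le> G s"
    and s: "0 < s" "s < R"
  shows "(\<integral>\<^sup>+ x. ennreal (exp (s * Y x)) \<partial>N) = ennreal (G s)"
proof -
  have int0: "integrable N (\<lambda>x. exp (t 0 * Y x))"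
    using eq[of 0] by (intro integrableI_nonneg) auto
  have int1: "integrable N (\<lambda>x. norm (1::complex) * exp (t 0 * \<bar>Y x\<bar>))"
    using Y by (intro Bochner_Integration.integrable_cong[THEN iffD1, OF refl _ int0]) auto
  define \<mu> where "\<mu> n = (\<integral>x. Y x ^ n / fact n \<partial>N)" for n
  define a where "a n = (deriv ^^ n) g 0 / fact n" for n
  have \<mu>_sums: "(\<lambda>n. of_real (\<mu> n) * w ^ n) sums (\<integral>x. exp (w * Y x) \<partial>N)" if "norm w \<le> t 0" for w :: complex
  proof -
    have "of_real (\<mu> n) = (\<integral>x. 1 * (complex_of_real (Y x) ^ n / fact n) \<partial>N)" for n
      unfolding \<mu>_def integral_complex_of_real[symmetric] by simp
    then show ?thesis
      using integral_exp_sums[OF _ _ int1 that] by simp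
  qed
  have a_sums: "(\<lambda>n. a n * w ^ n) sums g w" if "norm w < R" for w
    using holomorphic_power_series[OF hol, of w] that by (simp add: a_def)
  have diff: "(\<lambda>n. (of_real (\<mu> n) - a n) * w ^ n) sums ((\<integral>x. exp (w * Y x) \<partial>N) - g w)"
    if "norm w < min (t 0) R" for w
    using sums_diff[OF \<mu>_sums a_sums, of w w] that by (simp add: algebra_simps)
  have zero: "(\<integral>x. exp (of_real (t j) * complex_of_real (Y x)) \<partial>N) - g (of_real (t j)) = 0" for j
  proof -
    have "(\<integral>x. exp (t j * Y x) \<partial>N) = G (t j)"
      using eq[of j] t(1,3)[of j] G(2)[of "t j"] by (subst integral_eq_nn_integral) auto
    then have "complex_of_real (\<integral>x. exp (t j * Y x) \<partial>N) = g (of_real (t j))"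
      using G(1) t by simp
    then show ?thesis
      unfolding integral_complex_of_real[symmetric] by (simp flip: exp_of_real)
  qed
  \<comment> \<open>If some coefficients differed, the difference of the two power series would have
    no zero in a punctured disc around 0, against its zeros at \<open>t j\<close>.\<close>
  have coeff: "of_real (\<mu> n) = a n" for n
  proof (rule ccontr)
    assume ne: "of_real (\<mu> n) \<noteq> a n"
    let ?c = "\<lambda>n. of_real (\<mu> n) - a n"
    let ?f = "\<lambda>w::complex. (\<integral>x. exp (w * Y x) \<partial>N) - g w"
    have R0: "0 < min (t 0) R" using t(1,3)[of 0] by auto
    have f0: "?f 0 = ?c 0"
      by (rule sums_unique2[OF diff powser_sums_zero]) (use R0 in auto)
    obtain e where e: "e > 0" "\<And>z. z \<in> cball 0 e - {0} \<Longrightarrow> ?f z \<noteq> 0"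
    proof (cases "?c 0 = 0")
      case True
      then have f00: "?f 0 = 0" using f0 by argo
      have n0: "0 < n" using True ne by (cases n) auto
      have df: "(\<lambda>n. ?c n * (w - 0) ^ n) sums ?f w" if "norm (w - 0) < min (t 0) R" for w
        using diff[of w] that by (simp only: diff_zero)
      have ne': "?c n \<noteq> 0" using ne by (simp only: right_minus_eq not_False_eq_True)
      show ?thesis
        by (rule powser_0_nonzero[OF R0 df f00 ne' n0]) (assumption, rule that)
    next
      case False
      have "?f holomorphic_on ball 0 (min (t 0) R)"
        by (rule power_series_holomorphic[of 0 _ ?c]) (use diff in auto)
      then have "continuous_on (ball 0 (min (t 0) R)) ?f" by (rule holomorphic_on_imp_continuous_on)
      moreover have "(0::complex) \<in> ball 0 (min (t 0) R)" using R0 by simp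
      ultimately have ic: "isCont ?f 0"
        using continuous_on_eq_continuous_at[OF open_ball] by blast
      have ne0: "?f 0 \<noteq> 0" using False unfolding f0 .
      have "\<forall>\<^sub>F z in at 0. ?f z \<noteq> 0"
        by (rule tendsto_imp_eventually_ne[OF ic[unfolded isCont_def] ne0])
      then obtain d where "d > 0" "\<And>z. z \<noteq> 0 \<Longrightarrow> dist z 0 < d \<Longrightarrow> ?f z \<noteq> 0"
        by (auto simp: eventually_at)
      then show ?thesis using that[of "d/2"] by (auto simp: dist_norm)
    qed
    obtain j where "t j < e" using order_tendstoD(2)[OF t(2) e(1)] eventually_happens by fastforce
    then have "?f (of_real (t j)) \<noteq> 0" using t(1)[of j] by (intro e(2)) (auto simp: dist_norm)
    then show False using zero[of j] by simp
  qed
  have "(\<lambda>n. of_real (\<mu> n) * complex_of_real s ^ n) sums complex_of_real (G s)"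
    using a_sums[of "of_real s"] s G(1)[of s] by (simp add: coeff)
  then have "(\<lambda>n. complex_of_real (\<mu> n * s ^ n)) sums complex_of_real (G s)" by simp
  then have sums: "(\<lambda>n. \<mu> n * s ^ n) sums G s" by (simp only: sums_of_real_iff)
  have int_n: "integrable N (\<lambda>x. Y x ^ n / fact n)" for n
  proof (rule Bochner_Integration.integrable_bound[OF integrable_mult_right[OF int0, of "inverse (t 0 ^ n)"]])
    show "AE x in N. norm (Y x ^ n / fact n) \<le> norm (inverse (t 0 ^ n) * exp (t 0 * Y x))"
    proof (rule AE_I2)
      fix x assume x: "x \<in> space N"
      have e: "(\<lambda>i. (t 0 * Y x) ^ i / fact i) sums exp (t 0 * Y x)"
        using exp_converges[of "t 0 * Y x"] by (simp add: field_simps)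
      have "(t 0 * Y x) ^ n / fact n \<le> exp (t 0 * Y x)"
        using sum_le_suminf[OF sums_summable[OF e], of "{n}"] sums_unique[OF e] Y[OF x] t(1)[of 0]
        by auto
      then show "norm (Y x ^ n / fact n) \<le> norm (inverse (t 0 ^ n) * exp (t 0 * Y x))"
        using t(1)[of 0] Y[OF x] by (simp add: power_mult_distrib field_simps)
    qed
  qed auto
  have "(\<integral>\<^sup>+ x. ennreal (exp (s * Y x)) \<partial>N) = (\<integral>\<^sup>+ x. (\<Sum>n. ennreal (Y x ^ n / fact n * s ^ n)) \<partial>N)"
  proof (intro nn_integral_cong)
    fix x assume x: "x \<in> space N"
    have e: "(\<lambda>i. Y x ^ i / fact i * s ^ i) sums exp (s * Y x)"
      using exp_converges[of "s * Y x"] by (simp add: field_simps power_mult_distrib)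
    then show "ennreal (exp (s * Y x)) = (\<Sum>n. ennreal (Y x ^ n / fact n * s ^ n))"
      using Y[OF x] s by (subst suminf_ennreal2) (auto simp: sums_iff)
  qed
  also have "\<dots> = (\<Sum>n. \<integral>\<^sup>+ x. ennreal (Y x ^ n / fact n * s ^ n) \<partial>N)"
    by (rule nn_integral_suminf) measurable
  also have "\<dots> = (\<Sum>n. ennreal (\<mu> n * s ^ n))"
  proof (intro suminf_cong)
    fix n
    show "(\<integral>\<^sup>+ x. ennreal (Y x ^ n / fact n * s ^ n) \<partial>N) = ennreal (\<mu> n * s ^ n)"
      unfolding \<mu>_def using Y s integrable_mult_left[OF int_n[of n], of "s ^ n"]
      by (subst nn_integral_eq_integral) (auto intro!: AE_I2)
  qed
  also have "\<dots> = ennreal (G s)"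
    using sums s Y by (subst suminf_ennreal2) (auto simp: sums_iff \<mu>_def intro!: mult_nonneg_nonneg Bochner_Integration.integral_nonneg)
  finally show ?thesis .
qed

section \<open>Volterra equations and scale functions\<close>

lemma AE_lborel_dense:
  fixes a b :: real
  assumes "AE x in lborel. P x" "a < b"
  shows "\<exists>x\<in>{a<..<b}. P x"
proof (rule ccontr)
  assume "\<not> ?thesis"
  then have "AE x in lborel. x \<notin> {a<..<b}"
    using assms(1) by (auto elim!: eventually_mono)
  then have "emeasure lborel {a<..<b} = 0"
    by (subst (asm) AE_iff_measurable[where N = "{a<..<b}"]) auto
  then show False using assms(2) by simp
qed

text \<open>Inverting a Laplace transform gives an identity almost everywhere; such sequences carry
  it to a prescribed point. The side matters where the objects are monotone or continuous from one
  side only.\<close>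

lemma AE_lborel_seq_above:
  fixes x :: real
  assumes "AE x in lborel. P x"
  obtains s where "\<And>n. P (s n)" "\<And>n. x < s n" "\<And>n::nat. s n < x + 1 / Suc n" "s \<longlonglongrightarrow> x"
proof -
  have "\<exists>y. P y \<and> x < y \<and> y < x + 1 / Suc n" for n :: nat
    using AE_lborel_dense[OF assms, of x "x + 1 / Suc n"] by auto
  then obtain s where s: "\<And>n::nat. P (s n) \<and> x < s n \<and> s n < x + 1 / Suc n" by metis
  have "(\<lambda>n. x + 1 / Suc n) \<longlonglongrightarrow> x + 0"
    by (intro tendsto_intros LIMSEQ_Suc lim_1_over_n)
  then have "s \<longlonglongrightarrow> x"
    by (intro tendsto_sandwich[of "\<lambda>_. x" s sequentially "\<lambda>n. x + 1 / Suc n" x] always_eventually)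
      (use s in \<open>auto intro: less_imp_le\<close>)
  then show thesis using s that by blast
qed

lemma AE_lborel_seq_below:
  fixes x :: real
  assumes "AE x in lborel. P x"
  obtains s where "\<And>n. P (s n)" "\<And>n. s n < x" "\<And>n::nat. x - 1 / Suc n < s n" "s \<longlonglongrightarrow> x"
proof -
  have "\<exists>y. P y \<and> y < x \<and> x - 1 / Suc n < y" for n :: nat
    using AE_lborel_dense[OF assms, of "x - 1 / Suc n" x] by auto
  then obtain s where s: "\<And>n::nat. P (s n) \<and> s n < x \<and> x - 1 / Suc n < s n" by metis
  have "(\<lambda>n. x - 1 / Suc n) \<longlonglongrightarrow> x - 0"
    by (intro tendsto_intros LIMSEQ_Suc lim_1_over_n)
  then have "s \<longlonglongrightarrow> x"
    by (intro tendsto_sandwich[of "\<lambda>n. x - 1 / Suc n" s sequentially "\<lambda>_. x" x] always_eventually)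
      (use s in \<open>auto intro: less_imp_le\<close>)
  then show thesis using s that by blast
qed

lemma nn_integral_lborel_shift:
  fixes f :: "real \<Rightarrow> ennreal"
  assumes [measurable]: "f \<in> borel_measurable borel"
  shows "(\<integral>\<^sup>+ x. f (x + a) \<partial>lborel) = (\<integral>\<^sup>+ x. f x \<partial>lborel)"
  using nn_integral_real_affine[of f 1 a] by (simp add: add.commute)

lemma laplace_transform_convolution:
  fixes g :: "real \<Rightarrow> ennreal" and U :: "real measure"
  assumes [measurable]: "g \<in> borel_measurable borel" and [measurable_cong]: "sets U = sets borel"
    and "sigma_finite_measure U"
  shows "(\<integral>\<^sup>+ x. ennreal (exp (- l * x)) * (\<integral>\<^sup>+ z. g (x - z) \<partial>U) \<partial>lborel) =
    (\<integral>\<^sup>+ z. ennreal (exp (- l * z)) \<partial>U) * (\<integral>\<^sup>+ x. ennreal (exp (- l * x)) * g x \<partial>lborel)"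
proof -
  interpret U: sigma_finite_measure U by fact
  interpret pair_sigma_finite lborel U ..
  have "(\<integral>\<^sup>+ x. ennreal (exp (- l * x)) * (\<integral>\<^sup>+ z. g (x - z) \<partial>U) \<partial>lborel) =
      (\<integral>\<^sup>+ x. (\<integral>\<^sup>+ z. ennreal (exp (- l * x)) * g (x - z) \<partial>U) \<partial>lborel)"
    by (intro nn_integral_cong nn_integral_cmult[symmetric]) measurable
  also have "\<dots> = (\<integral>\<^sup>+ z. (\<integral>\<^sup>+ x. ennreal (exp (- l * x)) * g (x - z) \<partial>lborel) \<partial>U)"
    by (rule Fubini'[symmetric]) measurable
  also have "\<dots> = (\<integral>\<^sup>+ z. ennreal (exp (- l * z)) * (\<integral>\<^sup>+ x. ennreal (exp (- l * x)) * g x \<partial>lborel) \<partial>U)"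
  proof (intro nn_integral_cong)
    fix z
    have "(\<integral>\<^sup>+ x. ennreal (exp (- l * x)) * g (x - z) \<partial>lborel) =
        (\<integral>\<^sup>+ x. ennreal (exp (- l * (x + z))) * g (x + z - z) \<partial>lborel)"
      by (rule nn_integral_lborel_shift[symmetric]) measurable
    also have "\<dots> = (\<integral>\<^sup>+ x. ennreal (exp (- l * z)) * (ennreal (exp (- l * x)) * g x) \<partial>lborel)"
    proof (intro nn_integral_cong)
      fix x
      have "exp (- l * (x + z)) = exp (- l * z) * exp (- l * x)"
        by (simp add: exp_add[symmetric] algebra_simps)
      then show "ennreal (exp (- l * (x + z))) * g (x + z - z) = ennreal (exp (- l * z)) * (ennreal (exp (- l * x)) * g x)"
        by (simp add: ennreal_mult' mult.assoc)
    qed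
    also have "\<dots> = ennreal (exp (- l * z)) * (\<integral>\<^sup>+ x. ennreal (exp (- l * x)) * g x \<partial>lborel)"
      by (rule nn_integral_cmult) measurable
    finally show "(\<integral>\<^sup>+ x. ennreal (exp (- l * x)) * g (x - z) \<partial>lborel) =
        ennreal (exp (- l * z)) * (\<integral>\<^sup>+ x. ennreal (exp (- l * x)) * g x \<partial>lborel)" .
  qed
  also have "\<dots> = (\<integral>\<^sup>+ z. ennreal (exp (- l * z)) \<partial>U) * (\<integral>\<^sup>+ x. ennreal (exp (- l * x)) * g x \<partial>lborel)"
    by (rule nn_integral_multc) measurable
  finally show ?thesis .
qed

text \<open>Made for convolutions: the kernel vanishes off the positive half-line, and the other
  factor is controlled only to the left of a fixed point.\<close>

lemma integrable_mult_bounded_on_support: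
  fixes f g :: "real \<Rightarrow> real"
  assumes "integrable lborel f" and [measurable]: "g \<in> borel_measurable borel"
    and "\<And>r. f r \<noteq> 0 \<Longrightarrow> \<bar>g r\<bar> \<le> B"
  shows "integrable lborel (\<lambda>r. f r * g r)"
proof (rule Bochner_Integration.integrable_bound[OF integrable_mult_right[OF assms(1), of B]])
  show "AE r in lborel. norm (f r * g r) \<le> norm (B * f r)"
  proof (rule AE_I2)
    fix r
    show "norm (f r * g r) \<le> norm (B * f r)"
    proof (cases "f r = 0")
      case False
      from assms(3)[OF this] have "\<bar>g r\<bar> \<le> \<bar>B\<bar>" by linarith
      then show ?thesis using mult_right_mono[of "\<bar>g r\<bar>" "\<bar>B\<bar>" "\<bar>f r\<bar>"] by (simp add: abs_mult mult.commute)
    qed simp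
  qed
  have [measurable]: "f \<in> borel_measurable borel" using assms(1) by (auto dest: borel_measurable_integrable)
  show "(\<lambda>r. f r * g r) \<in> borel_measurable lborel" by measurable
qed

lemma integrable_small_near_zero:
  fixes f :: "real \<Rightarrow> real"
  assumes "integrable lborel f" "0 < c"
  obtains d where "0 < d" "(\<integral>r. f r * indicator {0<..<d} r \<partial>lborel) < c"
proof -
  have [measurable]: "f \<in> borel_measurable borel" using assms(1) by (auto dest: borel_measurable_integrable)
  have "(\<lambda>n::nat. \<integral>r. f r * indicator {0<..<1 / Suc n} r \<partial>lborel) \<longlonglongrightarrow> (\<integral>r. 0 \<partial>(lborel :: real measure))"
  proof (rule integral_dominated_convergence[where w = "\<lambda>r. norm (f r)"])
    show "AE r in lborel. (\<lambda>n::nat. f r * indicator {0<..<1 / Suc n} r) \<longlonglongrightarrow> 0"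
    proof (rule AE_I2)
      fix r :: real
      show "(\<lambda>n::nat. f r * indicator {0<..<1 / Suc n} r) \<longlonglongrightarrow> 0"
      proof (cases "0 < r")
        case True
        then have "\<forall>\<^sub>F n in sequentially. 1 / Suc n < r"
          using order_tendstoD(2)[OF LIMSEQ_Suc[OF lim_1_over_n]] by simp
        then have "\<forall>\<^sub>F n in sequentially. f r * indicator {0<..<1 / Suc n} r = 0"
          by eventually_elim auto
        then show ?thesis by (rule tendsto_eventually)
      qed simp
    qed
    show "\<And>n. AE x in lborel. norm (f x * indicator {0<..<1 / real (Suc n)} x) \<le> norm (f x)"
      by (auto simp: indicator_def)
  qed (use assms in auto)
  then have "\<forall>\<^sub>F n in sequentially. (\<integral>r. f r * indicator {0<..<1 / Suc n} r \<partial>lborel) < c"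
    using assms(2) by (intro order_tendstoD(2)) auto
  then obtain n where "(\<integral>r. f r * indicator {0<..<1 / Suc n} r \<partial>lborel) < c"
    by (auto simp: eventually_sequentially)
  then show thesis by (intro that[of "1 / Suc n"]) auto
qed

text \<open>A maximum principle: at the first point where \<open>W x + W (v - x) - W v\<close> attains a negative
  minimum, the monotonicity of \<open>k\<close> contradicts that its image under \<open>c + k *\<close> is constant.\<close>

lemma volterra_solution_subadditive:
  fixes W k :: "real \<Rightarrow> real"
  assumes c: "0 < c" and k: "integrable lborel k" "\<And>r. r \<le> 0 \<Longrightarrow> k r = 0" "\<And>r. 0 \<le> k r"
      "\<And>r s. 0 < r \<Longrightarrow> r \<le> s \<Longrightarrow> k s \<le> k r"
    and W: "\<And>x. x \<le> 0 \<Longrightarrow> W x = 0" "mono W" "continuous_on UNIV W"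
    and eq: "\<And>v. 0 < v \<Longrightarrow> v < R \<Longrightarrow> c * W v + (\<integral>r. k r * W (v - r) \<partial>lborel) = v"
    and x: "0 \<le> x" "x \<le> v" "v < R"
  shows "W v \<le> W x + W (v - x)"
proof (rule ccontr)
  assume neg: "\<not> ?thesis"
  define e where "e v = W x + W (v - x) - W v" for v
  have e_cont: "continuous_on S e" for S
    unfolding e_def by (intro continuous_intros continuous_on_subset[OF W(3)] continuous_on_compose2[OF W(3)]) auto
  have [measurable]: "W \<in> borel_measurable borel" "e \<in> borel_measurable borel"
    using W(3) e_cont[of UNIV] by (auto intro: borel_measurable_continuous_onI)
  have Wnn: "0 \<le> W y" for y using W(1)[of 0] W(1)[of y] monoD[OF W(2), of 0 y] by (cases "y \<le> 0") auto
  obtain vm where vm: "vm \<in> {x..v}" "\<And>y. y \<in> {x..v} \<Longrightarrow> e vm \<le> e y"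
    using continuous_attains_inf[OF _ _ e_cont, of "{x..v}"] x by auto
  let ?S = "{x..v} \<inter> e -` {e vm}"
  have "compact ?S" "?S \<noteq> {}"
    using vm(1) compact_Int_closed[OF compact_Icc closed_vimage[OF closed_singleton e_cont]] by auto
  \<comment> \<open>Taking the first minimiser makes \<open>F\<close> strictly positive just to the
    left of \<open>v0\<close>.\<close>
  then obtain v0 where v0: "v0 \<in> ?S" "\<And>y. y \<in> ?S \<Longrightarrow> v0 \<le> y"
    using compact_attains_inf[of ?S] by blast
  have ev: "e vm < 0" using vm(2)[of v] neg x by (auto simp: e_def)
  have "e x = 0" using W(1)[of 0] by (simp add: e_def)
  then have v0x: "x < v0" "v0 \<le> v" "e v0 = e vm" using v0(1) ev by (auto simp: less_le)
  define F where "F y = e y - e v0" for y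
  have [measurable]: "F \<in> borel_measurable borel" unfolding F_def by measurable
  have F_cont: "continuous_on S F" for S unfolding F_def by (intro continuous_intros e_cont)
  have Fnn: "0 \<le> F y" if "y \<le> v" for y
  proof (cases "x \<le> y")
    case True
    then show ?thesis using vm(2)[of y] that v0x by (simp add: F_def)
  next
    case False
    then have "0 \<le> e y" using monoD[OF W(2), of y x] Wnn[of "y - x"] by (simp add: e_def)
    then show ?thesis using ev v0x by (simp add: F_def)
  qed
  have Fpos: "0 < F y" if "x \<le> y" "y < v0" for y
    using Fnn[of y] v0(2)[of y] that v0x by (fastforce simp: F_def less_le)
  define B where "B = 2 * W R + \<bar>e v0\<bar>"
  have FB: "\<bar>F y\<bar> \<le> B" if "y \<le> v" for y
  proof -
    have "W x \<le> W R" "W (y - x) \<le> W R" "W y \<le> W R" using that x by (auto intro!: monoD[OF W(2)])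
    then have "\<bar>e y\<bar> \<le> 2 * W R" using Wnn[of x] Wnn[of y] Wnn[of "y - x"] by (auto simp: e_def)
    then show ?thesis by (auto simp: F_def B_def)
  qed
  have int_kF: "integrable lborel (\<lambda>r. k r * F (y - r))" if "y \<le> v" for y
  proof (intro integrable_mult_bounded_on_support[OF k(1), where B = B] FB)
    fix r assume "k r \<noteq> 0"
    then have "0 < r" using k(2)[of r] by force
    then show "y - r \<le> v" using that by simp
  qed measurable
  have int_kW: "integrable lborel (\<lambda>r. k r * W (y - r))" if "y \<le> v" for y
  proof (intro integrable_mult_bounded_on_support[OF k(1), where B = "W R"])
    fix r assume "k r \<noteq> 0"
    then have "0 < r" using k(2)[of r] by force
    then show "\<bar>W (y - r)\<bar> \<le> W R" using Wnn monoD[OF W(2), of "y - r" R] that x by auto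
  qed auto
  have eq0: "c * W y + (\<integral>r. k r * W (y - r) \<partial>lborel) = y" if y: "0 \<le> y" "y \<le> v" for y
  proof (cases "y = 0")
    case True
    have "(\<lambda>r. k r * W (y - r)) = (\<lambda>_. 0)"
    proof
      fix r show "k r * W (y - r) = 0"
        using k(2)[of r] W(1)[of "y - r"] True by (cases "r \<le> 0") auto
    qed
    then show ?thesis using True W(1)[of 0] by simp
  next
    case False
    then show ?thesis using eq[of y] y x by auto
  qed
  \<comment> \<open>The operator sends \<open>W\<close> to the identity and the shift of
    \<open>W\<close> by \<open>x\<close> to the identity minus \<open>x\<close>, so the variable
    parts cancel and only constants survive.\<close>
  have const: "c * F y + (\<integral>r. k r * F (y - r) \<partial>lborel) =
      (c + (\<integral>r. k r \<partial>lborel)) * (W x - e v0) - x" if y: "x \<le> y" "y \<le> v" for y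
  proof -
    have "(\<integral>r. k r * F (y - r) \<partial>lborel) =
        (\<integral>r. (W x - e v0) * k r + k r * W ((y - x) - r) - k r * W (y - r) \<partial>lborel)"
      by (intro Bochner_Integration.integral_cong) (auto simp: F_def e_def algebra_simps)
    also have "\<dots> = (W x - e v0) * (\<integral>r. k r \<partial>lborel) + (\<integral>r. k r * W ((y - x) - r) \<partial>lborel)
        - (\<integral>r. k r * W (y - r) \<partial>lborel)"
      using k(1) int_kW[of "y - x"] int_kW[of y] y x
      by (subst Bochner_Integration.integral_diff, simp, simp, subst Bochner_Integration.integral_add) auto
    also have "\<dots> = (W x - e v0) * (\<integral>r. k r \<partial>lborel) + ((y - x) - c * W (y - x)) - (y - c * W y)"
      using eq0[of "y - x"] eq0[of y] y x by auto
    finally show ?thesis by (simp add: F_def e_def algebra_simps)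
  qed
  obtain d0 where d0: "0 < d0" "(\<integral>r. k r * indicator {0<..<d0} r \<partial>lborel) < c"
    using integrable_small_near_zero[OF k(1) c] .
  define d where "d = min (d0 / 2) (v0 - x)"
  have d: "0 < d" "d < d0" "d \<le> v0 - x" using d0 v0x by (auto simp: d_def)
  \<comment> \<open>\<open>v1\<close> maximises \<open>F\<close> on a short interval before
    \<open>v0\<close>. Comparing the constant at \<open>v0\<close> and at \<open>v1\<close> will
    bound \<open>c * F v1\<close> by \<open>F v1\<close> times the mass of \<open>k\<close> near 0,
    which is below \<open>c\<close>.\<close>
  obtain v1 where v1: "v1 \<in> {v0 - d..v0}" "\<And>y. y \<in> {v0 - d..v0} \<Longrightarrow> F y \<le> F v1"
    using continuous_attains_sup[OF _ _ F_cont, of "{v0 - d..v0}"] d by auto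
  have Fv1: "0 < F v1" using Fpos[of "v0 - d"] v1(2)[of "v0 - d"] d by auto
  have "v1 \<noteq> v0" using Fv1 by (auto simp: F_def)
  define h where "h = v0 - v1"
  have h: "0 < h" "h < d0" using \<open>v1 \<noteq> v0\<close> v1(1) d by (auto simp: h_def)
  have int_shift: "integrable lborel (\<lambda>r. k (r - h) * F (v0 - r))"
    "(\<integral>r. k (r - h) * F (v0 - r) \<partial>lborel) = (\<integral>r. k r * F (v1 - r) \<partial>lborel)"
    using lborel_integrable_real_affine[OF int_kF[of v1], of 1 "- h"]
      lborel_integral_real_affine[of 1 "\<lambda>r. k r * F (v1 - r)" "- h"] v1(1) v0x
    by (auto simp: h_def algebra_simps)
  have "c * F v1 = (\<integral>r. k r * F (v0 - r) \<partial>lborel) - (\<integral>r. k r * F (v1 - r) \<partial>lborel)"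
    using const[of v0] const[of v1] v0x v1(1) d by (auto simp: F_def)
  also have "\<dots> = (\<integral>r. k r * F (v0 - r) - k (r - h) * F (v0 - r) \<partial>lborel)"
    using int_shift int_kF[of v0] v0x by simp
  also have "\<dots> \<le> (\<integral>r. F v1 * (k r * indicator {0<..<d0} r) \<partial>lborel)"
  proof (rule integral_mono)
    show "integrable lborel (\<lambda>r. k r * F (v0 - r) - k (r - h) * F (v0 - r))"
      using int_shift int_kF[of v0] v0x by simp
    show "integrable lborel (\<lambda>r. F v1 * (k r * indicator {0<..<d0} r))"
      by (intro integrable_mult_right integrable_mult_bounded_on_support[OF k(1), where B = 1]) (auto simp: indicator_def)
    \<comment> \<open>With both integrals written in the variable of \<open>v0\<close>, the part
      beyond \<open>h\<close> is nonpositive since \<open>k\<close> decreases and \<open>F\<close>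
      is nonnegative; below \<open>h\<close> only \<open>k r * F (v0 - r)\<close> is left, and there
      \<open>F v1\<close> is the maximum.\<close>
    fix r
    consider "r \<le> 0" | "0 < r" "r \<le> h" | "h < r" by linarith
    then show "k r * F (v0 - r) - k (r - h) * F (v0 - r) \<le> F v1 * (k r * indicator {0<..<d0} r)"
    proof cases
      case 1
      then show ?thesis using k(2)[of r] k(2)[of "r - h"] h by auto
    next
      case 2
      then have "v0 - r \<in> {v0 - d..v0}" using v1(1) by (auto simp: h_def)
      then have "k r * F (v0 - r) \<le> k r * F v1" by (intro mult_left_mono v1(2) k(3))
      then show ?thesis using 2 k(2)[of "r - h"] h by (auto simp: mult.commute)
    next
      case 3
      then have "k r * F (v0 - r) \<le> k (r - h) * F (v0 - r)"
        using h v0x by (intro mult_right_mono k(4) Fnn) auto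
      moreover have "0 \<le> F v1 * (k r * indicator {0<..<d0} r)" using Fv1 k(3) by auto
      ultimately show ?thesis by linarith
    qed
  qed
  also have "\<dots> = F v1 * (\<integral>r. k r * indicator {0<..<d0} r \<partial>lborel)" by simp
  also have "\<dots> < F v1 * c" using d0(2) Fv1 by (intro mult_strict_left_mono)
  finally show False by simp
qed

section \<open>Elementary exponential integrals and sums of measures\<close>

lemma exp_second_order_bounds:
  fixes u :: real
  assumes "0 \<le> u"
  shows "0 \<le> exp (- u) - 1 + u" "exp (- u) - 1 + u \<le> u" "exp (- u) - 1 + u \<le> u\<^sup>2"
proof -
  show "0 \<le> exp (- u) - 1 + u" using exp_ge_add_one_self[of "- u"] by simp
  show "exp (- u) - 1 + u \<le> u" using assms by simp
  have "exp (- u) \<le> 1 / (1 + u)"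
    using exp_ge_add_one_self[of u] assms by (simp add: exp_minus field_simps)
  also have "\<dots> \<le> 1 - u + u\<^sup>2"
    using assms by (simp add: field_simps power2_eq_square)
  finally show "exp (- u) - 1 + u \<le> u\<^sup>2" by simp
qed

lemma nn_integral_exp_linear:
  fixes l y :: real
  assumes l: "0 < l" and y: "0 < y"
  shows "(\<integral>\<^sup>+ z. ennreal (exp (- l * z)) * (ennreal (y - z) * indicator {0..} z) \<partial>lborel)
    = ennreal ((exp (- l * y) - 1 + l * y) / l\<^sup>2)"
proof -
  let ?G = "\<lambda>z. exp (- l * z) * (1 / l\<^sup>2 - (y - z) / l)"
  have "(\<integral>\<^sup>+ z. ennreal (exp (- l * z)) * (ennreal (y - z) * indicator {0..} z) \<partial>lborel) =
      (\<integral>\<^sup>+ z. ennreal (exp (- l * z) * (y - z)) * indicator {0..y} z \<partial>lborel)"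
    by (intro nn_integral_cong) (auto simp: indicator_def ennreal_mult'[symmetric] ennreal_neg)
  also have "\<dots> = ennreal (?G y - ?G 0)"
  proof (rule nn_integral_FTC_Icc)
    fix z :: real
    show "(?G has_real_derivative exp (- l * z) * (y - z)) (at z)" if "z \<in> {0..y}"
      using l by (auto intro!: derivative_eq_intros simp: field_simps power2_eq_square)
  qed (use y in auto)
  also have "?G y - ?G 0 = (exp (- l * y) - 1 + l * y) / l\<^sup>2"
    using l by (simp add: field_simps power2_eq_square)
  finally show ?thesis .
qed

text \<open>The resolvent equation is stated with \<open>W\<close> added on the left, so that
  uniqueness of transforms is used for measures and never for a difference of measures.\<close>

definition add_measure :: "'a measure \<Rightarrow> 'a measure \<Rightarrow> 'a measure" where
  "add_measure M N = measure_of (space M) (sets M) (\<lambda>A. emeasure M A + emeasure N A)"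

lemma sets_add_measure [simp, measurable_cong]: "sets (add_measure M N) = sets M"
  by (simp add: add_measure_def)

lemma space_add_measure [simp]: "space (add_measure M N) = space M"
  by (simp add: add_measure_def)

lemma emeasure_add_measure:
  assumes "sets M = sets N" "A \<in> sets M"
  shows "emeasure (add_measure M N) A = emeasure M A + emeasure N A"
  unfolding add_measure_def
proof (rule emeasure_measure_of_sigma)
  show "sigma_algebra (space M) (sets M)" ..
  show "positive (sets M) (\<lambda>A. emeasure M A + emeasure N A)"
    by (simp add: positive_def)
  show "countably_additive (sets M) (\<lambda>A. emeasure M A + emeasure N A)"
  proof (rule countably_additiveI)
    fix A :: "nat \<Rightarrow> 'a set"
    assume A: "range A \<subseteq> sets M" "disjoint_family A"
    then show "(\<Sum>i. emeasure M (A i) + emeasure N (A i)) = emeasure M (\<Union>i. A i) + emeasure N (\<Union>i. A i)"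
      using assms(1) by (simp add: suminf_add[symmetric] suminf_emeasure)
  qed
qed fact

lemma nn_integral_add_measure:
  assumes sets: "sets M = sets N" and "f \<in> borel_measurable M"
  shows "(\<integral>\<^sup>+ x. f x \<partial>add_measure M N) = (\<integral>\<^sup>+ x. f x \<partial>M) + (\<integral>\<^sup>+ x. f x \<partial>N)"
  using assms(2)
proof (induction rule: borel_measurable_induct)
  case (cong f g)
  have sp: "space M = space N" using sets by (rule sets_eq_imp_space_eq)
  have "(\<integral>\<^sup>+ x. f x \<partial>A) = (\<integral>\<^sup>+ x. g x \<partial>A)" if "space A = space M" for A
    using cong(3) that by (intro nn_integral_cong) simp
  from this[of M] this[of N] this[of "add_measure M N"] sp cong(4) show ?case by simp
next
  case (set A)
  then show ?case using sets by (simp add: emeasure_add_measure)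
next
  case (mult u v)
  have [measurable_cong]: "sets N = sets M" using sets by simp
  note [measurable] = mult(2)
  show ?case using mult(4) by (simp add: nn_integral_cmult distrib_left)
next
  case (add u v)
  have [measurable_cong]: "sets N = sets M" using sets by simp
  note [measurable] = add(1,3)
  show ?case using add by (simp add: nn_integral_add add_ac)
next
  case (seq U)
  have [measurable_cong]: "sets N = sets M" using sets by simp
  note [measurable] = seq(1)
  have inc: "incseq (\<lambda>i. \<integral>\<^sup>+ x. U i x \<partial>A)" for A
    using seq(3) by (auto simp: incseq_def le_fun_def intro: nn_integral_mono)
  have sup: "(\<integral>\<^sup>+ x. (SUP i. U i) x \<partial>A) = (SUP i. \<integral>\<^sup>+ x. U i x \<partial>A)" if "sets A = sets M" for A
  proof -
    have "U i \<in> borel_measurable A" for i using seq(1) that by (simp cong: measurable_cong_sets)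
    then show ?thesis
      using nn_integral_monotone_convergence_SUP[OF seq(3)] by (simp add: SUP_apply[abs_def] image_comp)
  qed
  have "(\<integral>\<^sup>+ x. (SUP i. U i) x \<partial>add_measure M N) = (SUP i. \<integral>\<^sup>+ x. U i x \<partial>add_measure M N)"
    by (rule sup) simp
  also have "\<dots> = (SUP i. (\<integral>\<^sup>+ x. U i x \<partial>M) + (\<integral>\<^sup>+ x. U i x \<partial>N))"
    using seq.IH by simp
  also have "\<dots> = (SUP i. \<integral>\<^sup>+ x. U i x \<partial>M) + (SUP i. \<integral>\<^sup>+ x. U i x \<partial>N)"
    by (rule ennreal_SUP_add[OF inc inc])
  also have "\<dots> = (\<integral>\<^sup>+ x. (SUP i. U i) x \<partial>M) + (\<integral>\<^sup>+ x. (SUP i. U i) x \<partial>N)"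
    using sup[of M] sup[of N] sets by simp
  finally show ?case .
qed

lemma nn_integral_exp_decay:
  assumes "0 < (l::real)"
  shows "(\<integral>\<^sup>+ x. ennreal (exp (- l * x)) * indicator {0..} x \<partial>lborel) = ennreal (1 / l)"
proof -
  have "(\<integral>\<^sup>+ x. ennreal (exp (- l * x)) * indicator {0..} x \<partial>lborel) = ennreal (0 - (- exp (- l * 0) / l))"
  proof (rule nn_integral_FTC_atLeast)
    show "((\<lambda>x. - exp (- l * x) / l) \<longlongrightarrow> 0) at_top" using assms by real_asymp
  qed (use assms in \<open>auto intro!: derivative_eq_intros\<close>)
  then show ?thesis by simp
qed

lemma nn_integral_exp_decay_linear:
  assumes "0 < (l::real)"
  shows "(\<integral>\<^sup>+ x. ennreal (exp (- l * x)) * ennreal x \<partial>lborel) = ennreal (1 / l\<^sup>2)"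
proof -
  let ?F = "\<lambda>x. - exp (- l * x) * (x / l + 1 / l\<^sup>2)"
  have "(\<integral>\<^sup>+ x. ennreal (exp (- l * x)) * ennreal x \<partial>lborel) =
      (\<integral>\<^sup>+ x. ennreal (exp (- l * x) * x) * indicator {0..} x \<partial>lborel)"
    by (intro nn_integral_cong)
      (auto simp: indicator_def ennreal_mult'[symmetric] ennreal_eq_0_iff mult_le_0_iff)
  also have "\<dots> = ennreal (0 - ?F 0)"
  proof (rule nn_integral_FTC_atLeast)
    show "(?F \<longlongrightarrow> 0) at_top" using assms by real_asymp
    show "(?F has_real_derivative exp (- l * x) * x) (at x)" for x
      using assms by (auto intro!: derivative_eq_intros simp: field_simps power2_eq_square)
  qed auto
  finally show ?thesis by simp
qed

section \<open>Scale functions: Volterra equation and subadditivity\<close>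

locale scale =
  fixes b c :: real and \<nu> :: "real measure" and W :: "real \<Rightarrow> real"
  assumes b_nonneg: "0 \<le> b" and c_pos: "0 < c"
    and jump: "jump_measure \<nu>" and scale: "scale_function b c \<nu> W"
begin

text \<open>The measure \<nu> lives on the trace sigma-algebra of the positive half-line. Its image
  on the whole line has the same measurable sets as the other measures in the Tonelli
  arguments.\<close>

definition nu :: "real measure" where "nu = distr \<nu> borel (\<lambda>y. y)"

lemma sets_nu [simp, measurable_cong]: "sets nu = sets borel" by (simp add: nu_def)

lemma space_nu [simp]: "space nu = UNIV" by (simp add: nu_def)

lemma id_measurable: "(\<lambda>y. y) \<in> measurable \<nu> borel"
proof -
  have "sets \<nu> = sets (restrict_space borel {0<..})" using jump by (simp add: jump_measure_def)
  then show ?thesis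
    by (subst measurable_cong_sets[OF _ refl, of \<nu> "restrict_space borel {0<..}"])
      (auto intro: measurable_restrict_space1)
qed

lemma nn_integral_nu:
  assumes [measurable]: "f \<in> borel_measurable borel"
  shows "(\<integral>\<^sup>+ y. f y \<partial>nu) = (\<integral>\<^sup>+ y. f y \<partial>\<nu>)"
  unfolding nu_def by (subst nn_integral_distr[OF id_measurable]) auto

lemma AE_nu_pos: "AE y in nu. 0 < y"
proof -
  have "space \<nu> = {0<..}"
    using jump sets_eq_imp_space_eq[of \<nu> "restrict_space borel {0<..}"]
    by (simp add: jump_measure_def space_restrict_space)
  then show ?thesis
    unfolding nu_def by (subst AE_distr_iff[OF id_measurable]) (auto intro: AE_I2)
qed

definition J :: ennreal where "J = (\<integral>\<^sup>+ y. ennreal (min y (y\<^sup>2)) \<partial>nu)"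

lemma J_finite: "J < \<infinity>"
  using jump unfolding J_def jump_measure_def by (subst nn_integral_nu) auto

lemma nu_integral_le:
  assumes "\<And>y. 0 < y \<Longrightarrow> g y \<le> K * min y (y\<^sup>2)" "0 \<le> K"
  shows "(\<integral>\<^sup>+ y. ennreal (g y) \<partial>nu) \<le> ennreal K * J"
proof -
  have "(\<integral>\<^sup>+ y. ennreal (g y) \<partial>nu) \<le> (\<integral>\<^sup>+ y. ennreal K * ennreal (min y (y\<^sup>2)) \<partial>nu)"
    using AE_nu_pos
    by (intro nn_integral_mono_AE, eventually_elim)
      (auto simp: ennreal_mult'[symmetric] assms intro!: ennreal_leI)
  also have "\<dots> = ennreal K * J" unfolding J_def by (rule nn_integral_cmult) auto
  finally show ?thesis .
qed

lemma nu_integral_finite: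
  assumes "\<And>y. 0 < y \<Longrightarrow> g y \<le> K * min y (y\<^sup>2)" "0 \<le> K"
  shows "(\<integral>\<^sup>+ y. ennreal (g y) \<partial>nu) < \<infinity>"
  using nu_integral_le[OF assms] J_finite
  by (metis ennreal_less_top ennreal_mult_less_top infinity_ennreal_def order_le_less_trans)

sublocale nu: sigma_finite_measure nu
proof
  \<comment> \<open>Away from 0 the integrand \<open>min y (y\<^sup>2)\<close> is at least the
    inverse square of \<open>Suc n\<close>, so the measure is finite there; the null half-line
    \<open>{..0}\<close> is added to exhaust the line.\<close>
  let ?B = "\<lambda>n::nat. {..0} \<union> {1 / Suc n<..} :: real set"
  have "emeasure nu (?B n) < \<infinity>" for n
  proof -
    have "emeasure nu (?B n) = (\<integral>\<^sup>+ y. ennreal (indicator (?B n) y) \<partial>nu)"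
      by (simp add: ennreal_indicator)
    also have "\<dots> < \<infinity>"
    proof (rule nu_integral_finite[where K = "(Suc n)\<^sup>2"])
      fix y :: real assume y: "0 < y"
      show "indicat_real (?B n) y \<le> real ((Suc n)\<^sup>2) * min y (y\<^sup>2)"
      proof (cases "1 / Suc n < y")
        case True
        then have 1: "1 \<le> real (Suc n) * y" by (simp add: field_simps)
        then have "1 \<le> (real (Suc n) * y)\<^sup>2" by simp
        then have 2: "1 \<le> real ((Suc n)\<^sup>2) * y\<^sup>2" by (simp only: of_nat_power power_mult_distrib)
        have "1 * 1 \<le> real (Suc n) * (real (Suc n) * y)" using 1 by (intro mult_mono) auto
        then have "1 \<le> real ((Suc n)\<^sup>2) * y"
          by (simp only: of_nat_power of_nat_mult power2_eq_square mult.assoc mult_1)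
        with 2 have "1 \<le> real ((Suc n)\<^sup>2) * min y (y\<^sup>2)"
          by (cases "y \<le> y\<^sup>2") (simp_all only: min_def if_True if_False)
        then show ?thesis by (rule order_trans[OF indicator_le_1])
      qed (use y in \<open>auto simp: indicator_def\<close>)
    qed simp
    finally show ?thesis .
  qed
  moreover have "(\<Union>n. ?B n) = UNIV"
  proof -
    have "\<exists>n::nat. y \<in> ?B n" for y
      using reals_Archimedean[of y] by (cases "0 < y") (auto simp: inverse_eq_divide)
    then show ?thesis by blast
  qed
  ultimately show "\<exists>A. countable A \<and> A \<subseteq> sets nu \<and> \<Union> A = space nu \<and> (\<forall>a\<in>A. emeasure nu a \<noteq> \<infinity>)"
    by (intro exI[of _ "range ?B"]) (auto simp: less_top[symmetric])
qed

abbreviation \<Phi> :: "real \<Rightarrow> real" where "\<Phi> \<equiv> laplace_exponent b c \<nu>"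

lemma exp_jump_le:
  fixes l y :: real
  assumes "0 \<le> l" "0 < y"
  shows "exp (- l * y) - 1 + l * y \<le> max l (l\<^sup>2) * min y (y\<^sup>2)"
proof -
  have "exp (- l * y) - 1 + l * y \<le> l * y" "exp (- l * y) - 1 + l * y \<le> l\<^sup>2 * y\<^sup>2"
    using exp_second_order_bounds[of "l * y"] assms by (auto simp: power_mult_distrib)
  moreover have "l * y \<le> max l (l\<^sup>2) * y" "l\<^sup>2 * y\<^sup>2 \<le> max l (l\<^sup>2) * y\<^sup>2"
    using assms by (auto intro: mult_right_mono)
  ultimately show ?thesis
    by (cases "y \<le> y\<^sup>2"; simp only: min_def if_True if_False; linarith)
qed

lemma jump_part_finite:
  assumes "0 \<le> l"
  shows "(\<integral>\<^sup>+ y. ennreal (exp (- l * y) - 1 + l * y) \<partial>nu) < \<infinity>"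
  using assms by (intro nu_integral_finite[OF exp_jump_le]) (auto simp: le_max_iff_disj)

lemma jump_part_eq:
  assumes "0 \<le> l"
  shows "ennreal (\<integral> y. (exp (- l * y) - 1 + l * y) \<partial>\<nu>) = (\<integral>\<^sup>+ y. ennreal (exp (- l * y) - 1 + l * y) \<partial>nu)"
proof -
  have m: "(\<lambda>y. exp (- l * y) - 1 + l * y) \<in> borel_measurable \<nu>"
    by (rule measurable_compose[OF id_measurable]) measurable
  have nn: "0 \<le> exp (- l * y) - 1 + l * y" for y
    using exp_ge_add_one_self[of "- l * y"] by simp
  have eq: "(\<integral>\<^sup>+ y. ennreal (exp (- l * y) - 1 + l * y) \<partial>\<nu>) = (\<integral>\<^sup>+ y. ennreal (exp (- l * y) - 1 + l * y) \<partial>nu)"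
    by (rule nn_integral_nu[symmetric]) measurable
  have "(\<integral> y. (exp (- l * y) - 1 + l * y) \<partial>\<nu>) = enn2real (\<integral>\<^sup>+ y. ennreal (exp (- l * y) - 1 + l * y) \<partial>\<nu>)"
    using m nn by (intro integral_eq_nn_integral) auto
  then show ?thesis
    unfolding eq using jump_part_finite[OF assms] by (simp add: less_top)
qed

lemma jump_part_nonneg: "0 \<le> (\<integral> y. (exp (- l * y) - 1 + l * y) \<partial>\<nu>)"
proof (rule Bochner_Integration.integral_nonneg)
  show "0 \<le> exp (- l * y) - 1 + l * y" for y
    using exp_ge_add_one_self[of "- l * y"] by simp
qed

lemma Phi_ge: "0 \<le> l \<Longrightarrow> c * l\<^sup>2 \<le> \<Phi> l"
  unfolding laplace_exponent_def using b_nonneg jump_part_nonneg[of l] by auto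

lemma Phi_pos: "0 < l \<Longrightarrow> 0 < \<Phi> l"
  using Phi_ge[of l] c_pos by (smt (verit) mult_pos_pos zero_less_power)

lemma Phi_le:
  assumes "0 \<le> l" "l \<le> 1"
  shows "\<Phi> l \<le> (b + c + enn2real J) * l"
proof -
  have ll: "l\<^sup>2 \<le> l" using assms by (simp add: power2_eq_square mult_left_le)
  have "ennreal (\<integral> y. (exp (- l * y) - 1 + l * y) \<partial>\<nu>) \<le> ennreal l * J"
    unfolding jump_part_eq[OF assms(1)] using exp_jump_le[OF assms(1)] ll assms
    by (intro nu_integral_le) (auto simp: max_def)
  also have "\<dots> = ennreal (l * enn2real J)"
    using J_finite assms by (subst ennreal_mult) (auto simp: less_top)
  finally have "(\<integral> y. (exp (- l * y) - 1 + l * y) \<partial>\<nu>) \<le> l * enn2real J"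
    using assms by (subst (asm) ennreal_le_iff) auto
  moreover have "c * l\<^sup>2 \<le> c * l" using ll c_pos by simp
  ultimately show ?thesis unfolding laplace_exponent_def by (simp add: algebra_simps)
qed

text \<open>Provides the interval on which the two-sided transform of the resolvent is finite, hence
  the strip for uniqueness.\<close>

lemma Phi_small:
  assumes "0 < q"
  obtains l0 where "0 < l0" "\<And>l. 0 < l \<Longrightarrow> l < l0 \<Longrightarrow> \<Phi> l < q"
proof -
  define K where "K = b + c + enn2real J"
  have K: "0 < K" using b_nonneg c_pos by (simp add: K_def add_pos_nonneg add_nonneg_pos)
  show thesis
  proof (rule that[of "min 1 (q / K)"])
    fix l assume l: "0 < l" "l < min 1 (q / K)"
    then have "\<Phi> l \<le> K * l" using Phi_le[of l] by (simp add: K_def)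
    also have "K * l < q" using l K by (simp add: field_simps)
    finally show "\<Phi> l < q" .
  qed (use assms K in auto)
qed

text \<open>Because \<open>ennreal\<close> truncates, the integrand is the positive part of
  \<open>y - z\<close>, and for \<open>z \<ge> 0\<close> the integral is the integrated tail of
  \<nu> beyond \<open>z\<close>. The value at 0 may be infinite.\<close>

definition kk :: "real \<Rightarrow> ennreal" where
  "kk z = ennreal b + (\<integral>\<^sup>+ y. ennreal (y - z) \<partial>nu)"

lemma kk_measurable [measurable]: "kk \<in> borel_measurable borel"
  unfolding kk_def by measurable

lemma kk_antimono: "r \<le> s \<Longrightarrow> kk s \<le> kk r"
  unfolding kk_def by (intro add_left_mono nn_integral_mono ennreal_leI) auto

lemma kk_finite:
  assumes "0 < z"
  shows "kk z < \<infinity>"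
proof -
  have "(\<integral>\<^sup>+ y. ennreal (y - z) \<partial>nu) < \<infinity>"
  proof (rule nu_integral_finite[where K = "max 1 (1 / z)"])
    fix y :: real assume y: "0 < y"
    show "y - z \<le> max 1 (1 / z) * min y (y\<^sup>2)"
    proof (cases "y \<le> z")
      case True
      have "0 \<le> max 1 (1 / z) * min y (y\<^sup>2)" using y by auto
      then show ?thesis using True by linarith
    next
      case False
      have "y - z \<le> 1 * y" "1 * y \<le> max 1 (1 / z) * y" using assms y by (auto intro: mult_right_mono)
      moreover have "y \<le> 1 / z * y\<^sup>2" using False assms y by (simp add: field_simps power2_eq_square)
      moreover have "1 / z * y\<^sup>2 \<le> max 1 (1 / z) * y\<^sup>2" by (intro mult_right_mono) auto
      ultimately show ?thesis using assms by (auto simp: min_def)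
    qed
  qed auto
  then show ?thesis by (simp add: kk_def)
qed

text \<open>Division of \<open>\<Phi> l\<close> by \<open>l\<^sup>2\<close> turns the Gaussian part
  into a point mass \<open>c\<close> at 0, the linear part into a constant density and each jump
  \<open>y\<close> into the ramp \<open>y - z\<close> on \<open>{0..y}\<close>. All of these
  densities decrease, which is where the monotone Volterra kernel comes from.\<close>

lemma kk_laplace:
  assumes l: "0 < l"
  shows "ennreal c + (\<integral>\<^sup>+ z. ennreal (exp (- l * z)) * (kk z * indicator {0..} z) \<partial>lborel) = ennreal (\<Phi> l / l\<^sup>2)"
proof -
  interpret pair_sigma_finite lborel nu ..
  have "(\<integral>\<^sup>+ z. ennreal (exp (- l * z)) * (kk z * indicator {0..} z) \<partial>lborel) =
      (\<integral>\<^sup>+ z. ennreal b * (ennreal (exp (- l * z)) * indicator {0..} z) +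
        (\<integral>\<^sup>+ y. ennreal (exp (- l * z)) * (ennreal (y - z) * indicator {0..} z) \<partial>nu) \<partial>lborel)"
  proof (intro nn_integral_cong)
    fix z :: real
    have "(\<integral>\<^sup>+ y. E * (ennreal (y - z) * I) \<partial>nu) = E * ((\<integral>\<^sup>+ y. ennreal (y - z) \<partial>nu) * I)" for E I :: ennreal
      by (simp add: nn_integral_cmult nn_integral_multc)
    note eq = this[of "ennreal (exp (- l * z))" "indicator {0..} z"]
    show "ennreal (exp (- l * z)) * (kk z * indicator {0..} z) =
        ennreal b * (ennreal (exp (- l * z)) * indicator {0..} z) +
        (\<integral>\<^sup>+ y. ennreal (exp (- l * z)) * (ennreal (y - z) * indicator {0..} z) \<partial>nu)"
      unfolding eq kk_def by (simp add: distrib_left distrib_right mult_ac)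
  qed
  also have "\<dots> = ennreal b * ennreal (1 / l) +
      (\<integral>\<^sup>+ z. (\<integral>\<^sup>+ y. ennreal (exp (- l * z)) * (ennreal (y - z) * indicator {0..} z) \<partial>nu) \<partial>lborel)"
  proof (rule trans[OF nn_integral_add])
    have "(\<integral>\<^sup>+ z. ennreal b * (ennreal (exp (- l * z)) * indicator {0..} z) \<partial>lborel) = ennreal b * ennreal (1 / l)"
      unfolding nn_integral_exp_decay[OF l, symmetric] by (rule nn_integral_cmult) measurable
    then show "(\<integral>\<^sup>+ z. ennreal b * (ennreal (exp (- l * z)) * indicator {0..} z) \<partial>lborel) +
        (\<integral>\<^sup>+ z. (\<integral>\<^sup>+ y. ennreal (exp (- l * z)) * (ennreal (y - z) * indicator {0..} z) \<partial>nu) \<partial>lborel) =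
        ennreal b * ennreal (1 / l) +
        (\<integral>\<^sup>+ z. (\<integral>\<^sup>+ y. ennreal (exp (- l * z)) * (ennreal (y - z) * indicator {0..} z) \<partial>nu) \<partial>lborel)"
      by (simp only:)
  qed measurable
  also have "(\<integral>\<^sup>+ z. (\<integral>\<^sup>+ y. ennreal (exp (- l * z)) * (ennreal (y - z) * indicator {0..} z) \<partial>nu) \<partial>lborel) =
      (\<integral>\<^sup>+ y. (\<integral>\<^sup>+ z. ennreal (exp (- l * z)) * (ennreal (y - z) * indicator {0..} z) \<partial>lborel) \<partial>nu)"
    by (rule Fubini'[symmetric]) measurable
  also have "\<dots> = (\<integral>\<^sup>+ y. ennreal (1 / l\<^sup>2) * ennreal (exp (- l * y) - 1 + l * y) \<partial>nu)"
    using AE_nu_pos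
  proof (intro nn_integral_cong_AE, eventually_elim)
    fix y :: real assume "0 < y"
    then show "(\<integral>\<^sup>+ z. ennreal (exp (- l * z)) * (ennreal (y - z) * indicator {0..} z) \<partial>lborel) =
        ennreal (1 / l\<^sup>2) * ennreal (exp (- l * y) - 1 + l * y)"
      using nn_integral_exp_linear[OF l, of y] exp_ge_add_one_self[of "- l * y"]
      by (simp add: ennreal_mult'[symmetric])
  qed
  also have "\<dots> = ennreal (1 / l\<^sup>2) * ennreal (\<integral> y. (exp (- l * y) - 1 + l * y) \<partial>\<nu>)"
    unfolding jump_part_eq[OF less_imp_le[OF l]] by (rule nn_integral_cmult) measurable
  finally have "ennreal c + (\<integral>\<^sup>+ z. ennreal (exp (- l * z)) * (kk z * indicator {0..} z) \<partial>lborel) =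
      ennreal c + (ennreal b * ennreal (1 / l) + ennreal (1 / l\<^sup>2) * ennreal (\<integral> y. (exp (- l * y) - 1 + l * y) \<partial>\<nu>))"
    by simp
  also have "\<dots> = ennreal (c + (b * (1 / l) + 1 / l\<^sup>2 * (\<integral> y. (exp (- l * y) - 1 + l * y) \<partial>\<nu>)))"
    using b_nonneg c_pos l jump_part_nonneg[of l] by (simp add: ennreal_mult'[symmetric] ennreal_plus[symmetric] del: ennreal_plus)
  also have "c + (b * (1 / l) + 1 / l\<^sup>2 * (\<integral> y. (exp (- l * y) - 1 + l * y) \<partial>\<nu>)) = \<Phi> l / l\<^sup>2"
    using l unfolding laplace_exponent_def by (simp add: field_simps power2_eq_square)
  finally show ?thesis .
qed

lemma W_laplace_real:
  assumes "0 < l"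
  shows "integrable lborel (\<lambda>x. indicator {0..} x * (exp (- l * x) * W x))"
    "(\<integral>x. indicator {0..} x * (exp (- l * x) * W x) \<partial>lborel) = 1 / \<Phi> l"
  using scale assms by (auto simp: scale_function_def set_integrable_def set_lebesgue_integral_def)

lemma W_neg: "x < 0 \<Longrightarrow> W x = 0"
  using scale by (simp add: scale_function_def)

lemma W_less: "0 \<le> x \<Longrightarrow> x < y \<Longrightarrow> W x < W y"
  using scale by (auto simp: scale_function_def strict_mono_on_def)

text \<open>The value at 0 is decided by \<open>c > 0\<close>: since \<open>\<Phi> l\<close> is at
  least \<open>c * l\<^sup>2\<close>, \<open>l\<close> times the transform of \<open>W\<close> tends
  to 0. For \<open>V\<close>, the excess of \<open>W\<close> over \<open>W 0\<close>, the
  corresponding limit is \<open>- W 0\<close>, and it is squeezed between 0 and \<open>V d\<close>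
  for every \<open>d > 0\<close>.\<close>

lemma W_zero: "W 0 = 0"
proof -
  define V where "V x = indicator {0..} x * (W x - W 0)" for x
  have V_nn: "0 \<le> V x" for x using W_less[of 0 x] by (cases "x = 0") (auto simp: V_def indicator_def)
  have V_mono: "V x \<le> V y" if "x \<le> y" for x y
    using W_less[of x y] W_less[of 0 y] that
    by (cases "x = y"; cases "x < 0"; cases "y = 0") (auto simp: V_def indicator_def)
  have exp_int: "integrable lborel (\<lambda>x. indicator {0..} x * exp (- l * x))"
    "(\<integral>x. indicator {0..} x * exp (- l * x) \<partial>lborel) = 1 / l" if "0 < l" for l :: real
  proof -
    have "(\<integral>\<^sup>+ x. ennreal (indicator {0..} x * exp (- l * x)) \<partial>lborel) = ennreal (1 / l)"
      using nn_integral_exp_decay[OF that] by (simp add: ennreal_mult' ennreal_indicator mult.commute)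
    then show "integrable lborel (\<lambda>x. indicator {0..} x * exp (- l * x))"
      "(\<integral>x. indicator {0..} x * exp (- l * x) \<partial>lborel) = 1 / l"
      using that by (auto intro!: integrableI_nonneg simp: integral_eq_nn_integral)
  qed
  have V_int: "integrable lborel (\<lambda>x. exp (- l * x) * V x)"
    "(\<integral>x. exp (- l * x) * V x \<partial>lborel) = 1 / \<Phi> l - W 0 / l" if l: "0 < l" for l
  proof -
    have eq: "exp (- l * x) * V x = indicator {0..} x * (exp (- l * x) * W x) - W 0 * (indicator {0..} x * exp (- l * x))" for x
      by (simp add: V_def algebra_simps)
    show "integrable lborel (\<lambda>x. exp (- l * x) * V x)"
      unfolding eq using W_laplace_real[OF l] exp_int[OF l] by auto
    show "(\<integral>x. exp (- l * x) * V x \<partial>lborel) = 1 / \<Phi> l - W 0 / l"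
      unfolding eq using W_laplace_real[OF l] exp_int[OF l] by auto
  qed
  define K where "K = (\<integral>x. exp (- 1 * x) * V x \<partial>lborel)"
  have tend1: "((\<lambda>l. l * (1 / \<Phi> l - W 0 / l)) \<longlongrightarrow> - W 0) at_top"
  proof -
    have "((\<lambda>l. l / \<Phi> l) \<longlongrightarrow> 0) at_top"
    proof (rule tendsto_sandwich[of "\<lambda>_. 0" _ _ "\<lambda>l. 1 / (c * l)"])
      show "\<forall>\<^sub>F l in at_top. 0 \<le> l / \<Phi> l"
        using eventually_gt_at_top[of 0]
      proof eventually_elim
        case (elim l)
        then show ?case using Phi_pos[of l] by simp
      qed
      show "\<forall>\<^sub>F l in at_top. l / \<Phi> l \<le> 1 / (c * l)"
        using eventually_gt_at_top[of 0]
      proof eventually_elim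
        case (elim l)
        then show ?case using Phi_ge[of l] Phi_pos[of l] c_pos by (simp add: field_simps power2_eq_square)
      qed
      show "((\<lambda>l. 1 / (c * l)) \<longlongrightarrow> 0) at_top" using c_pos by real_asymp
    qed simp
    then have "((\<lambda>l. l / \<Phi> l - W 0) \<longlongrightarrow> 0 - W 0) at_top" by (intro tendsto_intros)
    then have "((\<lambda>l. l / \<Phi> l - W 0) \<longlongrightarrow> - W 0) at_top" by simp
    moreover have "\<forall>\<^sub>F l in at_top. l / \<Phi> l - W 0 = l * (1 / \<Phi> l - W 0 / l)"
      using eventually_gt_at_top[of 0] by eventually_elim (simp add: right_diff_distrib)
    ultimately show ?thesis by (rule Lim_transform_eventually)
  qed
  have bound: "- W 0 \<le> V d" if d: "0 < d" for d
  proof -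
    \<comment> \<open>The integral is split at \<open>d\<close>: below, \<open>V\<close> is at most
      \<open>V d\<close>; above, the surplus decay \<open>exp (- (l - 1) * d)\<close> multiplies the
      transform \<open>K\<close> at 1.\<close>
    have tend2: "((\<lambda>l. V d + l * exp (- (l - 1) * d) * K) \<longlongrightarrow> V d) at_top" using d by real_asymp
    show ?thesis
    proof (rule tendsto_le[OF _ tend2 tend1])
      show "\<forall>\<^sub>F l in at_top. l * (1 / \<Phi> l - W 0 / l) \<le> V d + l * exp (- (l - 1) * d) * K"
        using eventually_gt_at_top[of 1]
      proof eventually_elim
        case (elim l)
        have "l * (1 / \<Phi> l - W 0 / l) = (\<integral>x. l * (exp (- l * x) * V x) \<partial>lborel)"
          using V_int(2)[of l] elim by simp
        also have "\<dots> \<le> (\<integral>x. l * V d * (indicator {0..} x * exp (- l * x)) +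
            l * exp (- (l - 1) * d) * (exp (- 1 * x) * V x) \<partial>lborel)"
        proof (rule integral_mono)
          show "integrable lborel (\<lambda>x. l * (exp (- l * x) * V x))"
            using V_int(1)[of l] elim by simp
          show "integrable lborel (\<lambda>x. l * V d * (indicator {0..} x * exp (- l * x)) +
              l * exp (- (l - 1) * d) * (exp (- 1 * x) * V x))"
            using V_int(1)[of 1] exp_int[of l] elim by (intro Bochner_Integration.integrable_add integrable_mult_right) auto
          fix x :: real
          consider "x < 0" | "0 \<le> x" "x \<le> d" | "d < x" by linarith
          then show "l * (exp (- l * x) * V x) \<le> l * V d * (indicator {0..} x * exp (- l * x)) +
              l * exp (- (l - 1) * d) * (exp (- 1 * x) * V x)"
          proof cases
            case 1
            then show ?thesis by (simp add: V_def)
          next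
            case 2
            have "l * (exp (- l * x) * V x) \<le> l * (exp (- l * x) * V d)"
              using 2 elim by (intro mult_left_mono V_mono) auto
            moreover have "0 \<le> l * exp (- (l - 1) * d) * (exp (- 1 * x) * V x)"
              using elim V_nn by auto
            ultimately show ?thesis using 2 by (simp add: mult_ac)
          next
            case 3
            have "exp (- l * x) = exp (- (l - 1) * x) * exp (- 1 * x)" by (simp add: exp_add[symmetric] algebra_simps)
            also have "\<dots> \<le> exp (- (l - 1) * d) * exp (- 1 * x)"
              using 3 elim by (intro mult_right_mono) auto
            finally have "l * (exp (- l * x) * V x) \<le> l * (exp (- (l - 1) * d) * exp (- 1 * x) * V x)"
              using elim V_nn by (intro mult_left_mono mult_right_mono) auto
            moreover have "0 \<le> l * V d * (indicator {0..} x * exp (- l * x))" using elim V_nn by auto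
            ultimately show ?thesis by (simp add: mult_ac)
          qed
        qed
        also have "\<dots> = l * V d * (1 / l) + l * exp (- (l - 1) * d) * K"
          using V_int(1)[of 1] exp_int[of l] elim unfolding K_def
          by (subst Bochner_Integration.integral_add) auto
        finally show ?case using elim by simp
      qed
    qed simp
  qed
  have "- W 0 \<ge> 0"
  proof (rule tendsto_lowerbound[OF tend1])
    show "\<forall>\<^sub>F l in at_top. 0 \<le> l * (1 / \<Phi> l - W 0 / l)"
      using eventually_gt_at_top[of 0]
    proof eventually_elim
      case (elim l)
      have "0 \<le> (\<integral>x. exp (- l * x) * V x \<partial>lborel)" using V_nn by (intro Bochner_Integration.integral_nonneg) auto
      then show ?case using V_int(2)[OF elim] elim by simp
    qed
  qed simp
  moreover have "- W 0 \<le> 0"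
  proof (rule tendsto_lowerbound)
    have "continuous_on {0..} W" using scale by (simp add: scale_function_def)
    then have "(W \<longlongrightarrow> W 0) (at 0 within {0..})" by (auto simp: continuous_on_def)
    then have "(W \<longlongrightarrow> W 0) (at_right 0)" by (rule tendsto_within_subset) auto
    then have "((\<lambda>d. W d - W 0) \<longlongrightarrow> W 0 - W 0) (at_right 0)" by (intro tendsto_intros)
    then show "((\<lambda>d. W d - W 0) \<longlongrightarrow> 0) (at_right 0)" by simp
  qed (use bound in \<open>auto simp: eventually_at_right_field V_def intro!: exI[of _ 1]\<close>)
  ultimately show ?thesis by simp
qed

lemma W_nonpos_zero: "x \<le> 0 \<Longrightarrow> W x = 0"
  using W_neg W_zero by (cases "x = 0") auto

lemma W_nonneg: "0 \<le> W x"
  using W_nonpos_zero[of x] W_less[of 0 x] W_zero by (cases "x \<le> 0") auto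

lemma W_mono: "mono W"
proof (rule monoI)
  fix x y :: real assume "x \<le> y"
  then show "W x \<le> W y"
    using W_nonpos_zero[of x] W_nonneg[of y] W_less[of x y] by (cases "x = y"; cases "x \<le> 0") auto
qed

lemma W_continuous: "continuous_on S W"
proof -
  have "continuous_on ({..0} \<union> {0..}) W"
  proof (rule continuous_on_closed_Un)
    show "continuous_on {..0} W"
      using W_nonpos_zero by (subst continuous_on_cong[OF refl, of _ _ "\<lambda>_. 0"]) auto
    show "continuous_on {0..} W" using scale by (simp add: scale_function_def)
  qed auto
  moreover have "{..0} \<union> {0..} = (UNIV :: real set)" by auto
  ultimately show ?thesis by (metis continuous_on_subset subset_UNIV)
qed

lemma W_measurable [measurable]: "W \<in> borel_measurable borel"
  by (rule borel_measurable_continuous_onI[OF W_continuous])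

lemma W_laplace:
  assumes "0 < l"
  shows "(\<integral>\<^sup>+ x. ennreal (exp (- l * x)) * ennreal (W x) \<partial>lborel) = ennreal (1 / \<Phi> l)"
proof -
  have "(\<integral>\<^sup>+ x. ennreal (exp (- l * x)) * ennreal (W x) \<partial>lborel) =
      (\<integral>\<^sup>+ x. ennreal (indicator {0..} x * (exp (- l * x) * W x)) \<partial>lborel)"
    by (intro nn_integral_cong) (auto simp: indicator_def ennreal_mult' W_neg)
  also have "\<dots> = ennreal (1 / \<Phi> l)"
    using W_laplace_real[OF assms] W_nonneg by (subst nn_integral_eq_integral) auto
  finally show ?thesis .
qed

text \<open>Both sides have transform \<open>1 / l\<^sup>2\<close>: the factor
  \<open>\<Phi> l\<close> in \<open>kk_laplace\<close> cancels against the transform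
  \<open>1 / \<Phi> l\<close> of \<open>W\<close>.\<close>

lemma volterra_AE:
  "AE x in lborel. ennreal c * ennreal (W x) +
     (\<integral>\<^sup>+ r. (kk r * indicator {0..} r) * ennreal (W (x - r)) \<partial>lborel) = ennreal x"
proof -
  define kr where "kr r = kk r * indicator {0..} r" for r
  have [measurable]: "kr \<in> borel_measurable borel" unfolding kr_def by measurable
  define U where "U = density lborel kr"
  have "AE r in lborel. kr r \<noteq> \<infinity>"
    using AE_lborel_singleton[of 0] by eventually_elim (use kk_finite in \<open>auto simp: kr_def indicator_def less_top\<close>)
  then have sf: "sigma_finite_measure U"
    unfolding U_def by (subst sigma_finite_measure.sigma_finite_iff_density_finite[OF sigma_finite_lborel]) auto
  interpret U: sigma_finite_measure U by (rule sf)
  have [measurable_cong]: "sets U = sets borel" by (simp add: U_def)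
  define f where "f x = ennreal c * ennreal (W x) + (\<integral>\<^sup>+ r. kr r * ennreal (W (x - r)) \<partial>lborel)" for x
  have [measurable]: "f \<in> borel_measurable borel" unfolding f_def by measurable
  have transf: "(\<integral>\<^sup>+ x. ennreal (exp (- l * x)) \<partial>density lborel f) = ennreal (1 / l\<^sup>2)" if l: "0 < l" for l
  proof -
    have "(\<integral>\<^sup>+ x. ennreal (exp (- l * x)) \<partial>density lborel f) = (\<integral>\<^sup>+ x. f x * ennreal (exp (- l * x)) \<partial>lborel)"
      by (rule nn_integral_density) measurable
    also have "\<dots> = (\<integral>\<^sup>+ x. ennreal c * (ennreal (exp (- l * x)) * ennreal (W x)) +
        ennreal (exp (- l * x)) * (\<integral>\<^sup>+ z. ennreal (W (x - z)) \<partial>U) \<partial>lborel)"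
      unfolding f_def U_def by (intro nn_integral_cong, subst nn_integral_density) (auto simp: algebra_simps)
    also have "\<dots> = ennreal c * ennreal (1 / \<Phi> l) +
        (\<integral>\<^sup>+ x. ennreal (exp (- l * x)) * (\<integral>\<^sup>+ z. ennreal (W (x - z)) \<partial>U) \<partial>lborel)"
      by (subst nn_integral_add) (auto simp: nn_integral_cmult W_laplace[OF l, simplified])
    also have "(\<integral>\<^sup>+ x. ennreal (exp (- l * x)) * (\<integral>\<^sup>+ z. ennreal (W (x - z)) \<partial>U) \<partial>lborel) =
        (\<integral>\<^sup>+ z. ennreal (exp (- l * z)) \<partial>U) * ennreal (1 / \<Phi> l)"
      by (subst laplace_transform_convolution[OF _ _ sf]) (auto simp: W_laplace[OF l, simplified] U_def)
    also have "(\<integral>\<^sup>+ z. ennreal (exp (- l * z)) \<partial>U) =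
        (\<integral>\<^sup>+ z. ennreal (exp (- l * z)) * (kk z * indicator {0..} z) \<partial>lborel)"
      unfolding U_def kr_def by (subst nn_integral_density) (auto simp: mult.commute)
    also have "ennreal c * ennreal (1 / \<Phi> l) + \<dots> * ennreal (1 / \<Phi> l) = ennreal (\<Phi> l / l\<^sup>2) * ennreal (1 / \<Phi> l)"
      unfolding kk_laplace[OF l, symmetric] by (simp add: distrib_right)
    also have "\<dots> = ennreal (1 / l\<^sup>2)"
      using Phi_pos[OF l] by (simp add: ennreal_mult'[symmetric])
    finally show ?thesis .
  qed
  have "density lborel f = density lborel (\<lambda>x. ennreal x)"
  proof (rule laplace_transform_unique[of _ _ 1 2])
    fix l :: real assume l: "1 < l" "l < 2"
    show "(\<integral>\<^sup>+ x. ennreal (exp (- l * x)) \<partial>density lborel f) < \<infinity>"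
      using transf[of l] l by simp
    have "(\<integral>\<^sup>+ x. ennreal (exp (- l * x)) \<partial>density lborel (\<lambda>x. ennreal x)) = ennreal (1 / l\<^sup>2)"
      using nn_integral_exp_decay_linear[of l] l by (subst nn_integral_density) (auto simp: mult.commute)
    then show "(\<integral>\<^sup>+ x. ennreal (exp (- l * x)) \<partial>density lborel f) =
        (\<integral>\<^sup>+ x. ennreal (exp (- l * x)) \<partial>density lborel (\<lambda>x. ennreal x))"
      using transf[of l] l by simp
  qed auto
  then have "AE x in lborel. f x = ennreal x"
    by (subst (asm) sigma_finite_measure.density_unique_iff[OF sigma_finite_lborel]) auto
  then show ?thesis by (simp add: f_def kr_def)
qed

text \<open>For arguments below \<open>R\<close>, cutting the kernel off at \<open>R\<close> changes
  nothing, since \<open>W\<close> vanishes on the negative half-line; it makes the kernel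
  integrable, as the maximum principle requires. Exceptional points are removed by dominated
  convergence along a sequence below \<open>v\<close>.\<close>

lemma volterra:
  assumes "0 < v" "v < R"
  shows "c * W v + (\<integral>r. enn2real (kk r) * indicator {0<..<R} r * W (v - r) \<partial>lborel) = v"
    and "integrable lborel (\<lambda>r. enn2real (kk r) * indicator {0<..<R} r)"
proof -
  define k where "k r = enn2real (kk r) * indicator {0<..<R} r" for r
  have [measurable]: "k \<in> borel_measurable borel" unfolding k_def by measurable
  have k_enn: "ennreal (k r) = kk r * indicator {0<..<R} r" for r
    using kk_finite[of r] by (auto simp: k_def indicator_def less_top)
  have "(\<integral>\<^sup>+ r. ennreal (k r) \<partial>lborel) \<le>
      (\<integral>\<^sup>+ r. ennreal (exp R) * (ennreal (exp (- 1 * r)) * (kk r * indicator {0..} r)) \<partial>lborel)"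
  proof (intro nn_integral_mono)
    fix r
    have "1 * kk r \<le> ennreal (exp R * exp (- r)) * kk r" if "0 < r" "r < R"
      using that by (intro mult_right_mono) (auto simp: exp_add[symmetric])
    then show "ennreal (k r) \<le> ennreal (exp R) * (ennreal (exp (- 1 * r)) * (kk r * indicator {0..} r))"
      unfolding k_enn by (auto simp: indicator_def ennreal_mult' mult_ac)
  qed
  also have "\<dots> = ennreal (exp R) * (\<integral>\<^sup>+ r. ennreal (exp (- 1 * r)) * (kk r * indicator {0..} r) \<partial>lborel)"
    by (rule nn_integral_cmult) measurable
  also have "\<dots> < \<infinity>"
    using kk_laplace[of 1] by (metis add_top_right_ennreal ennreal_less_top ennreal_mult_less_top ennreal_neq_top
      infinity_ennreal_def less_top zero_less_one add_top)
  finally show int: "integrable lborel (\<lambda>r. enn2real (kk r) * indicator {0<..<R} r)"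
    unfolding k_def[symmetric] by (intro integrableI_nonneg) (auto simp: k_def)
  have k0: "k r \<noteq> 0 \<Longrightarrow> 0 < r" for r by (auto simp: k_def indicator_def split: if_splits)
  have int_kW: "integrable lborel (\<lambda>r. k r * W (x - r))" for x
    using int[folded k_def] W_nonneg monoD[OF W_mono, of "x - r" x for r] k0
    by (intro integrable_mult_bounded_on_support[where B = "W x"]) (auto simp: less_imp_le)
  have ae: "AE x in lborel. 0 < x \<and> x < R \<longrightarrow> c * W x + (\<integral>r. k r * W (x - r) \<partial>lborel) = x"
    using volterra_AE
  proof eventually_elim
    case (elim x)
    show ?case
    proof
      assume x: "0 < x \<and> x < R"
      have "(\<integral>\<^sup>+ r. (kk r * indicator {0..} r) * ennreal (W (x - r)) \<partial>lborel) = (\<integral>\<^sup>+ r. ennreal (k r * W (x - r)) \<partial>lborel)"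
      proof (intro nn_integral_cong_AE)
        show "AE r in lborel. (kk r * indicator {0..} r) * ennreal (W (x - r)) = ennreal (k r * W (x - r))"
          using AE_lborel_singleton[of 0]
        proof eventually_elim
          case (elim r)
          consider "r < 0" | "0 < r" "r < R" | "R \<le> r" using elim by linarith
          then show ?case
          proof cases
            case 2
            have "ennreal (k r * W (x - r)) = ennreal (k r) * ennreal (W (x - r))"
              by (intro ennreal_mult) (auto simp: k_def W_nonneg)
            moreover have "ennreal (k r) = kk r" using 2 by (simp add: k_enn)
            ultimately show ?thesis using 2 by simp
          qed (use x W_nonpos_zero[of "x - r"] in \<open>auto simp: k_def\<close>)
        qed
      qed
      also have "\<dots> = ennreal (\<integral>r. k r * W (x - r) \<partial>lborel)"
        using int_kW W_nonneg by (intro nn_integral_eq_integral) (auto simp: k_def)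
      finally have "ennreal (c * W x + (\<integral>r. k r * W (x - r) \<partial>lborel)) = ennreal x"
        using elim c_pos W_nonneg by (subst ennreal_plus) (auto simp: ennreal_mult' k_def intro!: Bochner_Integration.integral_nonneg)
      then show "c * W x + (\<integral>r. k r * W (x - r) \<partial>lborel) = x"
        using x c_pos W_nonneg by (subst (asm) ennreal_inj) (auto simp: k_def intro!: add_nonneg_nonneg Bochner_Integration.integral_nonneg)
    qed
  qed
  obtain s where s: "\<And>n. 0 < s n \<and> s n < R \<longrightarrow> c * W (s n) + (\<integral>r. k r * W (s n - r) \<partial>lborel) = s n"
    "\<And>n. s n < v" "s \<longlonglongrightarrow> v"
    by (rule AE_lborel_seq_below[OF ae]) blast
  have Wc: "isCont W x" for x using W_continuous[of UNIV] by (simp add: continuous_on_eq_continuous_at)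
  have l1: "(\<lambda>n. c * W (s n) + (\<integral>r. k r * W (s n - r) \<partial>lborel)) \<longlonglongrightarrow> c * W v + (\<integral>r. k r * W (v - r) \<partial>lborel)"
  proof (intro tendsto_add tendsto_mult tendsto_const isCont_tendsto_compose[OF Wc s(3)]
      integral_dominated_convergence[where w = "\<lambda>r. W v * k r"])
    show "AE r in lborel. (\<lambda>n. k r * W (s n - r)) \<longlonglongrightarrow> k r * W (v - r)"
      by (intro AE_I2 tendsto_mult tendsto_const isCont_tendsto_compose[OF Wc] tendsto_diff s(3))
    show "AE r in lborel. norm (k r * W (s n - r)) \<le> W v * k r" for n
    proof (rule AE_I2)
      fix r
      have "W (s n - r) \<le> W v" if "0 < r" using that s(2)[of n] by (intro monoD[OF W_mono]) auto
      moreover have kn: "0 \<le> k r" by (simp add: k_def)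
      ultimately have "k r * W (s n - r) \<le> k r * W v"
        using k0[of r] by (cases "k r = 0") (auto intro!: mult_left_mono)
      moreover have "0 \<le> k r * W (s n - r)" using kn W_nonneg by simp
      ultimately show "norm (k r * W (s n - r)) \<le> W v * k r"
        by (simp only: real_norm_def abs_of_nonneg mult.commute[of "W v"])
    qed
    show "integrable lborel (\<lambda>r. W v * k r)" using int by (simp add: k_def)
  qed auto
  have "\<forall>\<^sub>F n in sequentially. 0 < s n"
    using s(3) assms by (intro order_tendstoD(1)) auto
  then have "\<forall>\<^sub>F n in sequentially. c * W (s n) + (\<integral>r. k r * W (s n - r) \<partial>lborel) = s n"
    by eventually_elim (use s(1,2) assms in \<open>auto intro: less_trans\<close>)
  from Lim_transform_eventually[OF l1 this] s(3)
  have "c * W v + (\<integral>r. k r * W (v - r) \<partial>lborel) = v"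
    by (rule LIMSEQ_unique)
  then show "c * W v + (\<integral>r. enn2real (kk r) * indicator {0<..<R} r * W (v - r) \<partial>lborel) = v"
    by (simp add: k_def)
qed

text \<open>The variable \<open>x\<close> ranges over the whole line because the inequality is later
  integrated at the points \<open>x - z\<close> with \<open>z\<close> distributed over the
  line.\<close>

lemma W_subadditive:
  assumes "0 \<le> y"
  shows "W (x + y) \<le> W x + W y"
proof (cases "0 \<le> x")
  case False
  then show ?thesis using W_nonneg[of x] monoD[OF W_mono, of "x + y" y] by auto
next
  case True
  define v where "v = x + y"
  let ?k = "\<lambda>r. enn2real (kk r) * indicator {0<..<v + 1} r"
  have v: "0 < v + 1/2" "v + 1/2 < v + 1" using True assms by (auto simp: v_def)
  have "W v \<le> W x + W (v - x)"
  proof (rule volterra_solution_subadditive[of c ?k _ "v + 1"])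
    show "integrable lborel ?k" using volterra(2)[OF v] .
    fix r s :: real assume "0 < r" "r \<le> s"
    then show "?k s \<le> ?k r"
      using kk_antimono[of r s] kk_finite[of r] by (auto simp: indicator_def intro!: enn2real_mono)
  qed (use True assms c_pos W_nonpos_zero W_mono W_continuous volterra(1) in \<open>auto simp: v_def\<close>)
  then show ?thesis by (simp add: v_def)
qed

end

section \<open>Resolvent densities\<close>

locale resolvent = scale +
  fixes q :: real and U :: "real measure"
  assumes q_pos: "0 < q" and sets_U [simp, measurable_cong]: "sets U = sets borel"
    and U_mass: "emeasure U UNIV = ennreal (1 / q)"
    and U_laplace: "\<And>l. 0 < l \<Longrightarrow> \<Phi> l < q \<Longrightarrow> (\<integral>\<^sup>+ x. ennreal (exp (- l * x)) \<partial>U) = ennreal (1 / (q - \<Phi> l))"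
begin

lemma space_U [simp]: "space U = UNIV"
  using sets_eq_imp_space_eq[OF sets_U] by simp

sublocale U: finite_measure U
  by standard (simp add: U_mass)

definition h :: "real \<Rightarrow> ennreal" where "h x = ennreal q * (\<integral>\<^sup>+ z. ennreal (W (x - z)) \<partial>U)"

lemma h_measurable [measurable]: "h \<in> borel_measurable borel"
  unfolding h_def by measurable

lemma h_mono: "x \<le> y \<Longrightarrow> h x \<le> h y"
  unfolding h_def by (intro mult_left_mono nn_integral_mono ennreal_leI monoD[OF W_mono]) auto

text \<open>\<open>q\<close> times \<open>U\<close> has mass one, so integrating the subadditivity
  of \<open>W\<close> leaves \<open>W y\<close> with coefficient 1, whatever \<open>q\<close>
  is.\<close>

lemma h_le: "0 \<le> y \<Longrightarrow> h (x + y) \<le> h x + ennreal (W y)"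
proof -
  assume y: "0 \<le> y"
  have "h (x + y) \<le> ennreal q * (\<integral>\<^sup>+ z. ennreal (W (x - z)) + ennreal (W y) \<partial>U)"
    unfolding h_def using W_subadditive[OF y, of "x - z" for z]
    by (intro mult_left_mono nn_integral_mono) (auto simp: ennreal_plus[symmetric] W_nonneg algebra_simps simp del: ennreal_plus intro!: ennreal_leI)
  also have "\<dots> = h x + ennreal q * (ennreal (W y) * ennreal (1 / q))"
    by (subst nn_integral_add) (auto simp: U_mass h_def distrib_left)
  also have "ennreal q * (ennreal (W y) * ennreal (1 / q)) = ennreal (W y)"
    using q_pos W_nonneg[of y] by (simp add: ennreal_mult'[symmetric])
  finally show ?thesis .
qed

lemma h_laplace:
  assumes "0 < l" "\<Phi> l < q"
  shows "(\<integral>\<^sup>+ x. h x * ennreal (exp (- l * x)) \<partial>lborel) = ennreal (1 / (q - \<Phi> l)) + ennreal (1 / \<Phi> l)"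
proof -
  have "(\<integral>\<^sup>+ x. h x * ennreal (exp (- l * x)) \<partial>lborel) =
      (\<integral>\<^sup>+ x. ennreal q * (ennreal (exp (- l * x)) * (\<integral>\<^sup>+ z. ennreal (W (x - z)) \<partial>U)) \<partial>lborel)"
    unfolding h_def by (intro nn_integral_cong) (simp only: mult_ac)
  also have "\<dots> = ennreal q * (\<integral>\<^sup>+ x. ennreal (exp (- l * x)) * (\<integral>\<^sup>+ z. ennreal (W (x - z)) \<partial>U) \<partial>lborel)"
    by (rule nn_integral_cmult) measurable
  also have "\<dots> = ennreal q * (ennreal (1 / (q - \<Phi> l)) * ennreal (1 / \<Phi> l))"
    by (subst laplace_transform_convolution[OF _ _ U.sigma_finite_measure])
      (auto simp: U_laplace[OF assms, simplified] W_laplace[OF assms(1), simplified])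
  also have "\<dots> = ennreal (q * (1 / (q - \<Phi> l) * (1 / \<Phi> l)))"
  proof -
    have "0 \<le> 1 / (q - \<Phi> l)" "0 \<le> 1 / \<Phi> l" "0 \<le> q" using assms Phi_pos[of l] q_pos by auto
    then show ?thesis by (simp only: ennreal_mult mult_nonneg_nonneg)
  qed
  \<comment> \<open>This partial fraction decomposition is the resolvent equation on the transform
    side.\<close>
  also have "q * (1 / (q - \<Phi> l) * (1 / \<Phi> l)) = 1 / (q - \<Phi> l) + 1 / \<Phi> l"
    using assms Phi_pos[of l] by (simp add: field_simps)
  also have "ennreal \<dots> = ennreal (1 / (q - \<Phi> l)) + ennreal (1 / \<Phi> l)"
    using assms Phi_pos[of l] by (intro ennreal_plus) auto
  finally show ?thesis .
qed

lemma resolvent_equation: "add_measure U (density lborel (\<lambda>x. ennreal (W x))) = density lborel h"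
proof -
  obtain l0 where l0: "0 < l0" "\<And>l. 0 < l \<Longrightarrow> l < l0 \<Longrightarrow> \<Phi> l < q"
    using Phi_small[OF q_pos] by blast
  have transf: "(\<integral>\<^sup>+ x. ennreal (exp (- l * x)) \<partial>add_measure U (density lborel (\<lambda>x. ennreal (W x)))) =
      ennreal (1 / (q - \<Phi> l)) + ennreal (1 / \<Phi> l)" if l: "0 < l" "l < l0" for l
  proof -
    have "(\<integral>\<^sup>+ x. ennreal (exp (- l * x)) \<partial>add_measure U (density lborel (\<lambda>x. ennreal (W x)))) =
        (\<integral>\<^sup>+ x. ennreal (exp (- l * x)) \<partial>U) + (\<integral>\<^sup>+ x. ennreal (exp (- l * x)) \<partial>density lborel (\<lambda>x. ennreal (W x)))"
      by (rule nn_integral_add_measure) auto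
    also have "(\<integral>\<^sup>+ x. ennreal (exp (- l * x)) \<partial>density lborel (\<lambda>x. ennreal (W x))) = ennreal (1 / \<Phi> l)"
      using W_laplace[OF l(1)] by (subst nn_integral_density) (auto simp: mult.commute)
    finally show ?thesis using U_laplace[OF l(1) l0(2)[OF l]] by simp
  qed
  show ?thesis
  proof (rule laplace_transform_unique[OF _ _ l0(1)])
    fix l assume l: "0 < l" "l < l0"
    show "(\<integral>\<^sup>+ x. ennreal (exp (- l * x)) \<partial>add_measure U (density lborel (\<lambda>x. ennreal (W x)))) < \<infinity>"
      unfolding transf[OF l] by simp
    have "(\<integral>\<^sup>+ x. ennreal (exp (- l * x)) \<partial>density lborel h) = (\<integral>\<^sup>+ x. h x * ennreal (exp (- l * x)) \<partial>lborel)"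
      by (rule nn_integral_density) measurable
    then show "(\<integral>\<^sup>+ x. ennreal (exp (- l * x)) \<partial>add_measure U (density lborel (\<lambda>x. ennreal (W x)))) =
        (\<integral>\<^sup>+ x. ennreal (exp (- l * x)) \<partial>density lborel h)"
      unfolding transf[OF l] using h_laplace[OF l(1) l0(2)[OF l]] by simp
  qed auto
qed

text \<open>Finite almost everywhere because its transform is; monotonicity extends this to every
  point.\<close>

lemma h_finite: "h x < \<infinity>"
proof -
  obtain l0 where l0: "0 < l0" "\<And>l. 0 < l \<Longrightarrow> l < l0 \<Longrightarrow> \<Phi> l < q"
    using Phi_small[OF q_pos] by blast
  define l where "l = l0 / 2"
  have l: "0 < l" "l < l0" using l0(1) by (auto simp: l_def)
  have "(\<integral>\<^sup>+ x. h x * ennreal (exp (- l * x)) \<partial>lborel) \<noteq> \<infinity>"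
    using h_laplace[OF l(1) l0(2)[OF l]] by simp
  then have "AE x in lborel. h x * ennreal (exp (- l * x)) \<noteq> \<infinity>"
    by (rule nn_integral_PInf_AE[rotated]) measurable
  from AE_lborel_dense[OF this, of x "x + 1"]
  obtain y where y: "x < y" "h y * ennreal (exp (- l * y)) \<noteq> \<infinity>"
    by auto
  then have "h y < \<infinity>" by (auto simp: ennreal_mult_eq_top_iff less_top)
  then show ?thesis using h_mono[of x y] y(1) by auto
qed

definition u :: "real \<Rightarrow> real" where "u x = enn2real (h x) - W x"

lemma h_increment_bounds:
  assumes "0 \<le> y"
  shows "enn2real (h x) \<le> enn2real (h (x + y))" "enn2real (h (x + y)) \<le> enn2real (h x) + W y"
proof -
  show "enn2real (h x) \<le> enn2real (h (x + y))"
    using h_mono[of x "x + y"] h_finite[of "x + y"] assms by (intro enn2real_mono) auto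
  have "enn2real (h (x + y)) \<le> enn2real (h x + ennreal (W y))"
    using h_le[OF assms, of x] h_finite[of x] by (intro enn2real_mono) auto
  also have "\<dots> = enn2real (h x) + W y"
    using h_finite[of x] W_nonneg[of y] by (subst enn2real_plus) auto
  finally show "enn2real (h (x + y)) \<le> enn2real (h x) + W y" .
qed

text \<open>Over a step of length \<open>d\<close> both \<open>h\<close> and \<open>W\<close>
  increase by an amount between 0 and \<open>W d\<close>, so their difference \<open>u\<close>
  changes by at most \<open>W d\<close>.\<close>

lemma u_modulus: "\<bar>u x - u y\<bar> \<le> W \<bar>x - y\<bar>"
proof -
  have "\<bar>u (a + d) - u a\<bar> \<le> W d" if "0 \<le> d" for a d
    using h_increment_bounds[OF that, of a] W_subadditive[OF that, of a] monoD[OF W_mono, of a "a + d"] that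
    by (auto simp: u_def)
  from this[of "x - y" y] this[of "y - x" x] show ?thesis
    by (cases "y \<le> x") (auto simp: abs_minus_commute)
qed

lemma W_tendsto_zero: "(f \<longlongrightarrow> 0) F \<Longrightarrow> ((\<lambda>x. W (f x)) \<longlongrightarrow> 0) F"
  using continuous_on_tendsto_compose[OF W_continuous[of UNIV], of f 0 F] W_zero by simp

lemma u_continuous: "continuous_on S u"
proof -
  have "isCont u x" for x
  proof -
    have "((\<lambda>y. y - x) \<longlongrightarrow> x - x) (at x)" by (intro tendsto_intros)
    then have "((\<lambda>y. W \<bar>y - x\<bar>) \<longlongrightarrow> 0) (at x)"
      by (intro W_tendsto_zero tendsto_rabs_zero) simp
    then have "((\<lambda>y. u y - u x) \<longlongrightarrow> 0) (at x)"
      by (rule Lim_null_comparison[rotated]) (use u_modulus in \<open>auto simp: always_eventually\<close>)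
    then show ?thesis unfolding isCont_def by (rule LIM_zero_cancel)
  qed
  then show ?thesis by (simp add: continuous_at_imp_continuous_on)
qed

lemma u_measurable [measurable]: "u \<in> borel_measurable borel"
  by (rule borel_measurable_continuous_onI[OF u_continuous])

text \<open>By the resolvent equation \<open>U\<close> is absolutely continuous. If \<open>f\<close>
  is a density, then \<open>f\<close> plus \<open>W\<close> is \<open>h\<close> almost everywhere,
  and as \<open>h\<close> is finite \<open>f\<close> is almost everywhere \<open>u\<close>, which is
  therefore not truncated by \<open>ennreal\<close> there.\<close>

lemma u_density: "density lborel (\<lambda>x. ennreal (u x)) = U" and u_nonneg_AE: "AE x in lborel. 0 \<le> u x"
proof -
  have em: "emeasure U B + emeasure (density lborel (\<lambda>x. ennreal (W x))) B = emeasure (density lborel h) B"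
    if "B \<in> sets borel" for B
    using that by (subst resolvent_equation[symmetric]) (simp add: emeasure_add_measure)
  have "absolutely_continuous lborel U"
    unfolding absolutely_continuous_def
  proof
    fix B assume B: "B \<in> null_sets (lborel :: real measure)"
    then have [measurable]: "B \<in> sets borel" by auto
    have "emeasure (density lborel h) B = 0"
      using B by (simp add: emeasure_density nn_integral_null_set)
    then show "B \<in> null_sets U" using em[of B] by auto
  qed
  then obtain f where f [measurable]: "f \<in> borel_measurable borel" and fU: "density lborel f = U"
    using sigma_finite_measure.Radon_Nikodym[OF sigma_finite_lborel, of U] by auto
  have "density lborel (\<lambda>x. f x + ennreal (W x)) = density lborel h"
  proof (rule measure_eqI)
    fix B assume "B \<in> sets (density lborel (\<lambda>x. f x + ennreal (W x)))"
    then have [measurable]: "B \<in> sets borel" by simp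
    show "emeasure (density lborel (\<lambda>x. f x + ennreal (W x))) B = emeasure (density lborel h) B"
      using em[of B] unfolding fU[symmetric]
      by (simp add: emeasure_density distrib_right nn_integral_add)
  qed simp
  then have "AE x in lborel. f x + ennreal (W x) = h x"
    by (subst (asm) sigma_finite_measure.density_unique_iff[OF sigma_finite_lborel]) auto
  then have ae: "AE x in lborel. f x = ennreal (u x) \<and> 0 \<le> u x"
  proof eventually_elim
    case (elim x)
    have "f x < \<infinity>" using h_finite[of x] elim by (metis add_top_right_ennreal add.commute infinity_ennreal_def less_top)
    then obtain r where r: "f x = ennreal r" "0 \<le> r" by (cases "f x") auto
    then have "h x = ennreal (r + W x)" using elim W_nonneg by simp
    then have "u x = r" using r W_nonneg[of x] by (simp add: u_def del: ennreal_plus)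
    then show ?case using r by simp
  qed
  then have "density lborel f = density lborel (\<lambda>x. ennreal (u x))"
    by (intro density_cong) auto
  then show "density lborel (\<lambda>x. ennreal (u x)) = U" by (simp add: fU)
  show "AE x in lborel. 0 \<le> u x" using ae by auto
qed

lemma u_nonneg: "0 \<le> u x"
proof -
  obtain s where s: "\<And>n. 0 \<le> u (s n)" "s \<longlonglongrightarrow> x"
    by (rule AE_lborel_seq_below[OF u_nonneg_AE, of x]) blast
  have "(\<lambda>n. u (s n)) \<longlonglongrightarrow> u x"
    using continuous_on_tendsto_compose[OF u_continuous[of UNIV] s(2)] by simp
  then show ?thesis by (rule LIMSEQ_le_const) (use s in auto)
qed

text \<open>To the right of 0 the growth of \<open>h\<close> is at most \<open>W x\<close>, which
  \<open>u\<close> subtracts again; to the left \<open>W\<close> vanishes and \<open>h\<close> is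
  nondecreasing.\<close>

lemma u_le: "u x \<le> u 0"
proof (cases "0 \<le> x")
  case True
  then show ?thesis using h_increment_bounds(2)[of x 0] W_zero by (simp add: u_def)
next
  case False
  then show ?thesis using h_increment_bounds(1)[of "- x" x] W_zero W_neg[of x] by (simp add: u_def)
qed

lemma u_diff_le: "u 0 - u x \<le> W \<bar>x\<bar>"
  using u_modulus[of 0 x] by simp

lemma nn_integral_U:
  assumes [measurable]: "f \<in> borel_measurable borel"
  shows "(\<integral>\<^sup>+ z. f z \<partial>U) = (\<integral>\<^sup>+ z. ennreal (u z) * f z \<partial>lborel)"
  using nn_integral_density[of "\<lambda>x. ennreal (u x)" lborel f] by (simp add: u_density)

lemma u0_pos: "0 < u 0"
proof (rule ccontr)
  assume "\<not> 0 < u 0"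
  then have "u x = 0" for x using u_le[of x] u_nonneg[of x] by linarith
  then have "(\<integral>\<^sup>+ z. 1 \<partial>U) = 0" by (subst nn_integral_U) auto
  then show False using U_mass q_pos by simp
qed

end

section \<open>Iterated integrals and Stieltjes limits\<close>

text \<open>Vanishing for negative \<open>t\<close> encodes the order of times: a product of
  discounts of successive differences lives on increasing times only.\<close>

definition disc :: "real \<Rightarrow> real \<Rightarrow> ennreal" where
  "disc q t = (if 0 \<le> t then ennreal (exp (- q * t)) else 0)"

lemma disc_measurable [measurable]: "disc q \<in> borel_measurable borel"
  unfolding disc_def by measurable

lemma disc_mult: "disc q (v - r) * disc q (t - v) = (if r \<le> v \<and> v \<le> t then disc q (t - r) else 0)"
proof -
  have "exp (- q * (v - r)) * exp (- q * (t - v)) = exp (- q * (t - r))"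
    by (simp add: exp_add[symmetric] algebra_simps)
  then show ?thesis
    by (auto simp: disc_def ennreal_mult'[symmetric])
qed

lemma disc_tail:
  assumes "0 < q" "0 \<le> t"
  shows "(\<integral>\<^sup>+ s. (if t \<le> s then ennreal q * disc q s else 0) \<partial>lborel) = ennreal (exp (- q * t))"
proof -
  have "(\<integral>\<^sup>+ s. (if t \<le> s then ennreal q * disc q s else 0) \<partial>lborel) =
      (\<integral>\<^sup>+ s. ennreal (q * exp (- q * s)) * indicator {t..} s \<partial>lborel)"
    using assms by (intro nn_integral_cong) (auto simp: disc_def indicator_def ennreal_mult')
  also have "\<dots> = ennreal (0 - (- exp (- q * t)))"
  proof (rule nn_integral_FTC_atLeast)
    show "((\<lambda>x. - exp (- q * x)) \<longlongrightarrow> 0) at_top" using assms by real_asymp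
  qed (use assms in \<open>auto intro!: derivative_eq_intros\<close>)
  finally show ?thesis by simp
qed

definition run :: "(real \<Rightarrow> ennreal) \<Rightarrow> real \<Rightarrow> real \<Rightarrow> ennreal" where
  "run \<phi> r t = (\<integral>\<^sup>+ v. (if r \<le> v \<and> v \<le> t then \<phi> v else 0) \<partial>lborel)"

lemma run_measurable [measurable (raw)]:
  assumes [measurable]: "\<phi> \<in> borel_measurable borel" "f \<in> borel_measurable N" "g \<in> borel_measurable N"
  shows "(\<lambda>x. run \<phi> (f x) (g x)) \<in> borel_measurable N"
  unfolding run_def by measurable

lemma run_split:
  assumes [measurable]: "\<phi> \<in> borel_measurable borel" and w: "r \<le> w" "w \<le> t"
  shows "run \<phi> r w + run \<phi> w t = run \<phi> r t"
proof -
  have "run \<phi> r w + run \<phi> w t =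
      (\<integral>\<^sup>+ v. (if r \<le> v \<and> v \<le> w then \<phi> v else 0) + (if w \<le> v \<and> v \<le> t then \<phi> v else 0) \<partial>lborel)"
    unfolding run_def by (rule nn_integral_add[symmetric]) measurable
  also have "\<dots> = run \<phi> r t"
    unfolding run_def
  proof (intro nn_integral_cong_AE)
    show "AE v in lborel. (if r \<le> v \<and> v \<le> w then \<phi> v else 0) + (if w \<le> v \<and> v \<le> t then \<phi> v else 0) =
        (if r \<le> v \<and> v \<le> t then \<phi> v else 0)"
      using AE_lborel_singleton[of w] by eventually_elim (use w in auto)
  qed
  finally show ?thesis .
qed

lemma run_mono: "s \<le> t \<Longrightarrow> run \<phi> r s \<le> run \<phi> r t"
  unfolding run_def by (intro nn_integral_mono) auto

text \<open>Since \<phi> is merely measurable and may be infinite, Tonelli replaces the derivative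
  of a power. With \<open>I\<close> the integral for \<open>Suc k\<close>, the induction hypothesis
  and Tonelli express \<open>I\<close> with the weight \<open>run \<phi> r w\<close> and
  \<open>Suc k\<close> times \<open>I\<close> with the weight \<open>run \<phi> w t\<close>; the sum
  has the constant weight \<open>run \<phi> r t\<close>.\<close>

lemma iterated_integral_power:
  assumes [measurable]: "\<phi> \<in> borel_measurable borel"
  shows "of_nat (Suc k) * (\<integral>\<^sup>+ v. (if r \<le> v \<and> v \<le> t then \<phi> v * run \<phi> v t ^ k else 0) \<partial>lborel) = run \<phi> r t ^ Suc k"
proof (induction k arbitrary: r)
  case 0
  show ?case by (auto simp: run_def intro!: nn_integral_cong)
next
  case (Suc k)
  define c where "c = (of_nat (Suc k) :: ennreal)"
  define I where "I = (\<integral>\<^sup>+ v. (if r \<le> v \<and> v \<le> t then \<phi> v * run \<phi> v t ^ Suc k else 0) \<partial>lborel)"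
  define H where "H w = (if r \<le> w \<and> w \<le> t then c * (\<phi> w * run \<phi> w t ^ k) else 0)" for w
  have [measurable]: "H \<in> borel_measurable borel" unfolding H_def by measurable
  have "I = (\<integral>\<^sup>+ v. (\<integral>\<^sup>+ w. (if r \<le> v \<and> v \<le> w \<and> w \<le> t then c * (\<phi> v * (\<phi> w * run \<phi> w t ^ k)) else 0) \<partial>lborel) \<partial>lborel)"
    unfolding I_def
  proof (intro nn_integral_cong)
    fix v
    show "(if r \<le> v \<and> v \<le> t then \<phi> v * run \<phi> v t ^ Suc k else 0) =
        (\<integral>\<^sup>+ w. (if r \<le> v \<and> v \<le> w \<and> w \<le> t then c * (\<phi> v * (\<phi> w * run \<phi> w t ^ k)) else 0) \<partial>lborel)"
    proof (cases "r \<le> v \<and> v \<le> t")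
      case True
      have "\<phi> v * run \<phi> v t ^ Suc k = c * \<phi> v * (\<integral>\<^sup>+ w. (if v \<le> w \<and> w \<le> t then \<phi> w * run \<phi> w t ^ k else 0) \<partial>lborel)"
        unfolding Suc[symmetric] c_def by (simp only: mult_ac)
      also have "\<dots> = (\<integral>\<^sup>+ w. c * \<phi> v * (if v \<le> w \<and> w \<le> t then \<phi> w * run \<phi> w t ^ k else 0) \<partial>lborel)"
        by (rule nn_integral_cmult[symmetric]) measurable
      also have "\<dots> = (\<integral>\<^sup>+ w. (if r \<le> v \<and> v \<le> w \<and> w \<le> t then c * (\<phi> v * (\<phi> w * run \<phi> w t ^ k)) else 0) \<partial>lborel)"
        using True by (intro nn_integral_cong) (auto simp: mult.assoc)
      finally show ?thesis using True by simp
    next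
      case False
      then have eq: "(\<lambda>w. if r \<le> v \<and> v \<le> w \<and> w \<le> t then c * (\<phi> v * (\<phi> w * run \<phi> w t ^ k)) else 0) = (\<lambda>_. 0)"
        by (intro ext) auto
      show ?thesis unfolding eq using False by auto
    qed
  qed
  also have "\<dots> = (\<integral>\<^sup>+ w. (\<integral>\<^sup>+ v. (if r \<le> v \<and> v \<le> w \<and> w \<le> t then c * (\<phi> v * (\<phi> w * run \<phi> w t ^ k)) else 0) \<partial>lborel) \<partial>lborel)"
    by (rule lborel_pair.Fubini') measurable
  also have "\<dots> = (\<integral>\<^sup>+ w. H w * run \<phi> r w \<partial>lborel)"
  proof (intro nn_integral_cong)
    fix w
    have "(\<integral>\<^sup>+ v. (if r \<le> v \<and> v \<le> w \<and> w \<le> t then c * (\<phi> v * (\<phi> w * run \<phi> w t ^ k)) else 0) \<partial>lborel) =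
        (\<integral>\<^sup>+ v. H w * (if r \<le> v \<and> v \<le> w then \<phi> v else 0) \<partial>lborel)"
      by (intro nn_integral_cong) (auto simp: H_def mult_ac)
    also have "\<dots> = H w * run \<phi> r w"
      unfolding run_def by (rule nn_integral_cmult) measurable
    finally show "(\<integral>\<^sup>+ v. (if r \<le> v \<and> v \<le> w \<and> w \<le> t then c * (\<phi> v * (\<phi> w * run \<phi> w t ^ k)) else 0) \<partial>lborel) =
        H w * run \<phi> r w" .
  qed
  finally have 1: "I = (\<integral>\<^sup>+ w. H w * run \<phi> r w \<partial>lborel)" .
  have "c * I = (\<integral>\<^sup>+ w. c * (if r \<le> w \<and> w \<le> t then \<phi> w * run \<phi> w t ^ Suc k else 0) \<partial>lborel)"
    unfolding I_def by (rule nn_integral_cmult[symmetric]) measurable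
  also have "\<dots> = (\<integral>\<^sup>+ w. H w * run \<phi> w t \<partial>lborel)"
    by (intro nn_integral_cong) (auto simp: H_def mult_ac)
  finally have "I + c * I = (\<integral>\<^sup>+ w. H w * run \<phi> r w + H w * run \<phi> w t \<partial>lborel)"
    unfolding 1 by (subst nn_integral_add) auto
  also have "\<dots> = (\<integral>\<^sup>+ w. H w * run \<phi> r t \<partial>lborel)"
    by (intro nn_integral_cong) (auto simp: H_def distrib_left[symmetric] run_split)
  also have "\<dots> = (\<integral>\<^sup>+ w. H w \<partial>lborel) * run \<phi> r t"
    by (rule nn_integral_multc) measurable
  also have "(\<integral>\<^sup>+ w. H w \<partial>lborel) = c * (\<integral>\<^sup>+ w. (if r \<le> w \<and> w \<le> t then \<phi> w * run \<phi> w t ^ k else 0) \<partial>lborel)"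
    by (subst nn_integral_cmult[symmetric]) (auto simp: H_def intro!: nn_integral_cong)
  also have "\<dots> = run \<phi> r t ^ Suc k" unfolding c_def by (rule Suc)
  finally have "I + c * I = run \<phi> r t ^ Suc (Suc k)" by (simp add: mult_ac)
  moreover have "of_nat (Suc (Suc k)) * I = I + c * I"
    by (simp add: c_def distrib_right)
  ultimately show ?case by (simp add: I_def)
qed

primrec chain :: "real \<Rightarrow> (real \<Rightarrow> ennreal) list \<Rightarrow> real \<Rightarrow> ennreal" where
  "chain q [] r = 1"
| "chain q (f # fs) r = (\<integral>\<^sup>+ t. disc q (t - r) * (f t * chain q fs t) \<partial>lborel)"

lemma chain_measurable [measurable (raw)]:
  "(\<And>f. f \<in> set fs \<Longrightarrow> f \<in> borel_measurable borel) \<Longrightarrow> chain q fs \<in> borel_measurable borel"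
proof (induction fs)
  case (Cons f fs)
  have [measurable]: "f \<in> borel_measurable borel" "chain q fs \<in> borel_measurable borel"
    using Cons by auto
  have "(\<lambda>r. \<integral>\<^sup>+ t. disc q (t - r) * (f t * chain q fs t) \<partial>lborel) \<in> borel_measurable borel"
    by measurable
  then show ?case by simp
next
  case Nil
  have "chain q [] = (\<lambda>_. 1)" by (rule ext) simp
  then show ?case by simp
qed

text \<open>The discounts of successive differences telescope by \<open>disc_mult\<close>; the
  ordered times fill one of \<open>fact k\<close> equal parts of a cube, which turns the iterated
  integral into a power.\<close>

lemma chain_replicate:
  assumes [measurable]: "\<phi> \<in> borel_measurable borel" "g \<in> borel_measurable borel"
  shows "fact k * chain q (replicate k \<phi> @ [g]) r = (\<integral>\<^sup>+ t. disc q (t - r) * (run \<phi> r t ^ k * g t) \<partial>lborel)"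
proof (induction k arbitrary: r)
  case 0
  then show ?case by simp
next
  case (Suc k)
  let ?C = "chain q (replicate k \<phi> @ [g])"
  have [measurable]: "?C \<in> borel_measurable borel" by (rule chain_measurable) auto
  have "fact (Suc k) * chain q (replicate (Suc k) \<phi> @ [g]) r =
      (of_nat (Suc k) * fact k) * (\<integral>\<^sup>+ v. disc q (v - r) * (\<phi> v * ?C v) \<partial>lborel)"
    by simp
  also have "\<dots> = (\<integral>\<^sup>+ v. (of_nat (Suc k) * fact k) * (disc q (v - r) * (\<phi> v * ?C v)) \<partial>lborel)"
    by (rule nn_integral_cmult[symmetric]) measurable
  also have "\<dots> = (\<integral>\<^sup>+ v. of_nat (Suc k) * (disc q (v - r) * \<phi> v) *
      (\<integral>\<^sup>+ t. disc q (t - v) * (run \<phi> v t ^ k * g t) \<partial>lborel) \<partial>lborel)"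
    unfolding Suc[symmetric] by (intro nn_integral_cong) (simp only: mult_ac)
  also have "\<dots> = (\<integral>\<^sup>+ v. (\<integral>\<^sup>+ t. of_nat (Suc k) * (disc q (v - r) * \<phi> v) *
      (disc q (t - v) * (run \<phi> v t ^ k * g t)) \<partial>lborel) \<partial>lborel)"
    by (intro nn_integral_cong nn_integral_cmult[symmetric]) measurable
  also have "\<dots> = (\<integral>\<^sup>+ t. (\<integral>\<^sup>+ v. of_nat (Suc k) * (disc q (v - r) * \<phi> v) *
      (disc q (t - v) * (run \<phi> v t ^ k * g t)) \<partial>lborel) \<partial>lborel)"
    by (rule lborel_pair.Fubini') measurable
  also have "\<dots> = (\<integral>\<^sup>+ t. disc q (t - r) * (run \<phi> r t ^ Suc k * g t) \<partial>lborel)"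
  proof (intro nn_integral_cong)
    fix t
    have "(\<integral>\<^sup>+ v. of_nat (Suc k) * (disc q (v - r) * \<phi> v) * (disc q (t - v) * (run \<phi> v t ^ k * g t)) \<partial>lborel) =
        (\<integral>\<^sup>+ v. (of_nat (Suc k) * disc q (t - r) * g t) * (if r \<le> v \<and> v \<le> t then \<phi> v * run \<phi> v t ^ k else 0) \<partial>lborel)"
    proof (intro nn_integral_cong)
      fix v
      have "of_nat (Suc k) * (disc q (v - r) * \<phi> v) * (disc q (t - v) * (run \<phi> v t ^ k * g t)) =
          (disc q (v - r) * disc q (t - v)) * (of_nat (Suc k) * g t * (\<phi> v * run \<phi> v t ^ k))"
        by (simp only: mult_ac)
      then show "of_nat (Suc k) * (disc q (v - r) * \<phi> v) * (disc q (t - v) * (run \<phi> v t ^ k * g t)) =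
          (of_nat (Suc k) * disc q (t - r) * g t) * (if r \<le> v \<and> v \<le> t then \<phi> v * run \<phi> v t ^ k else 0)"
        unfolding disc_mult by (simp add: mult_ac)
    qed
    also have "\<dots> = (of_nat (Suc k) * disc q (t - r) * g t) * (\<integral>\<^sup>+ v. (if r \<le> v \<and> v \<le> t then \<phi> v * run \<phi> v t ^ k else 0) \<partial>lborel)"
      by (rule nn_integral_cmult) measurable
    also have "\<dots> = disc q (t - r) * (run \<phi> r t ^ Suc k * g t)"
      unfolding iterated_integral_power[OF assms(1), symmetric] by (simp only: mult_ac)
    finally show "(\<integral>\<^sup>+ v. of_nat (Suc k) * (disc q (v - r) * \<phi> v) * (disc q (t - v) * (run \<phi> v t ^ k * g t)) \<partial>lborel) =
        disc q (t - r) * (run \<phi> r t ^ Suc k * g t)" .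
  qed
  finally show ?case .
qed

text \<open>The discount is the survival probability of an exponential time of rate
  \<open>q\<close>, so a discounted integral becomes an integral up to a random horizon.\<close>

lemma disc_integral_by_parts:
  assumes q: "0 < q" and [measurable]: "f \<in> borel_measurable borel"
  shows "(\<integral>\<^sup>+ t. disc q t * f t \<partial>lborel) = (\<integral>\<^sup>+ s. ennreal q * disc q s * run f 0 s \<partial>lborel)"
proof -
  have "(\<integral>\<^sup>+ s. ennreal q * disc q s * run f 0 s \<partial>lborel) =
      (\<integral>\<^sup>+ s. (\<integral>\<^sup>+ t. ennreal q * disc q s * (if 0 \<le> t \<and> t \<le> s then f t else 0) \<partial>lborel) \<partial>lborel)"
    unfolding run_def by (intro nn_integral_cong nn_integral_cmult[symmetric]) measurable
  also have "\<dots> = (\<integral>\<^sup>+ t. (\<integral>\<^sup>+ s. ennreal q * disc q s * (if 0 \<le> t \<and> t \<le> s then f t else 0) \<partial>lborel) \<partial>lborel)"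
    by (rule lborel_pair.Fubini') measurable
  also have "\<dots> = (\<integral>\<^sup>+ t. disc q t * f t \<partial>lborel)"
  proof (intro nn_integral_cong)
    fix t :: real
    have "(\<integral>\<^sup>+ s. ennreal q * disc q s * (if 0 \<le> t \<and> t \<le> s then f t else 0) \<partial>lborel) =
        (\<integral>\<^sup>+ s. (if t \<le> s then ennreal q * disc q s else 0) * (if 0 \<le> t then f t else 0) \<partial>lborel)"
      by (intro nn_integral_cong) auto
    also have "\<dots> = (\<integral>\<^sup>+ s. (if t \<le> s then ennreal q * disc q s else 0) \<partial>lborel) * (if 0 \<le> t then f t else 0)"
      by (rule nn_integral_multc) measurable
    also have "\<dots> = disc q t * f t"
      using disc_tail[OF q, of t] by (cases "0 \<le> t") (simp_all add: disc_def)
    finally show "(\<integral>\<^sup>+ s. ennreal q * disc q s * (if 0 \<le> t \<and> t \<le> s then f t else 0) \<partial>lborel) = disc q t * f t" .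
  qed
  finally show ?thesis by simp
qed

text \<open>Second moments give uniform integrability. Fatou's lemma is the lower bound; for the
  upper one the part above \<open>Suc n\<close> costs at most \<open>C / Suc n\<close>, and the
  truncated part converges by domination.\<close>

lemma nn_integral_convergence_L2_bounded:
  fixes f :: "nat \<Rightarrow> 'b \<Rightarrow> ennreal"
  assumes "finite_measure N" and [measurable]: "\<And>j. f j \<in> borel_measurable N" "g \<in> borel_measurable N"
    and lim: "AE x in N. (\<lambda>j. f j x) \<longlonglongrightarrow> g x"
    and C: "\<And>j. (\<integral>\<^sup>+ x. f j x ^ 2 \<partial>N) \<le> C" "C < \<infinity>"
  shows "(\<lambda>j. \<integral>\<^sup>+ x. f j x \<partial>N) \<longlonglongrightarrow> (\<integral>\<^sup>+ x. g x \<partial>N)"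
proof -
  interpret finite_measure N by fact
  have "(\<integral>\<^sup>+ x. g x \<partial>N) = (\<integral>\<^sup>+ x. liminf (\<lambda>j. f j x) \<partial>N)"
    using lim by (intro nn_integral_cong_AE, eventually_elim) (auto dest: lim_imp_Liminf[rotated])
  also have "\<dots> \<le> liminf (\<lambda>j. \<integral>\<^sup>+ x. f j x \<partial>N)"
    by (rule nn_integral_liminf) measurable
  finally have lower: "(\<integral>\<^sup>+ x. g x \<partial>N) \<le> liminf (\<lambda>j. \<integral>\<^sup>+ x. f j x \<partial>N)" .
  have upper: "limsup (\<lambda>j. \<integral>\<^sup>+ x. f j x \<partial>N) \<le> (\<integral>\<^sup>+ x. g x \<partial>N) + C / ennreal (Suc n)" for n :: nat
  proof -
    have pw: "y \<le> min y (ennreal (Suc n)) + y ^ 2 / ennreal (Suc n)" for y :: ennreal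
    proof (cases "y \<le> ennreal (Suc n)")
      case True then show ?thesis by (simp add: min_def add_increasing2)
    next
      case False
      then have gt: "ennreal (Suc n) \<le> y" by simp
      have "y = ennreal (Suc n) * y / ennreal (Suc n)"
        by (simp add: ennreal_mult_divide_eq mult.commute)
      also have "\<dots> \<le> y * y / ennreal (Suc n)"
        by (intro divide_right_mono_ennreal mult_right_mono gt) auto
      finally show ?thesis by (simp add: power2_eq_square add_increasing)
    qed
    have le: "(\<integral>\<^sup>+ x. f j x \<partial>N) \<le> (\<integral>\<^sup>+ x. min (f j x) (ennreal (Suc n)) \<partial>N) + C / ennreal (Suc n)" for j
    proof -
      have "(\<integral>\<^sup>+ x. f j x \<partial>N) \<le> (\<integral>\<^sup>+ x. min (f j x) (ennreal (Suc n)) + f j x ^ 2 / ennreal (Suc n) \<partial>N)"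
        by (intro nn_integral_mono pw)
      also have "\<dots> = (\<integral>\<^sup>+ x. min (f j x) (ennreal (Suc n)) \<partial>N) + (\<integral>\<^sup>+ x. f j x ^ 2 \<partial>N) / ennreal (Suc n)"
        by (subst nn_integral_add) (auto simp: nn_integral_divide)
      also have "\<dots> \<le> (\<integral>\<^sup>+ x. min (f j x) (ennreal (Suc n)) \<partial>N) + C / ennreal (Suc n)"
        by (intro add_left_mono divide_right_mono_ennreal C)
      finally show ?thesis .
    qed
    have "(\<lambda>j. \<integral>\<^sup>+ x. min (f j x) (ennreal (Suc n)) \<partial>N) \<longlonglongrightarrow> (\<integral>\<^sup>+ x. min (g x) (ennreal (Suc n)) \<partial>N)"
    proof (rule nn_integral_dominated_convergence[where w = "\<lambda>_. ennreal (Suc n)"])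
      show "(\<integral>\<^sup>+ x. ennreal (Suc n) \<partial>N) < \<infinity>"
        using finite_emeasure_space by (simp add: less_top[symmetric] ennreal_mult_eq_top_iff ennreal_add_eq_top)
      show "AE x in N. (\<lambda>j. min (f j x) (ennreal (Suc n))) \<longlonglongrightarrow> min (g x) (ennreal (Suc n))"
        using lim by eventually_elim (intro tendsto_min tendsto_const)
    qed auto
    then have "(\<lambda>j. (\<integral>\<^sup>+ x. min (f j x) (ennreal (Suc n)) \<partial>N) + C / ennreal (Suc n)) \<longlonglongrightarrow>
        (\<integral>\<^sup>+ x. min (g x) (ennreal (Suc n)) \<partial>N) + C / ennreal (Suc n)"
      by (intro tendsto_intros)
    then have "limsup (\<lambda>j. (\<integral>\<^sup>+ x. min (f j x) (ennreal (Suc n)) \<partial>N) + C / ennreal (Suc n)) =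
        (\<integral>\<^sup>+ x. min (g x) (ennreal (Suc n)) \<partial>N) + C / ennreal (Suc n)"
      by (rule lim_imp_Limsup[rotated]) simp
    moreover have "limsup (\<lambda>j. \<integral>\<^sup>+ x. f j x \<partial>N) \<le> limsup (\<lambda>j. (\<integral>\<^sup>+ x. min (f j x) (ennreal (Suc n)) \<partial>N) + C / ennreal (Suc n))"
      by (intro Limsup_mono always_eventually allI le)
    moreover have "(\<integral>\<^sup>+ x. min (g x) (ennreal (Suc n)) \<partial>N) \<le> (\<integral>\<^sup>+ x. g x \<partial>N)"
      by (intro nn_integral_mono) auto
    ultimately show ?thesis by (metis (no_types, lifting) add_right_mono order_trans)
  qed
  have "limsup (\<lambda>j. \<integral>\<^sup>+ x. f j x \<partial>N) \<le> (\<integral>\<^sup>+ x. g x \<partial>N)"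
  proof (rule LIMSEQ_le_const)
    obtain r where r: "C = ennreal r" "0 \<le> r" using C(2) by (cases C) auto
    have "(\<lambda>n. r * (1 / real (Suc n))) \<longlonglongrightarrow> r * 0"
      by (intro tendsto_intros LIMSEQ_Suc lim_1_over_n)
    then have "(\<lambda>n. ennreal (r / real (Suc n))) \<longlonglongrightarrow> ennreal 0"
      by (intro tendsto_ennrealI) simp
    then have "(\<lambda>n. (\<integral>\<^sup>+ x. g x \<partial>N) + ennreal (r / real (Suc n))) \<longlonglongrightarrow> (\<integral>\<^sup>+ x. g x \<partial>N) + ennreal 0"
      by (intro tendsto_add tendsto_const)
    moreover have "C / ennreal (Suc n) = ennreal (r / real (Suc n))" for n
      unfolding r(1) by (rule divide_ennreal) (use r in auto)
    ultimately show "(\<lambda>n. (\<integral>\<^sup>+ x. g x \<partial>N) + C / ennreal (Suc n)) \<longlonglongrightarrow> (\<integral>\<^sup>+ x. g x \<partial>N)"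
      by simp
  qed (use upper in auto)
  moreover have "liminf (\<lambda>j. \<integral>\<^sup>+ x. f j x \<partial>N) \<le> limsup (\<lambda>j. \<integral>\<^sup>+ x. f j x \<partial>N)"
    by (rule Liminf_le_Limsup) simp
  ultimately show ?thesis
    using lower by (subst tendsto_iff_Liminf_eq_Limsup) (auto intro: antisym order_trans)
qed

lemma nn_integral_below:
  fixes z :: real
  shows "(\<integral>\<^sup>+ \<eta>. (if 0 \<le> \<eta> \<and> \<eta> < z then 1 else 0) \<partial>lborel) = ennreal z"
proof -
  have "(\<integral>\<^sup>+ \<eta>. (if 0 \<le> \<eta> \<and> \<eta> < z then 1 else 0) \<partial>lborel) = (\<integral>\<^sup>+ \<eta>. indicator {0..<z} \<eta> \<partial>lborel)"
    by (intro nn_integral_cong) (auto simp: indicator_def)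
  then show ?thesis by (cases "0 \<le> z") (auto simp: ennreal_neg)
qed

text \<open>The layer-cake formula reduces the convergence of \<open>\<integral> Z dA\<^sub>j\<close> to that of the
  increments of \<open>A\<^sub>j\<close>, since the superlevel sets of \<open>Z\<close> are intervals.\<close>

lemma stieltjes_convergence:
  fixes A Z :: "real \<Rightarrow> real" and Aj :: "nat \<Rightarrow> real \<Rightarrow> real" and a :: "nat \<Rightarrow> real \<Rightarrow> ennreal"
  assumes [measurable]: "\<And>j. a j \<in> borel_measurable borel" and s: "0 \<le> s"
    and Aj: "\<And>j t. 0 \<le> t \<Longrightarrow> t \<le> s \<Longrightarrow> run (a j) 0 t = ennreal (Aj j t)" "\<And>j t. 0 \<le> Aj j t"
    and lim: "\<And>t. 0 \<le> t \<Longrightarrow> t \<le> s \<Longrightarrow> (\<lambda>j. Aj j t) \<longlonglongrightarrow> A t"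
    and A: "A 0 = 0" "continuous_on {0..s} A" "mono_on {0..s} A"
    and Z: "continuous_on {0..s} Z" "mono_on {0..s} Z" "\<And>t. 0 \<le> t \<Longrightarrow> t \<le> s \<Longrightarrow> 0 \<le> Z t"
  defines "T \<equiv> \<lambda>\<zeta>. Inf {t. 0 \<le> t \<and> t \<le> s \<and> \<zeta> \<le> A t}"
  shows "(\<lambda>j. run (\<lambda>t. ennreal (Z t) * a j t) 0 s) \<longlonglongrightarrow>
    (\<integral>\<^sup>+ \<zeta>. (if 0 < \<zeta> \<and> \<zeta> \<le> A s then ennreal (Z (T \<zeta>)) else 0) \<partial>lborel)"
proof -
  \<comment> \<open>Freezing \<open>Z\<close> outside \<open>{0..s}\<close> makes it monotone on the
    line, hence Borel; \<open>Tc\<close> below serves the same end.\<close>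
  define Zc where "Zc t = Z (max 0 (min s t))" for t
  have Zc_eq: "Zc t = Z t" if "0 \<le> t" "t \<le> s" for t using that by (simp add: Zc_def)
  have Zc_mono: "mono Zc"
    unfolding Zc_def using s by (auto intro!: monoI mono_onD[OF Z(2)])
  have [measurable]: "Zc \<in> borel_measurable borel" by (rule borel_measurable_mono[OF Zc_mono])
  have A_mono: "A t \<le> A t'" if "0 \<le> t" "t \<le> t'" "t' \<le> s" for t t'
    using mono_onD[OF A(3), of t t'] that by auto
  have T: "0 \<le> T \<zeta>" "T \<zeta> \<le> s" "\<zeta> \<le> A (T \<zeta>)" "\<And>t. 0 \<le> t \<Longrightarrow> t \<le> s \<Longrightarrow> \<zeta> \<le> A t \<longleftrightarrow> T \<zeta> \<le> t"
    if \<zeta>: "\<zeta> \<le> A s" for \<zeta>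
  proof -
    let ?S = "{t. 0 \<le> t \<and> t \<le> s \<and> \<zeta> \<le> A t}"
    have "?S = {0..s} \<inter> A -` {\<zeta>..}" by auto
    moreover have "closed ({0..s} \<inter> A -` {\<zeta>..})"
      by (intro continuous_closed_preimage A(2)) auto
    ultimately have "closed ?S" by simp
    moreover have "?S \<noteq> {}" "bdd_below ?S" using \<zeta> s by (auto intro!: bdd_belowI[of _ 0])
    ultimately have "T \<zeta> \<in> ?S" unfolding T_def by (intro closed_contains_Inf)
    then show 1: "0 \<le> T \<zeta>" "T \<zeta> \<le> s" "\<zeta> \<le> A (T \<zeta>)" by auto
    show "\<zeta> \<le> A t \<longleftrightarrow> T \<zeta> \<le> t" if t: "0 \<le> t" "t \<le> s" for t
    proof
      assume "\<zeta> \<le> A t"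
      then show "T \<zeta> \<le> t" unfolding T_def using t \<open>bdd_below ?S\<close> by (intro cInf_lower) auto
    next
      assume "T \<zeta> \<le> t"
      then show "\<zeta> \<le> A t" using 1 A_mono[of "T \<zeta>" t] t by auto
    qed
  qed
  define Tc where "Tc \<zeta> = T (min \<zeta> (A s))" for \<zeta>
  have "mono Tc"
  proof (rule monoI)
    fix \<zeta> \<zeta>' :: real assume "\<zeta> \<le> \<zeta>'"
    then show "Tc \<zeta> \<le> Tc \<zeta>'"
      unfolding Tc_def using T(1-3)[of "min \<zeta>' (A s)"] by (subst T(4)[symmetric]) auto
  qed
  then have [measurable]: "Tc \<in> borel_measurable borel" by (rule borel_measurable_mono)
  have Tc_eq: "Tc \<zeta> = T \<zeta>" if "\<zeta> \<le> A s" for \<zeta> using that by (simp add: Tc_def)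
  \<comment> \<open>\<open>Q j \<eta>\<close> is the mass that the density \<open>a j\<close> gives
    to the superlevel set of \<open>Z\<close> at \<eta>, and \<open>Q' \<eta>\<close> is the mass of
    that set under \<open>A\<close>, measured in the variable \<zeta>.\<close>
  define Q where "Q j \<eta> = (if 0 \<le> \<eta> then \<integral>\<^sup>+ t. (if 0 \<le> t \<and> t \<le> s \<and> \<eta> < Zc t then a j t else 0) \<partial>lborel else 0)" for j \<eta>
  define Q' where "Q' \<eta> = (if 0 \<le> \<eta> then \<integral>\<^sup>+ \<zeta>. (if 0 < \<zeta> \<and> \<zeta> \<le> A s \<and> \<eta> < Zc (Tc \<zeta>) then 1 else 0) \<partial>lborel else 0)" for \<eta>
  have [measurable]: "Q j \<in> borel_measurable borel" "Q' \<in> borel_measurable borel" for j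
    unfolding Q_def Q'_def by measurable
  have Q: "run (\<lambda>t. ennreal (Z t) * a j t) 0 s = (\<integral>\<^sup>+ \<eta>. Q j \<eta> \<partial>lborel)" for j
  proof -
    have "run (\<lambda>t. ennreal (Z t) * a j t) 0 s =
        (\<integral>\<^sup>+ t. (\<integral>\<^sup>+ \<eta>. (if 0 \<le> \<eta> \<and> \<eta> < Zc t then 1 else 0) \<partial>lborel) * (if 0 \<le> t \<and> t \<le> s then a j t else 0) \<partial>lborel)"
      unfolding run_def nn_integral_below by (intro nn_integral_cong) (auto simp: Zc_eq)
    also have "\<dots> = (\<integral>\<^sup>+ t. (\<integral>\<^sup>+ \<eta>. (if 0 \<le> \<eta> \<and> \<eta> < Zc t then 1 else 0) * (if 0 \<le> t \<and> t \<le> s then a j t else 0) \<partial>lborel) \<partial>lborel)"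
      by (intro nn_integral_cong nn_integral_multc[symmetric]) measurable
    also have "\<dots> = (\<integral>\<^sup>+ \<eta>. (\<integral>\<^sup>+ t. (if 0 \<le> \<eta> \<and> \<eta> < Zc t then 1 else 0) * (if 0 \<le> t \<and> t \<le> s then a j t else 0) \<partial>lborel) \<partial>lborel)"
      by (rule lborel_pair.Fubini') measurable
    also have "\<dots> = (\<integral>\<^sup>+ \<eta>. Q j \<eta> \<partial>lborel)"
      unfolding Q_def by (intro nn_integral_cong) (auto intro!: nn_integral_cong)
    finally show ?thesis .
  qed
  have Q': "(\<integral>\<^sup>+ \<zeta>. (if 0 < \<zeta> \<and> \<zeta> \<le> A s then ennreal (Z (T \<zeta>)) else 0) \<partial>lborel) = (\<integral>\<^sup>+ \<eta>. Q' \<eta> \<partial>lborel)"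
  proof -
    have "(\<integral>\<^sup>+ \<zeta>. (if 0 < \<zeta> \<and> \<zeta> \<le> A s then ennreal (Z (T \<zeta>)) else 0) \<partial>lborel) =
        (\<integral>\<^sup>+ \<zeta>. (\<integral>\<^sup>+ \<eta>. (if 0 < \<zeta> \<and> \<zeta> \<le> A s \<and> 0 \<le> \<eta> \<and> \<eta> < Zc (Tc \<zeta>) then 1 else 0) \<partial>lborel) \<partial>lborel)"
    proof (intro nn_integral_cong)
      fix \<zeta> :: real
      show "(if 0 < \<zeta> \<and> \<zeta> \<le> A s then ennreal (Z (T \<zeta>)) else 0) =
          (\<integral>\<^sup>+ \<eta>. (if 0 < \<zeta> \<and> \<zeta> \<le> A s \<and> 0 \<le> \<eta> \<and> \<eta> < Zc (Tc \<zeta>) then 1 else 0) \<partial>lborel)"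
        using nn_integral_below[of "Zc (Tc \<zeta>)"] T(1,2)[of \<zeta>]
        by (cases "0 < \<zeta> \<and> \<zeta> \<le> A s") (auto simp: Tc_eq Zc_eq)
    qed
    also have "\<dots> = (\<integral>\<^sup>+ \<eta>. (\<integral>\<^sup>+ \<zeta>. (if 0 < \<zeta> \<and> \<zeta> \<le> A s \<and> 0 \<le> \<eta> \<and> \<eta> < Zc (Tc \<zeta>) then 1 else 0) \<partial>lborel) \<partial>lborel)"
      by (rule lborel_pair.Fubini') measurable
    also have "\<dots> = (\<integral>\<^sup>+ \<eta>. Q' \<eta> \<partial>lborel)"
      unfolding Q'_def by (intro nn_integral_cong) (auto intro!: nn_integral_cong)
    finally show ?thesis .
  qed
  have limQ: "(\<lambda>j. Q j \<eta>) \<longlonglongrightarrow> Q' \<eta>" for \<eta>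
  proof (cases "0 \<le> \<eta>")
    case False
    then show ?thesis by (simp add: Q_def Q'_def)
  next
    case True
    let ?K = "{t. 0 \<le> t \<and> t \<le> s \<and> Z t \<le> \<eta>}"
    show ?thesis
    proof (cases "?K = {}")
      case empty: True
      have Zgt: "\<eta> < Zc t" if "0 \<le> t" "t \<le> s" for t using empty that by (force simp: Zc_eq)
      have "Q j \<eta> = ennreal (Aj j s)" for j
        using True s Zgt unfolding Q_def Aj(1)[OF s order_refl, symmetric] run_def
        by (auto intro!: nn_integral_cong)
      moreover have "Q' \<eta> = ennreal (A s)"
      proof -
        have "Q' \<eta> = (\<integral>\<^sup>+ \<zeta>. indicator {0<..A s} \<zeta> \<partial>lborel)"
          unfolding Q'_def using True Zgt T(1,2)
          by (auto intro!: nn_integral_cong simp: indicator_def Tc_eq)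
        then show ?thesis using A_mono[of 0 s] A(1) s by simp
      qed
      ultimately show ?thesis using lim[OF s order_refl] by (simp add: tendsto_ennrealI)
    next
      case ne: False
      have "?K = {0..s} \<inter> Z -` {..\<eta>}" by auto
      moreover have "closed ({0..s} \<inter> Z -` {..\<eta>})"
        by (intro continuous_closed_preimage Z(1)) auto
      ultimately have cl: "closed ?K" by simp
      have bdd: "bdd_above ?K" by (auto intro!: bdd_aboveI[of _ s])
      \<comment> \<open>The last time at which \<open>Z\<close> is at most \<eta>: the superlevel
        set is the interval from \<kappa> to \<open>s\<close>, and its mass is an increment of
        \<open>Aj j\<close>.\<close>
      define \<kappa> where "\<kappa> = Sup ?K"
      have "\<kappa> \<in> ?K" unfolding \<kappa>_def by (rule closed_contains_Sup[OF ne bdd cl])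
      then have \<kappa>: "0 \<le> \<kappa>" "\<kappa> \<le> s" "Z \<kappa> \<le> \<eta>" by auto
      have Z_iff: "\<eta> < Zc t \<longleftrightarrow> \<kappa> < t" if t: "0 \<le> t" "t \<le> s" for t
      proof
        assume "\<eta> < Zc t"
        then show "\<kappa> < t" using mono_onD[OF Z(2), of t \<kappa>] t \<kappa> by (force simp: Zc_eq not_less)
      next
        assume "\<kappa> < t"
        then have "t \<notin> ?K" using cSup_upper[OF _ bdd] unfolding \<kappa>_def by (meson not_less)
        then show "\<eta> < Zc t" using t by (auto simp: Zc_eq)
      qed
      have Qj: "Q j \<eta> = ennreal (Aj j s - Aj j \<kappa>)" for j
      proof -
        have "Q j \<eta> = run (a j) \<kappa> s"
          unfolding Q_def run_def
        proof (subst if_P[OF True], intro nn_integral_cong_AE)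
          show "AE t in lborel. (if 0 \<le> t \<and> t \<le> s \<and> \<eta> < Zc t then a j t else 0) = (if \<kappa> \<le> t \<and> t \<le> s then a j t else 0)"
            using AE_lborel_singleton[of \<kappa>]
          proof eventually_elim
            case (elim t)
            show ?case using Z_iff[of t] elim \<kappa> by (cases "0 \<le> t \<and> t \<le> s") auto
          qed
        qed
        moreover have "run (a j) 0 \<kappa> + run (a j) \<kappa> s = run (a j) 0 s"
          by (rule run_split) (use \<kappa> in auto)
        then have eq: "ennreal (Aj j \<kappa>) + run (a j) \<kappa> s = ennreal (Aj j s)"
          using \<kappa> s by (simp add: Aj)
        then have "run (a j) \<kappa> s = ennreal (Aj j s) - ennreal (Aj j \<kappa>)"
          by (metis ennreal_add_diff_cancel_left ennreal_neq_top)
        ultimately show ?thesis using Aj(2)[of j \<kappa>] by (simp add: ennreal_minus)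
      qed
      moreover have "Q' \<eta> = ennreal (A s - A \<kappa>)"
      proof -
        have "Q' \<eta> = (\<integral>\<^sup>+ \<zeta>. indicator {A \<kappa><..A s} \<zeta> \<partial>lborel)"
          unfolding Q'_def
        proof (subst if_P[OF True], intro nn_integral_cong)
          fix \<zeta> :: real
          have "\<eta> < Zc (Tc \<zeta>) \<longleftrightarrow> A \<kappa> < \<zeta>" if "\<zeta> \<le> A s"
            using Z_iff[of "T \<zeta>"] T[OF that] \<kappa> by (simp add: Tc_eq that not_le[symmetric])
          moreover have "0 \<le> A \<kappa>" using A_mono[of 0 \<kappa>] A(1) \<kappa> by simp
          ultimately show "(if 0 < \<zeta> \<and> \<zeta> \<le> A s \<and> \<eta> < Zc (Tc \<zeta>) then 1 else 0) = (indicator {A \<kappa><..A s} \<zeta> :: ennreal)"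
            by (auto simp: indicator_def)
        qed
        then show ?thesis using A_mono[of \<kappa> s] \<kappa> by simp
      qed
      ultimately show ?thesis
        using lim[of s] lim[of \<kappa>] s \<kappa> by (auto intro!: tendsto_ennrealI tendsto_diff)
    qed
  qed
  have "Bseq (\<lambda>j. Aj j s)" using lim[OF s order_refl] by (intro convergent_imp_Bseq convergentI)
  then obtain B where B: "\<And>j. Aj j s \<le> B" by (auto simp: Bseq_def abs_le_iff)
  have "(\<lambda>j. \<integral>\<^sup>+ \<eta>. Q j \<eta> \<partial>lborel) \<longlonglongrightarrow> (\<integral>\<^sup>+ \<eta>. Q' \<eta> \<partial>lborel)"
  proof (rule nn_integral_dominated_convergence[where w = "\<lambda>\<eta>. ennreal B * indicator {0..<Z s} \<eta>"])
    show "AE \<eta> in lborel. Q j \<eta> \<le> ennreal B * indicator {0..<Z s} \<eta>" for j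
    proof (rule AE_I2)
      fix \<eta> :: real
      show "Q j \<eta> \<le> ennreal B * indicator {0..<Z s} \<eta>"
      proof (cases "0 \<le> \<eta> \<and> \<eta> < Z s")
        case True
        have "Q j \<eta> \<le> run (a j) 0 s"
          unfolding Q_def run_def using True by (auto intro!: nn_integral_mono)
        also have "\<dots> \<le> ennreal B" using Aj(1)[OF s order_refl, of j] B by (simp add: ennreal_leI)
        finally show ?thesis using True by simp
      next
        case False
        have "\<not> \<eta> < Zc t" if "0 \<le> \<eta>" "0 \<le> t" "t \<le> s" for t
          using mono_onD[OF Z(2), of t s] that False s by (auto simp: Zc_eq)
        then have "Q j \<eta> = 0" unfolding Q_def by (auto intro!: nn_integral_zero' AE_I2)
        then show ?thesis by simp
      qed
    qed
    show "(\<integral>\<^sup>+ \<eta>. ennreal B * indicator {0..<Z s} \<eta> \<partial>lborel) < \<infinity>"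
      using Z(3)[OF s order_refl] by (simp add: nn_integral_cmult_indicator ennreal_mult_less_top)
  qed (use limQ in auto)
  then show ?thesis by (simp add: Q Q')
qed

section \<open>Chains of resolvent kernels\<close>

text \<open>The spatial counterpart of \<open>chain\<close>: after averaging over the path the
  ordered times disappear, and each factor is reached from the previous one by a resolvent
  step.\<close>

primrec kernel_chain :: "real measure \<Rightarrow> (real \<Rightarrow> ennreal) list \<Rightarrow> real \<Rightarrow> ennreal" where
  "kernel_chain U [] y = 1"
| "kernel_chain U (f # fs) y = (\<integral>\<^sup>+ z. f (y + z) * kernel_chain U fs (y + z) \<partial>U)"

lemma kernel_chain_measurable:
  assumes [measurable_cong]: "sets U = sets borel" and "sigma_finite_measure U"
  shows "(\<And>f. f \<in> set fs \<Longrightarrow> f \<in> borel_measurable borel) \<Longrightarrow> kernel_chain U fs \<in> borel_measurable borel"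
proof (induction fs)
  case Nil
  have "kernel_chain U [] = (\<lambda>_. 1)" by (rule ext) simp
  then show ?case by simp
next
  case (Cons f fs)
  interpret sigma_finite_measure U by fact
  have [measurable]: "f \<in> borel_measurable borel" "kernel_chain U fs \<in> borel_measurable borel"
    using Cons by auto
  have "(\<lambda>y. \<integral>\<^sup>+ z. f (y + z) * kernel_chain U fs (y + z) \<partial>U) \<in> borel_measurable borel"
    by measurable
  then show ?case by simp
qed

section \<open>Processes with stationary independent increments and the Kac moment formula\<close>

locale increments_process = prob_space M for M :: "'a measure" +
  fixes X :: "real \<Rightarrow> 'a \<Rightarrow> real"
  assumes joint: "(\<lambda>p. X (fst p) (snd p)) \<in> borel_measurable (borel \<Otimes>\<^sub>M M)"
    and X_zero: "AE \<omega> in M. X 0 \<omega> = 0"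
    and indep: "\<And>(n::nat) t. 0 \<le> t 0 \<Longrightarrow> mono_on {..n} t \<Longrightarrow>
       indep_vars (\<lambda>_. borel) (\<lambda>i \<omega>. X (t (Suc i)) \<omega> - X (t i) \<omega>) {..<n}"
    and stat: "\<And>s h. 0 \<le> s \<Longrightarrow> 0 \<le> h \<Longrightarrow> distr M borel (\<lambda>\<omega>. X (s + h) \<omega> - X s \<omega>) = distr M borel (X h)"
begin

lemma X_measurable [measurable (raw)]:
  assumes [measurable]: "f \<in> borel_measurable N" "g \<in> measurable N M"
  shows "(\<lambda>x. X (f x) (g x)) \<in> borel_measurable N"
  using measurable_compose[of "\<lambda>x. (f x, g x)" N "borel \<Otimes>\<^sub>M M", OF _ joint] by simp

text \<open>Almost surely the positions are partial sums of increments, as \<open>X 0\<close> is 0.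
  Independence of the first \<open>n\<close> increments from the next one makes the law of the pair
  a product, and the last increment is integrated first.\<close>

lemma markov:
  assumes t: "t 0 = 0" "mono_on {..Suc n} t"
    and [measurable]: "\<Psi> \<in> borel_measurable (PiM {..n} (\<lambda>_. borel))" "g \<in> borel_measurable borel"
  shows "(\<integral>\<^sup>+ \<omega>. \<Psi> (\<lambda>i\<in>{..n}. X (t i) \<omega>) * g (X (t (Suc n)) \<omega>) \<partial>M) =
    (\<integral>\<^sup>+ \<omega>. \<Psi> (\<lambda>i\<in>{..n}. X (t i) \<omega>) * (\<integral>\<^sup>+ z. g (X (t n) \<omega> + z) \<partial>distr M borel (X (t (Suc n) - t n))) \<partial>M)"
proof -
  define D where "D i \<omega> = X (t (Suc i)) \<omega> - X (t i) \<omega>" for i \<omega>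
  define G where "G \<omega> = (\<lambda>i\<in>{..<n}. D i \<omega>)" for \<omega>
  define H where "H \<omega> = (\<lambda>i\<in>{n}. D i \<omega>)" for \<omega>
  define pos where "pos a i = (\<Sum>j<i. a j)" for a :: "nat \<Rightarrow> real" and i
  let ?P = "PiM {..<n} (\<lambda>_. borel) :: (nat \<Rightarrow> real) measure"
  let ?P2 = "PiM {n} (\<lambda>_. borel) :: (nat \<Rightarrow> real) measure"
  let ?E = "distr M borel (X (t (Suc n) - t n))"
  have [measurable]: "(\<lambda>\<omega>. D i \<omega>) \<in> borel_measurable M" for i unfolding D_def by measurable
  have [measurable]: "G \<in> measurable M ?P" "H \<in> measurable M ?P2" unfolding G_def H_def by measurable
  have [measurable]: "(\<lambda>a. pos a i) \<in> borel_measurable ?P" if "i \<le> n" for i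
    unfolding pos_def using that by (intro borel_measurable_sum) auto
  have pos_meas: "(\<lambda>a. \<lambda>i\<in>{..n}. pos a i) \<in> measurable ?P (PiM {..n} (\<lambda>_. borel))"
    by (intro measurable_restrict) auto
  have pos_n [measurable]: "(\<lambda>a. pos a n) \<in> borel_measurable ?P" by simp
  define F where "F p = \<Psi> (\<lambda>i\<in>{..n}. pos (fst p) i) * g (pos (fst p) n + snd p)" for p :: "(nat \<Rightarrow> real) \<times> real"
  have [measurable]: "F \<in> borel_measurable (?P \<Otimes>\<^sub>M borel)"
    unfolding F_def
    by (intro borel_measurable_times_ennreal measurable_compose[OF measurable_compose[OF measurable_fst pos_meas] assms(3)]
        measurable_compose[OF _ assms(4)] borel_measurable_add measurable_compose[OF measurable_fst pos_n] measurable_snd)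
  define F' where "F' p = F (fst p, snd p n)" for p :: "(nat \<Rightarrow> real) \<times> (nat \<Rightarrow> real)"
  have [measurable]: "F' \<in> borel_measurable (?P \<Otimes>\<^sub>M ?P2)" unfolding F'_def by measurable
  have "t n \<le> t (Suc n)" "0 \<le> t n"
    using mono_onD[OF t(2), of n "Suc n"] mono_onD[OF t(2), of 0 n] t(1) by auto
  then have dist_D: "distr M borel (D n) = ?E"
    using stat[of "t n" "t (Suc n) - t n"] by (simp add: D_def[abs_def])
  have "indep_vars (\<lambda>_. borel) D {..<Suc n}"
    unfolding D_def[abs_def] using t by (intro indep) auto
  then have "indep_var ?P G ?P2 H"
    unfolding G_def[abs_def] H_def[abs_def] by (rule indep_var_restrict) auto
  then have pair: "distr M ?P G \<Otimes>\<^sub>M distr M ?P2 H = distr M (?P \<Otimes>\<^sub>M ?P2) (\<lambda>\<omega>. (G \<omega>, H \<omega>))"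
    by (simp add: indep_var_distribution_eq)
  interpret H: prob_space "distr M ?P2 H" by (rule prob_space_distr) measurable
  have tele: "(\<Sum>j<i. X (t (Suc j)) \<omega> - X (t j) \<omega>) = X (t i) \<omega> - X 0 \<omega>" for i \<omega>
    using t(1) by (induction i) auto
  have posG: "pos (G \<omega>) i = X (t i) \<omega> - X 0 \<omega>" if "i \<le> n" for i \<omega>
  proof -
    have "pos (G \<omega>) i = (\<Sum>j<i. X (t (Suc j)) \<omega> - X (t j) \<omega>)"
      unfolding pos_def G_def D_def using that by (intro sum.cong) auto
    then show ?thesis by (simp add: tele)
  qed
  have restr: "(\<lambda>i\<in>{..n}. pos (G \<omega>) i) = (\<lambda>i\<in>{..n}. X (t i) \<omega>)" if "X 0 \<omega> = 0" for \<omega>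
    using posG that by (auto intro!: restrict_ext)
  have "(\<integral>\<^sup>+ \<omega>. \<Psi> (\<lambda>i\<in>{..n}. X (t i) \<omega>) * g (X (t (Suc n)) \<omega>) \<partial>M) = (\<integral>\<^sup>+ \<omega>. F (G \<omega>, D n \<omega>) \<partial>M)"
    using X_zero
  proof (intro nn_integral_cong_AE, eventually_elim)
    fix \<omega> assume 0: "X 0 \<omega> = 0"
    show "\<Psi> (\<lambda>i\<in>{..n}. X (t i) \<omega>) * g (X (t (Suc n)) \<omega>) = F (G \<omega>, D n \<omega>)"
      using posG[of n \<omega>] 0 by (simp add: F_def restr D_def)
  qed
  also have "\<dots> = (\<integral>\<^sup>+ \<omega>. F' (G \<omega>, H \<omega>) \<partial>M)" by (simp add: F'_def H_def)
  also have "\<dots> = (\<integral>\<^sup>+ p. F' p \<partial>distr M (?P \<Otimes>\<^sub>M ?P2) (\<lambda>\<omega>. (G \<omega>, H \<omega>)))"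
    by (rule nn_integral_distr[symmetric]) measurable
  also have "\<dots> = (\<integral>\<^sup>+ p. F' p \<partial>(distr M ?P G \<Otimes>\<^sub>M distr M ?P2 H))" by (simp only: pair)
  also have "\<dots> = (\<integral>\<^sup>+ a. (\<integral>\<^sup>+ w. F' (a, w) \<partial>distr M ?P2 H) \<partial>distr M ?P G)"
    by (rule H.nn_integral_fst[symmetric]) simp
  also have "\<dots> = (\<integral>\<^sup>+ \<omega>. (\<integral>\<^sup>+ w. F' (G \<omega>, w) \<partial>distr M ?P2 H) \<partial>M)"
    by (rule nn_integral_distr) measurable
  also have "\<dots> = (\<integral>\<^sup>+ \<omega>. (\<integral>\<^sup>+ z. F (G \<omega>, z) \<partial>?E) \<partial>M)"
  proof (intro nn_integral_cong)
    fix \<omega> assume [measurable]: "\<omega> \<in> space M"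
    have [measurable]: "G \<omega> \<in> space ?P" by (rule measurable_space[of G M]) measurable
    have "(\<integral>\<^sup>+ w. F' (G \<omega>, w) \<partial>distr M ?P2 H) = (\<integral>\<^sup>+ \<omega>'. F' (G \<omega>, H \<omega>') \<partial>M)"
      by (rule nn_integral_distr) measurable
    also have "\<dots> = (\<integral>\<^sup>+ \<omega>'. F (G \<omega>, D n \<omega>') \<partial>M)" by (simp add: F'_def H_def)
    also have "\<dots> = (\<integral>\<^sup>+ z. F (G \<omega>, z) \<partial>distr M borel (D n))"
      by (rule nn_integral_distr[symmetric]) measurable
    finally show "(\<integral>\<^sup>+ w. F' (G \<omega>, w) \<partial>distr M ?P2 H) = (\<integral>\<^sup>+ z. F (G \<omega>, z) \<partial>?E)"
      by (simp only: dist_D)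
  qed
  also have "\<dots> = (\<integral>\<^sup>+ \<omega>. \<Psi> (\<lambda>i\<in>{..n}. X (t i) \<omega>) * (\<integral>\<^sup>+ z. g (X (t n) \<omega> + z) \<partial>?E) \<partial>M)"
    using X_zero
  proof (intro nn_integral_cong_AE, eventually_elim)
    fix \<omega> assume 0: "X 0 \<omega> = 0"
    have "(\<integral>\<^sup>+ z. F (G \<omega>, z) \<partial>?E) = (\<integral>\<^sup>+ z. \<Psi> (\<lambda>i\<in>{..n}. X (t i) \<omega>) * g (X (t n) \<omega> + z) \<partial>?E)"
      using posG[of n \<omega>] 0 by (simp add: F_def restr)
    also have "\<dots> = \<Psi> (\<lambda>i\<in>{..n}. X (t i) \<omega>) * (\<integral>\<^sup>+ z. g (X (t n) \<omega> + z) \<partial>?E)"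
      by (rule nn_integral_cmult) measurable
    finally show "(\<integral>\<^sup>+ z. F (G \<omega>, z) \<partial>?E) = \<Psi> (\<lambda>i\<in>{..n}. X (t i) \<omega>) * (\<integral>\<^sup>+ z. g (X (t n) \<omega> + z) \<partial>?E)" .
  qed
  finally show ?thesis .
qed

definition resolvent_measure :: "real \<Rightarrow> real measure" where
  "resolvent_measure q = distr (density (lborel \<Otimes>\<^sub>M M) (\<lambda>p. disc q (fst p))) borel (\<lambda>p. X (fst p) (snd p))"

lemma sets_resolvent_measure [simp, measurable_cong]: "sets (resolvent_measure q) = sets borel"
  by (simp add: resolvent_measure_def)

lemma nn_integral_resolvent_measure:
  assumes [measurable]: "f \<in> borel_measurable borel"
  shows "(\<integral>\<^sup>+ z. f z \<partial>resolvent_measure q) = (\<integral>\<^sup>+ t. disc q t * (\<integral>\<^sup>+ z. f z \<partial>distr M borel (X t)) \<partial>lborel)"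
proof -
  have "(\<integral>\<^sup>+ z. f z \<partial>resolvent_measure q) = (\<integral>\<^sup>+ p. disc q (fst p) * f (X (fst p) (snd p)) \<partial>(lborel \<Otimes>\<^sub>M M))"
    unfolding resolvent_measure_def by (subst nn_integral_distr) (auto simp: nn_integral_density)
  also have "\<dots> = (\<integral>\<^sup>+ t. (\<integral>\<^sup>+ \<omega>. disc q t * f (X t \<omega>) \<partial>M) \<partial>lborel)"
    by (subst nn_integral_fst[symmetric]) auto
  also have "\<dots> = (\<integral>\<^sup>+ t. disc q t * (\<integral>\<^sup>+ z. f z \<partial>distr M borel (X t)) \<partial>lborel)"
  proof (intro nn_integral_cong)
    fix t
    have "(\<integral>\<^sup>+ z. f z \<partial>distr M borel (X t)) = (\<integral>\<^sup>+ \<omega>. f (X t \<omega>) \<partial>M)"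
      by (rule nn_integral_distr) measurable
    then show "(\<integral>\<^sup>+ \<omega>. disc q t * f (X t \<omega>) \<partial>M) = disc q t * (\<integral>\<^sup>+ z. f z \<partial>distr M borel (X t))"
      by (simp add: nn_integral_cmult)
  qed
  finally show ?thesis .
qed

lemma resolvent_measure_mass:
  assumes "0 < q"
  shows "emeasure (resolvent_measure q) UNIV = ennreal (1 / q)"
proof -
  have one: "emeasure (distr M borel (X t)) UNIV = 1" for t
    by (simp add: emeasure_distr emeasure_space_1)
  have "emeasure (resolvent_measure q) UNIV = (\<integral>\<^sup>+ z. 1 \<partial>resolvent_measure q)"
    by (simp add: resolvent_measure_def)
  also have "\<dots> = (\<integral>\<^sup>+ t. ennreal (exp (- q * t)) * indicator {0..} t \<partial>lborel)"
    by (subst nn_integral_resolvent_measure) (auto simp: one disc_def indicator_def intro!: nn_integral_cong)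
  finally show ?thesis using nn_integral_exp_decay[OF assms] by simp
qed

lemma finite_resolvent_measure: "0 < q \<Longrightarrow> finite_measure (resolvent_measure q)"
  using resolvent_measure_mass[of q]
  by (intro finite_measureI) (simp add: resolvent_measure_def)

definition path_chain :: "real \<Rightarrow> (real \<Rightarrow> ennreal) list \<Rightarrow> real \<Rightarrow> 'a \<Rightarrow> ennreal" where
  "path_chain q fs r \<omega> = chain q (map (\<lambda>f t. f (X t \<omega>)) fs) r"

lemma path_chain_simps:
  "path_chain q [] r \<omega> = 1"
  "path_chain q (f # fs) r \<omega> = (\<integral>\<^sup>+ t. disc q (t - r) * (f (X t \<omega>) * path_chain q fs t \<omega>) \<partial>lborel)"
  by (simp_all add: path_chain_def)

lemma path_chain_measurable:
  "(\<And>f. f \<in> set fs \<Longrightarrow> f \<in> borel_measurable borel) \<Longrightarrow>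
    (\<lambda>p. path_chain q fs (fst p) (snd p)) \<in> borel_measurable (borel \<Otimes>\<^sub>M M)"
proof (induction fs)
  case (Cons f fs)
  have [measurable]: "f \<in> borel_measurable borel" using Cons by auto
  have IH: "(\<lambda>p. path_chain q fs (fst p) (snd p)) \<in> borel_measurable (borel \<Otimes>\<^sub>M M)" using Cons by auto
  have [measurable]: "(\<lambda>x. path_chain q fs (a x) (b x)) \<in> borel_measurable N"
    if [measurable]: "a \<in> borel_measurable N" "b \<in> measurable N M" for a b and N :: "'c measure"
    using measurable_compose[of "\<lambda>x. (a x, b x)" N "borel \<Otimes>\<^sub>M M", OF _ IH] by simp
  show ?case unfolding path_chain_simps by measurable
qed (simp add: path_chain_simps)

lemma path_chain_measurable' [measurable (raw)]:
  assumes "\<And>f. f \<in> set fs \<Longrightarrow> f \<in> borel_measurable borel"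
    and [measurable]: "a \<in> borel_measurable N" "b \<in> measurable N M"
  shows "(\<lambda>x. path_chain q fs (a x) (b x)) \<in> borel_measurable N"
  using measurable_compose[of "\<lambda>x. (a x, b x)" N "borel \<Otimes>\<^sub>M M", OF _ path_chain_measurable[OF assms(1)]] by simp

text \<open>Conditioning on the next time \<open>v\<close> adds \<open>v\<close> to the grid and the
  factor \<open>f (X v \<omega>)\<close> to the past. The induction therefore has to carry an
  arbitrary functional \<Psi> of finitely many earlier positions.\<close>

lemma expectation_path_chain:
  assumes q: "0 < q"
  shows "(\<And>f. f \<in> set fs \<Longrightarrow> f \<in> borel_measurable borel) \<Longrightarrow> t 0 = 0 \<Longrightarrow> mono_on {..n::nat} t \<Longrightarrow>
    \<Psi> \<in> borel_measurable (PiM {..n} (\<lambda>_. borel)) \<Longrightarrow>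
    (\<integral>\<^sup>+ \<omega>. \<Psi> (\<lambda>i\<in>{..n}. X (t i) \<omega>) * path_chain q fs (t n) \<omega> \<partial>M) =
    (\<integral>\<^sup>+ \<omega>. \<Psi> (\<lambda>i\<in>{..n}. X (t i) \<omega>) * kernel_chain (resolvent_measure q) fs (X (t n) \<omega>) \<partial>M)"
proof (induction fs arbitrary: n t \<Psi>)
  case Nil
  then show ?case by (simp add: path_chain_simps)
next
  case (Cons f fs)
  let ?U = "resolvent_measure q"
  let ?K = "kernel_chain ?U fs"
  interpret U: finite_measure ?U by (rule finite_resolvent_measure[OF q])
  have f [measurable]: "f \<in> borel_measurable borel" and fs: "\<And>f. f \<in> set fs \<Longrightarrow> f \<in> borel_measurable borel"
    using Cons.prems by auto
  have [measurable]: "?K \<in> borel_measurable borel"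
    by (rule kernel_chain_measurable[OF _ U.sigma_finite_measure fs]) auto
  note [measurable] = Cons.prems(4)
  have restr [measurable]: "(\<lambda>\<omega>. \<lambda>i\<in>{..n}. X (t i) \<omega>) \<in> measurable M (PiM {..n} (\<lambda>_. borel))"
    by measurable
  let ?Y = "\<lambda>\<omega>. \<Psi> (\<lambda>i\<in>{..n}. X (t i) \<omega>)"
  have [measurable]: "?Y \<in> borel_measurable M" by measurable
  have step: "(\<integral>\<^sup>+ \<omega>. ?Y \<omega> * (f (X v \<omega>) * path_chain q fs v \<omega>) \<partial>M) =
      (\<integral>\<^sup>+ \<omega>. ?Y \<omega> * (\<integral>\<^sup>+ z. f (X (t n) \<omega> + z) * ?K (X (t n) \<omega> + z) \<partial>distr M borel (X (v - t n))) \<partial>M)"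
    if v: "t n \<le> v" for v
  proof -
    define t' where "t' = t(Suc n := v)"
    have t': "t' 0 = 0" "mono_on {..Suc n} t'" "t' (Suc n) = v" "t' n = t n"
      and t'_eq: "\<And>i. i \<le> n \<Longrightarrow> t' i = t i"
      using Cons.prems(2) v mono_onD[OF Cons.prems(3)]
      by (auto simp: t'_def mono_on_def le_Suc_eq intro: order_trans[OF _ v])
    define \<Psi>' where "\<Psi>' w = \<Psi> (restrict w {..n}) * f (w (Suc n))" for w :: "nat \<Rightarrow> real"
    have rm: "(\<lambda>w. restrict w {..n}) \<in> measurable (PiM {..Suc n} (\<lambda>_. borel)) (PiM {..n} (\<lambda>_. borel :: real measure))"
      by (rule measurable_restrict_subset) auto
    have cm: "(\<lambda>w. w (Suc n)) \<in> borel_measurable (PiM {..Suc n} (\<lambda>_. borel :: real measure))"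
      by (rule measurable_component_singleton) simp
    have \<Psi>'_meas: "\<Psi>' \<in> borel_measurable (PiM {..Suc n} (\<lambda>_. borel))"
      unfolding \<Psi>'_def by (intro borel_measurable_times_ennreal measurable_compose[OF rm Cons.prems(4)]
          measurable_compose[OF cm f])
    have \<Psi>'_eq: "\<Psi>' (\<lambda>i\<in>{..Suc n}. X (t' i) \<omega>) = ?Y \<omega> * f (X v \<omega>)" for \<omega>
    proof -
      have "restrict (\<lambda>i\<in>{..Suc n}. X (t' i) \<omega>) {..n} = (\<lambda>i\<in>{..n}. X (t i) \<omega>)"
        by (auto simp: t'_eq fun_eq_iff restrict_def)
      then show ?thesis by (simp add: \<Psi>'_def t'(3))
    qed
    have Y'_eq: "\<Psi> (\<lambda>i\<in>{..n}. X (t' i) \<omega>) = ?Y \<omega>" for \<omega>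
      by (intro arg_cong[where f = \<Psi>] restrict_ext) (simp add: t'_eq)
    have "(\<integral>\<^sup>+ \<omega>. ?Y \<omega> * (f (X v \<omega>) * path_chain q fs v \<omega>) \<partial>M) =
        (\<integral>\<^sup>+ \<omega>. \<Psi>' (\<lambda>i\<in>{..Suc n}. X (t' i) \<omega>) * path_chain q fs (t' (Suc n)) \<omega> \<partial>M)"
      by (simp only: \<Psi>'_eq t'(3) mult.assoc)
    also have "\<dots> = (\<integral>\<^sup>+ \<omega>. \<Psi>' (\<lambda>i\<in>{..Suc n}. X (t' i) \<omega>) * ?K (X (t' (Suc n)) \<omega>) \<partial>M)"
      using fs t' \<Psi>'_meas by (intro Cons.IH) auto
    also have "\<dots> = (\<integral>\<^sup>+ \<omega>. \<Psi> (\<lambda>i\<in>{..n}. X (t' i) \<omega>) * (f (X (t' (Suc n)) \<omega>) * ?K (X (t' (Suc n)) \<omega>)) \<partial>M)"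
      by (simp only: \<Psi>'_eq Y'_eq t'(3) mult.assoc)
    also have "\<dots> = (\<integral>\<^sup>+ \<omega>. \<Psi> (\<lambda>i\<in>{..n}. X (t' i) \<omega>) *
        (\<integral>\<^sup>+ z. f (X (t' n) \<omega> + z) * ?K (X (t' n) \<omega> + z) \<partial>distr M borel (X (t' (Suc n) - t' n))) \<partial>M)"
      by (rule markov[OF t'(1,2) Cons.prems(4), of "\<lambda>y. f y * ?K y"]) measurable
    finally show ?thesis by (simp only: Y'_eq t'(3,4))
  qed
  have "(\<integral>\<^sup>+ \<omega>. ?Y \<omega> * path_chain q (f # fs) (t n) \<omega> \<partial>M) =
      (\<integral>\<^sup>+ \<omega>. (\<integral>\<^sup>+ v. disc q (v - t n) * (?Y \<omega> * (f (X v \<omega>) * path_chain q fs v \<omega>)) \<partial>lborel) \<partial>M)"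
  proof (intro nn_integral_cong)
    fix \<omega> assume [measurable]: "\<omega> \<in> space M"
    have [measurable]: "(\<lambda>v. path_chain q fs v \<omega>) \<in> borel_measurable borel"
      using fs by (intro path_chain_measurable') auto
    have [measurable]: "(\<lambda>v. X v \<omega>) \<in> borel_measurable borel"
      by (intro X_measurable) auto
    have "?Y \<omega> * path_chain q (f # fs) (t n) \<omega> =
        (\<integral>\<^sup>+ v. ?Y \<omega> * (disc q (v - t n) * (f (X v \<omega>) * path_chain q fs v \<omega>)) \<partial>lborel)"
      unfolding path_chain_simps by (rule nn_integral_cmult[symmetric]) measurable
    then show "?Y \<omega> * path_chain q (f # fs) (t n) \<omega> =
        (\<integral>\<^sup>+ v. disc q (v - t n) * (?Y \<omega> * (f (X v \<omega>) * path_chain q fs v \<omega>)) \<partial>lborel)"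
      by (simp only: mult_ac)
  qed
  also have "\<dots> = (\<integral>\<^sup>+ v. (\<integral>\<^sup>+ \<omega>. disc q (v - t n) * (?Y \<omega> * (f (X v \<omega>) * path_chain q fs v \<omega>)) \<partial>M) \<partial>lborel)"
  proof -
    interpret pair_sigma_finite lborel M ..
    have [measurable]: "(\<lambda>p. path_chain q fs (fst p) (snd p)) \<in> borel_measurable (borel \<Otimes>\<^sub>M M)"
      using path_chain_measurable[OF fs] .
    have "(\<lambda>p. disc q (fst p - t n) * (?Y (snd p) * (f (X (fst p) (snd p)) * path_chain q fs (fst p) (snd p))))
        \<in> borel_measurable (lborel \<Otimes>\<^sub>M M)"
      by measurable
    then show ?thesis by (intro Fubini') (simp add: case_prod_unfold)
  qed
  also have "\<dots> = (\<integral>\<^sup>+ v. disc q (v - t n) * (\<integral>\<^sup>+ \<omega>. ?Y \<omega> *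
      (\<integral>\<^sup>+ z. f (X (t n) \<omega> + z) * ?K (X (t n) \<omega> + z) \<partial>distr M borel (X (v - t n))) \<partial>M) \<partial>lborel)"
  proof (intro nn_integral_cong)
    fix v
    have "(\<lambda>\<omega>. ?Y \<omega> * (f (X v \<omega>) * path_chain q fs v \<omega>)) \<in> borel_measurable M"
      using fs by (intro borel_measurable_times_ennreal path_chain_measurable') auto
    then show "(\<integral>\<^sup>+ \<omega>. disc q (v - t n) * (?Y \<omega> * (f (X v \<omega>) * path_chain q fs v \<omega>)) \<partial>M) =
        disc q (v - t n) * (\<integral>\<^sup>+ \<omega>. ?Y \<omega> *
          (\<integral>\<^sup>+ z. f (X (t n) \<omega> + z) * ?K (X (t n) \<omega> + z) \<partial>distr M borel (X (v - t n))) \<partial>M)"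
      using step[of v] by (cases "t n \<le> v") (simp_all add: nn_integral_cmult disc_def)
  qed
  also have "\<dots> = (\<integral>\<^sup>+ v. disc q v * (\<integral>\<^sup>+ \<omega>. ?Y \<omega> *
      (\<integral>\<^sup>+ \<omega>'. f (X (t n) \<omega> + X v \<omega>') * ?K (X (t n) \<omega> + X v \<omega>') \<partial>M) \<partial>M) \<partial>lborel)"
  proof -
    \<comment> \<open>By stationarity the integrand depends on \<open>v\<close> only through
      \<open>v - t n\<close>, so time can be restarted at 0.\<close>
    let ?H = "\<lambda>v. disc q v * (\<integral>\<^sup>+ \<omega>. ?Y \<omega> *
      (\<integral>\<^sup>+ \<omega>'. f (X (t n) \<omega> + X v \<omega>') * ?K (X (t n) \<omega> + X v \<omega>') \<partial>M) \<partial>M)"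
    have [measurable]: "?H \<in> borel_measurable borel" by measurable
    have "(\<integral>\<^sup>+ v. disc q (v - t n) * (\<integral>\<^sup>+ \<omega>. ?Y \<omega> *
        (\<integral>\<^sup>+ z. f (X (t n) \<omega> + z) * ?K (X (t n) \<omega> + z) \<partial>distr M borel (X (v - t n))) \<partial>M) \<partial>lborel) =
        (\<integral>\<^sup>+ v. ?H (v + - t n) \<partial>lborel)"
      by (subst nn_integral_distr) auto
    also have "\<dots> = (\<integral>\<^sup>+ v. ?H v \<partial>lborel)"
      by (rule nn_integral_lborel_shift) measurable
    finally show ?thesis .
  qed
  also have "\<dots> = (\<integral>\<^sup>+ v. (\<integral>\<^sup>+ \<omega>. ?Y \<omega> * (disc q v *
      (\<integral>\<^sup>+ \<omega>'. f (X (t n) \<omega> + X v \<omega>') * ?K (X (t n) \<omega> + X v \<omega>') \<partial>M)) \<partial>M) \<partial>lborel)"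
    by (intro nn_integral_cong, subst nn_integral_cmult[symmetric]) (auto simp: mult_ac)
  also have "\<dots> = (\<integral>\<^sup>+ \<omega>. (\<integral>\<^sup>+ v. ?Y \<omega> * (disc q v *
      (\<integral>\<^sup>+ \<omega>'. f (X (t n) \<omega> + X v \<omega>') * ?K (X (t n) \<omega> + X v \<omega>') \<partial>M)) \<partial>lborel) \<partial>M)"
  proof -
    interpret pair_sigma_finite lborel M ..
    show ?thesis by (intro Fubini'[symmetric]) measurable
  qed
  also have "\<dots> = (\<integral>\<^sup>+ \<omega>. ?Y \<omega> * kernel_chain ?U (f # fs) (X (t n) \<omega>) \<partial>M)"
  proof (intro nn_integral_cong)
    fix \<omega> assume [measurable]: "\<omega> \<in> space M"
    have "kernel_chain ?U (f # fs) (X (t n) \<omega>) =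
        (\<integral>\<^sup>+ v. disc q v * (\<integral>\<^sup>+ \<omega>'. f (X (t n) \<omega> + X v \<omega>') * ?K (X (t n) \<omega> + X v \<omega>') \<partial>M) \<partial>lborel)"
      by (simp add: nn_integral_resolvent_measure nn_integral_distr)
    then show "(\<integral>\<^sup>+ v. ?Y \<omega> * (disc q v *
        (\<integral>\<^sup>+ \<omega>'. f (X (t n) \<omega> + X v \<omega>') * ?K (X (t n) \<omega> + X v \<omega>') \<partial>M)) \<partial>lborel) =
        ?Y \<omega> * kernel_chain ?U (f # fs) (X (t n) \<omega>)"
      by (simp add: nn_integral_cmult)
  qed
  finally show ?case .
qed

lemma expectation_path_chain_zero:
  assumes q: "0 < q" and fs: "\<And>f. f \<in> set fs \<Longrightarrow> f \<in> borel_measurable borel"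
  shows "(\<integral>\<^sup>+ \<omega>. path_chain q fs 0 \<omega> \<partial>M) = kernel_chain (resolvent_measure q) fs 0"
proof -
  have "(\<integral>\<^sup>+ \<omega>. path_chain q fs 0 \<omega> \<partial>M) = (\<integral>\<^sup>+ \<omega>. kernel_chain (resolvent_measure q) fs (X 0 \<omega>) \<partial>M)"
    using expectation_path_chain[OF q fs, where t = "\<lambda>_. 0" and n = 0 and \<Psi> = "\<lambda>_. 1"] by (simp add: mono_on_def)
  also have "\<dots> = (\<integral>\<^sup>+ \<omega>. kernel_chain (resolvent_measure q) fs 0 \<partial>M)"
    using X_zero by (intro nn_integral_cong_AE) auto
  finally show ?thesis by (simp add: emeasure_space_1)
qed

end

text \<open>The uniform density on a shrinking interval to the right of \<open>p\<close>, an
  approximation of the unit mass at \<open>p\<close>. Its integral along the path approximates the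
  local time at \<open>p\<close>.\<close>

definition unif :: "nat \<Rightarrow> real \<Rightarrow> real \<Rightarrow> ennreal" where
  "unif j p z = (if p \<le> z \<and> z \<le> p + 1 / real (Suc j) then ennreal (real (Suc j)) else 0)"

lemma unif_measurable [measurable]: "unif j p \<in> borel_measurable borel"
  unfolding unif_def by measurable

lemma nn_integral_unif:
  assumes [measurable]: "H \<in> borel_measurable borel"
  shows "(\<integral>\<^sup>+ z. unif j p z * H z \<partial>lborel) =
    (\<integral>\<^sup>+ s. indicator {0..1} s * H (p + s / real (Suc j)) \<partial>lborel)"
proof -
  have "(\<integral>\<^sup>+ z. unif j p z * H z \<partial>lborel) = ennreal \<bar>1 / real (Suc j)\<bar> *
      (\<integral>\<^sup>+ s. unif j p (p + 1 / real (Suc j) * s) * H (p + 1 / real (Suc j) * s) \<partial>lborel)"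
    by (rule nn_integral_real_affine) auto
  also have "\<dots> = (\<integral>\<^sup>+ s. ennreal \<bar>1 / real (Suc j)\<bar> *
      (unif j p (p + 1 / real (Suc j) * s) * H (p + 1 / real (Suc j) * s)) \<partial>lborel)"
    by (rule nn_integral_cmult[symmetric]) measurable
  also have "\<dots> = (\<integral>\<^sup>+ s. indicator {0..1} s * H (p + s / real (Suc j)) \<partial>lborel)"
  proof (intro nn_integral_cong)
    fix s :: real
    have "unif j p (p + 1 / real (Suc j) * s) = (if 0 \<le> s \<and> s \<le> 1 then ennreal (real (Suc j)) else 0)"
      by (simp add: unif_def divide_le_cancel zero_le_divide_iff)
    moreover have "ennreal \<bar>1 / real (Suc j)\<bar> * ennreal (real (Suc j)) = 1"
      by (simp add: ennreal_mult[symmetric] del: of_nat_Suc)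
    ultimately show "ennreal \<bar>1 / real (Suc j)\<bar> *
        (unif j p (p + 1 / real (Suc j) * s) * H (p + 1 / real (Suc j) * s)) =
        indicator {0..1} s * H (p + s / real (Suc j))"
      by (auto simp: indicator_def mult.assoc[symmetric])
  qed
  finally show ?thesis .
qed

section \<open>Kernel chains concentrating at two levels\<close>

context resolvent
begin

text \<open>One kernel for both levels: its integral along the path approximates \<alpha> times the
  local time at 0 plus \<beta> times the local time at \<open>x\<close>, so powers of that
  combination come from repeating a single kernel.\<close>

definition mix :: "real \<Rightarrow> real \<Rightarrow> real \<Rightarrow> nat \<Rightarrow> real \<Rightarrow> ennreal" where
  "mix \<alpha> \<beta> x j z = ennreal \<alpha> * unif j 0 z + ennreal \<beta> * unif j x z"

lemma mix_measurable [measurable]: "mix \<alpha> \<beta> x j \<in> borel_measurable borel"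
  unfolding mix_def by measurable

lemma kernel_chain_measurable_U:
  "(\<And>f. f \<in> set fs \<Longrightarrow> f \<in> borel_measurable borel) \<Longrightarrow> kernel_chain U fs \<in> borel_measurable borel"
  by (rule kernel_chain_measurable[OF sets_U U.sigma_finite_measure])

lemma U_unif:
  assumes [measurable]: "H \<in> borel_measurable borel"
  shows "(\<integral>\<^sup>+ z. unif j p (y + z) * H (y + z) \<partial>U) =
    (\<integral>\<^sup>+ s. indicator {0..1} s * (ennreal (u (p + s / real (Suc j) - y)) * H (p + s / real (Suc j))) \<partial>lborel)"
proof -
  have "(\<integral>\<^sup>+ z. unif j p (y + z) * H (y + z) \<partial>U) =
      (\<integral>\<^sup>+ z. ennreal (u ((z + y) - y)) * (unif j p (z + y) * H (z + y)) \<partial>lborel)"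
    by (subst nn_integral_U) (auto simp: add.commute)
  also have "\<dots> = (\<integral>\<^sup>+ z. ennreal (u (z - y)) * (unif j p z * H z) \<partial>lborel)"
    by (rule nn_integral_lborel_shift) measurable
  also have "\<dots> = (\<integral>\<^sup>+ z. unif j p z * (ennreal (u (z - y)) * H z) \<partial>lborel)"
    by (simp only: mult_ac)
  also have "\<dots> = (\<integral>\<^sup>+ s. indicator {0..1} s * (ennreal (u (p + s / real (Suc j) - y)) * H (p + s / real (Suc j))) \<partial>lborel)"
    by (rule nn_integral_unif) measurable
  finally show ?thesis .
qed

lemma U_unif_le:
  assumes [measurable]: "H \<in> borel_measurable borel" and H: "\<And>z. H z \<le> B"
  shows "(\<integral>\<^sup>+ z. unif j p (y + z) * H (y + z) \<partial>U) \<le> ennreal (u 0) * B"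
proof -
  have "(\<integral>\<^sup>+ z. unif j p (y + z) * H (y + z) \<partial>U) \<le> (\<integral>\<^sup>+ s. indicator {0..1} s * (ennreal (u 0) * B) \<partial>(lborel :: real measure))"
    unfolding U_unif[OF assms(1)]
    by (intro nn_integral_mono mult_left_mono mult_mono ennreal_leI u_le H) auto
  also have "\<dots> = ennreal (u 0) * B" by (subst nn_integral_multc) auto
  finally show ?thesis .
qed

lemma U_mix:
  assumes [measurable]: "H \<in> borel_measurable borel"
  shows "(\<integral>\<^sup>+ z. mix \<alpha> \<beta> x j (y + z) * H (y + z) \<partial>U) =
    ennreal \<alpha> * (\<integral>\<^sup>+ z. unif j 0 (y + z) * H (y + z) \<partial>U) + ennreal \<beta> * (\<integral>\<^sup>+ z. unif j x (y + z) * H (y + z) \<partial>U)"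
proof -
  have "(\<integral>\<^sup>+ z. mix \<alpha> \<beta> x j (y + z) * H (y + z) \<partial>U) =
      (\<integral>\<^sup>+ z. ennreal \<alpha> * (unif j 0 (y + z) * H (y + z)) + ennreal \<beta> * (unif j x (y + z) * H (y + z)) \<partial>U)"
    unfolding mix_def by (simp only: distrib_right mult.assoc)
  also have "\<dots> = (\<integral>\<^sup>+ z. ennreal \<alpha> * (unif j 0 (y + z) * H (y + z)) \<partial>U) + (\<integral>\<^sup>+ z. ennreal \<beta> * (unif j x (y + z) * H (y + z)) \<partial>U)"
    by (rule nn_integral_add) measurable
  finally show ?thesis by (simp add: nn_integral_cmult)
qed

text \<open>Each kernel contributes at most \<open>(\<alpha> + \<beta>) * u 0\<close>, because
  \<open>unif\<close> has mass one and \<open>u\<close> is maximal at 0. The bound is the same for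
  all \<open>j\<close> and thus dominates the limits below.\<close>

lemma kernel_chain_mix_le:
  assumes "0 \<le> \<alpha>" "0 \<le> \<beta>" and g: "\<And>f. f \<in> set gs \<Longrightarrow> f \<in> borel_measurable borel"
    and B: "\<And>y. kernel_chain U gs y \<le> ennreal B" "0 \<le> B"
  shows "kernel_chain U (replicate k (mix \<alpha> \<beta> x j) @ gs) y \<le> ennreal (((\<alpha> + \<beta>) * u 0) ^ k * B)"
proof (induction k arbitrary: y)
  case 0
  then show ?case using B by simp
next
  case (Suc k)
  let ?H = "kernel_chain U (replicate k (mix \<alpha> \<beta> x j) @ gs)"
  let ?B = "((\<alpha> + \<beta>) * u 0) ^ k * B"
  have [measurable]: "?H \<in> borel_measurable borel" using g by (intro kernel_chain_measurable_U) auto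
  have Bnn: "0 \<le> ?B" using assms u0_pos B(2) by simp
  have "kernel_chain U (replicate (Suc k) (mix \<alpha> \<beta> x j) @ gs) y =
      ennreal \<alpha> * (\<integral>\<^sup>+ z. unif j 0 (y + z) * ?H (y + z) \<partial>U) + ennreal \<beta> * (\<integral>\<^sup>+ z. unif j x (y + z) * ?H (y + z) \<partial>U)"
    by (simp add: U_mix)
  also have "\<dots> \<le> ennreal \<alpha> * (ennreal (u 0) * ennreal ?B) + ennreal \<beta> * (ennreal (u 0) * ennreal ?B)"
    using Suc by (intro add_mono mult_left_mono U_unif_le) auto
  also have "\<dots> = ennreal (\<alpha> * (u 0 * ?B) + \<beta> * (u 0 * ?B))"
  proof -
    have "0 \<le> u 0 * ?B" using Bnn u0_pos by simp
    then have 1: "0 \<le> \<alpha> * (u 0 * ?B)" "0 \<le> \<beta> * (u 0 * ?B)" using assms by simp_all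
    have 2: "ennreal a * (ennreal (u 0) * ennreal ?B) = ennreal (a * (u 0 * ?B))" if "0 \<le> a" for a
      using Bnn u0_pos that by (simp only: ennreal_mult[symmetric] mult_nonneg_nonneg less_imp_le)
    show ?thesis unfolding ennreal_plus[OF 1] using assms by (simp only: 2)
  qed
  also have "\<alpha> * (u 0 * ?B) + \<beta> * (u 0 * ?B) = ((\<alpha> + \<beta>) * u 0) ^ Suc k * B"
    by (simp add: algebra_simps)
  finally show ?case .
qed

text \<open>Starting points move with \<open>j\<close>, and \<kappa> is required to converge along
  every sequence tending to \<open>p\<close>: a step of the chain lands near its level, at
  \<open>p + s / Suc j\<close>, and not on it. This continuous convergence is the form that survives
  the induction over chains.\<close>

lemma U_unif_tendsto:
  fixes \<kappa> :: "nat \<Rightarrow> real \<Rightarrow> ennreal"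
  assumes [measurable]: "\<And>j. \<kappa> j \<in> borel_measurable borel" and B: "\<And>j z. \<kappa> j z \<le> ennreal B"
    and lim: "\<And>y. y \<longlonglongrightarrow> p \<Longrightarrow> (\<lambda>j. \<kappa> j (y j)) \<longlonglongrightarrow> ennreal k" and y: "y \<longlonglongrightarrow> y0"
  shows "(\<lambda>j. \<integral>\<^sup>+ z. unif j p (y j + z) * \<kappa> j (y j + z) \<partial>U) \<longlonglongrightarrow> ennreal (u (p - y0)) * ennreal k"
proof -
  have "(\<lambda>j. \<integral>\<^sup>+ s. indicator {0..1} s * (ennreal (u (p + s / real (Suc j) - y j)) * \<kappa> j (p + s / real (Suc j))) \<partial>lborel) \<longlonglongrightarrow>
      (\<integral>\<^sup>+ s. indicator {0..1} s * (ennreal (u (p - y0)) * ennreal k) \<partial>(lborel :: real measure))"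
  proof (rule nn_integral_dominated_convergence[where w = "\<lambda>s. indicator {0..1} s * (ennreal (u 0) * ennreal B)"])
    show "AE s in lborel. indicator {0..1} s * (ennreal (u (p + s / real (Suc j) - y j)) * \<kappa> j (p + s / real (Suc j)))
        \<le> indicator {0..1} s * (ennreal (u 0) * ennreal B)" for j
      by (intro AE_I2 mult_left_mono mult_mono ennreal_leI u_le B) auto
    show "(\<integral>\<^sup>+ s. indicator {0..1} s * (ennreal (u 0) * ennreal B) \<partial>(lborel :: real measure)) < \<infinity>"
      by (subst nn_integral_multc) (auto simp: ennreal_mult_less_top)
    show "AE s in lborel. (\<lambda>j. indicator {0..1} s * (ennreal (u (p + s / real (Suc j) - y j)) * \<kappa> j (p + s / real (Suc j))))
        \<longlonglongrightarrow> indicator {0..1} s * (ennreal (u (p - y0)) * ennreal k)"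
    proof (rule AE_I2)
      fix s :: real
      have "(\<lambda>j. s * (1 / real (Suc j))) \<longlonglongrightarrow> s * 0"
        by (intro tendsto_mult tendsto_const LIMSEQ_Suc[OF lim_1_over_n])
      then have s0: "(\<lambda>j. s / real (Suc j)) \<longlonglongrightarrow> 0" by simp
      have 1: "(\<lambda>j. p + s / real (Suc j)) \<longlonglongrightarrow> p + 0" by (intro tendsto_add tendsto_const s0)
      have 2: "(\<lambda>j. p + s / real (Suc j) - y j) \<longlonglongrightarrow> p + 0 - y0" by (intro tendsto_diff 1 y)
      have "isCont u (p - y0)" using u_continuous[of UNIV] by (simp add: continuous_on_eq_continuous_at)
      then have "(\<lambda>j. u (p + s / real (Suc j) - y j)) \<longlonglongrightarrow> u (p - y0)"
        using 2 isCont_tendsto_compose by fastforce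
      then have "(\<lambda>j. ennreal (u (p + s / real (Suc j) - y j)) * \<kappa> j (p + s / real (Suc j))) \<longlonglongrightarrow> ennreal (u (p - y0)) * ennreal k"
        using 1 by (intro tendsto_mult_ennreal tendsto_ennrealI lim) auto
      then show "(\<lambda>j. indicator {0..1} s * (ennreal (u (p + s / real (Suc j) - y j)) * \<kappa> j (p + s / real (Suc j))))
        \<longlonglongrightarrow> indicator {0..1} s * (ennreal (u (p - y0)) * ennreal k)"
        by (cases "s \<in> {0..1}") auto
    qed
  qed measurable
  moreover have "(\<integral>\<^sup>+ s. indicator {0..1} s * (ennreal (u (p - y0)) * ennreal k) \<partial>(lborel :: real measure)) = ennreal (u (p - y0)) * ennreal k"
    by (subst nn_integral_multc) auto
  ultimately show ?thesis by (simp add: U_unif)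
qed

text \<open>The sum over all words of length \<open>k\<close> in the levels 0 and \<open>x\<close>
  of the products of resolvent densities from \<open>y\<close> along the word and finally to 0, with
  weight \<alpha> for each letter 0 and \<beta> for each letter \<open>x\<close>. The last step has
  no weight since it stems from \<open>unif j 0\<close>.\<close>

primrec vertex :: "real \<Rightarrow> real \<Rightarrow> real \<Rightarrow> nat \<Rightarrow> real \<Rightarrow> real" where
  "vertex \<alpha> \<beta> x 0 y = u (- y)"
| "vertex \<alpha> \<beta> x (Suc k) y = \<alpha> * (u (- y) * vertex \<alpha> \<beta> x k 0) + \<beta> * (u (x - y) * vertex \<alpha> \<beta> x k x)"

lemma vertex_nonneg: "0 \<le> \<alpha> \<Longrightarrow> 0 \<le> \<beta> \<Longrightarrow> 0 \<le> vertex \<alpha> \<beta> x k y"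
  by (induction k arbitrary: y) (auto simp: u_nonneg)

lemma vertex_le:
  assumes "0 \<le> \<alpha>" "0 \<le> \<beta>"
  shows "vertex \<alpha> \<beta> x k y \<le> ((\<alpha> + \<beta>) * u 0) ^ k * u 0"
proof (induction k arbitrary: y)
  case 0
  then show ?case by (simp add: u_le)
next
  case (Suc k)
  let ?B = "((\<alpha> + \<beta>) * u 0) ^ k * u 0"
  have "u z * vertex \<alpha> \<beta> x k w \<le> u 0 * ?B" for z w
    using Suc[of w] u_le[of z] u0_pos by (intro mult_mono vertex_nonneg assms) auto
  then have "vertex \<alpha> \<beta> x (Suc k) y \<le> \<alpha> * (u 0 * ?B) + \<beta> * (u 0 * ?B)"
    using assms by (auto intro!: add_mono mult_left_mono)
  also have "\<dots> = ((\<alpha> + \<beta>) * u 0) ^ Suc k * u 0" by (simp add: algebra_simps)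
  finally show ?case .
qed

lemma kernel_chain_unif_le: "kernel_chain U [unif j 0] y \<le> ennreal (u 0)"
  using U_unif_le[of "\<lambda>_. 1" 1 j 0 y] by simp

lemma kernel_chain_tendsto:
  assumes "0 \<le> \<alpha>" "0 \<le> \<beta>" "y \<longlonglongrightarrow> y0"
  shows "(\<lambda>j. kernel_chain U (replicate k (mix \<alpha> \<beta> x j) @ [unif j 0]) (y j)) \<longlonglongrightarrow> ennreal (vertex \<alpha> \<beta> x k y0)"
  using assms(3)
proof (induction k arbitrary: y y0)
  case 0
  then show ?case
    using U_unif_tendsto[of "\<lambda>_ _. 1" 1 0 1 y y0] by simp
next
  case (Suc k)
  let ?H = "\<lambda>j. kernel_chain U (replicate k (mix \<alpha> \<beta> x j) @ [unif j 0])"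
  have [measurable]: "?H j \<in> borel_measurable borel" for j by (intro kernel_chain_measurable_U) auto
  have B: "?H j z \<le> ennreal (((\<alpha> + \<beta>) * u 0) ^ k * u 0)" for j z
    using u0_pos by (intro kernel_chain_mix_le assms(1,2) kernel_chain_unif_le) auto
  have lim: "(\<lambda>j. \<integral>\<^sup>+ z. unif j p (y j + z) * ?H j (y j + z) \<partial>U) \<longlonglongrightarrow>
      ennreal (u (p - y0)) * ennreal (vertex \<alpha> \<beta> x k p)" for p
    by (rule U_unif_tendsto[OF _ B Suc.IH Suc.prems]) measurable
  have "(\<lambda>j. ennreal \<alpha> * (\<integral>\<^sup>+ z. unif j 0 (y j + z) * ?H j (y j + z) \<partial>U) +
        ennreal \<beta> * (\<integral>\<^sup>+ z. unif j x (y j + z) * ?H j (y j + z) \<partial>U)) \<longlonglongrightarrow>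
      ennreal \<alpha> * (ennreal (u (0 - y0)) * ennreal (vertex \<alpha> \<beta> x k 0)) +
      ennreal \<beta> * (ennreal (u (x - y0)) * ennreal (vertex \<alpha> \<beta> x k x))"
    by (intro tendsto_add tendsto_mult_ennreal tendsto_const lim) (auto simp: ennreal_mult_eq_top_iff)
  moreover have "ennreal \<alpha> * (ennreal (u (0 - y0)) * ennreal (vertex \<alpha> \<beta> x k 0)) +
      ennreal \<beta> * (ennreal (u (x - y0)) * ennreal (vertex \<alpha> \<beta> x k x)) = ennreal (vertex \<alpha> \<beta> x (Suc k) y0)"
  proof -
    have 1: "0 \<le> a * (u z * vertex \<alpha> \<beta> x k w)" if "0 \<le> a" for a z w
      using that u_nonneg[of z] vertex_nonneg[OF assms(1,2), of x k w] by simp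
    have 2: "ennreal a * (ennreal (u z) * ennreal (vertex \<alpha> \<beta> x k w)) = ennreal (a * (u z * vertex \<alpha> \<beta> x k w))"
      if "0 \<le> a" for a z w
      using that u_nonneg[of z] vertex_nonneg[OF assms(1,2), of x k w]
      by (simp only: ennreal_mult[symmetric] mult_nonneg_nonneg)
    show ?thesis
      unfolding vertex.simps ennreal_plus[OF 1[OF assms(1)] 1[OF assms(2)]] using assms by (simp only: 2 diff_0)
  qed
  ultimately show ?case by (simp add: U_mix)
qed

text \<open>The vertex weights are the powers of the \<open>2 \<times> 2\<close> matrix of resolvent densities between the
  levels \<open>0\<close> and \<open>x\<close>; their sum is computed by inverting it.\<close>

definition ratio :: "real \<Rightarrow> real" where "ratio x = u x * u (- x) / (u 0)\<^sup>2"

definition scl :: "real \<Rightarrow> real" where "scl x = u 0 - u x * u (- x) / u 0"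

definition rate :: "real \<Rightarrow> real \<Rightarrow> real" where "rate x \<beta> = ratio x * \<beta> / (1 - \<beta> * scl x)"

lemma ratio_bounds: "0 \<le> ratio x" "ratio x \<le> 1"
proof -
  have "u x * u (- x) \<le> u 0 * u 0"
    using u_le[of x] u_le[of "- x"] u_nonneg[of "- x"] u0_pos by (intro mult_mono) auto
  then show "ratio x \<le> 1" using u0_pos by (simp add: ratio_def power2_eq_square)
  show "0 \<le> ratio x" using u_nonneg u0_pos by (simp add: ratio_def)
qed

lemma scl_bounds:
  assumes "0 \<le> x"
  shows "0 \<le> scl x" "scl x \<le> 2 * W x" "scl x \<le> u 0"
proof -
  have le: "u x * u (- x) \<le> u 0 * u 0"
    using u_le[of x] u_le[of "- x"] u_nonneg[of "- x"] u0_pos by (intro mult_mono) auto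
  then show "0 \<le> scl x" using u0_pos by (simp add: scl_def field_simps)
  show "scl x \<le> u 0" using u0_pos u_nonneg by (simp add: scl_def)
  \<comment> \<open>The difference of \<open>u 0 * u 0\<close> and \<open>u x * u (- x)\<close> is
    split so that each summand contains one increment of \<open>u\<close>, at most
    \<open>W x\<close> for every \<open>q\<close>.\<close>
  have "u 0 * scl x = u 0 * (u 0 - u x) + u x * (u 0 - u (- x))"
    using u0_pos by (simp add: scl_def field_simps)
  also have "\<dots> \<le> u 0 * W x + u 0 * W x"
    using u_diff_le[of x] u_diff_le[of "- x"] u_le[of x] u_le[of "- x"] u_nonneg[of x] u0_pos assms
    by (intro add_mono mult_mono) auto
  finally have "u 0 * scl x \<le> u 0 * (2 * W x)" by (simp only: mult_2 distrib_left)
  then show "scl x \<le> 2 * W x" using u0_pos by simp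
qed

text \<open>Splitting off the first step gives a linear system for the two generating functions at 0
  and \<open>x\<close>. Its solution is a simple pole in \<alpha>, the transform of an exponential
  function of the level; the second conclusion places \<alpha> to the left of the pole.\<close>

lemma vertex_sums:
  assumes \<alpha>: "0 \<le> \<alpha>" and \<beta>: "0 \<le> \<beta>" and small: "(\<alpha> + \<beta>) * u 0 < 1" and x: "0 \<le> x"
  defines "\<kappa> \<equiv> 1 / u 0 - rate x \<beta>"
  shows "(\<lambda>k. vertex \<alpha> \<beta> x k 0) sums (1 / (\<kappa> - \<alpha>))" "\<alpha> < \<kappa>"
proof -
  have summ: "summable (\<lambda>k. vertex \<alpha> \<beta> x k y)" for y
  proof (rule summable_comparison_test)
    show "\<exists>N. \<forall>n\<ge>N. norm (vertex \<alpha> \<beta> x n y) \<le> ((\<alpha> + \<beta>) * u 0) ^ n * u 0"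
      using vertex_le[OF \<alpha> \<beta>] vertex_nonneg[OF \<alpha> \<beta>] by auto
    show "summable (\<lambda>n. ((\<alpha> + \<beta>) * u 0) ^ n * u 0)"
      using small \<alpha> \<beta> u0_pos by (intro summable_mult2 summable_geometric) auto
  qed
  define V where "V y = (\<Sum>k. vertex \<alpha> \<beta> x k y)" for y
  have V: "V y = u (- y) + (\<alpha> * (u (- y) * V 0) + \<beta> * (u (x - y) * V x))" for y
  proof -
    have "V y = vertex \<alpha> \<beta> x 0 y + (\<Sum>k. vertex \<alpha> \<beta> x (Suc k) y)"
      unfolding V_def using suminf_split_head[OF summ[of y]] by simp
    also have "(\<Sum>k. vertex \<alpha> \<beta> x (Suc k) y) = \<alpha> * (u (- y) * V 0) + \<beta> * (u (x - y) * V x)"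
      unfolding vertex.simps V_def using summ
      by (subst suminf_add[symmetric]) (auto intro!: summable_mult simp: suminf_mult)
    finally show ?thesis by simp
  qed
  have \<beta>u: "\<beta> * u 0 < 1" and "\<alpha> * u 0 < 1 - \<beta> * u 0"
    using small \<alpha> u0_pos by (auto simp: algebra_simps add_strict_increasing intro: le_less_trans[rotated])
  have \<beta>s: "\<beta> * scl x < 1"
    using mult_left_mono[OF scl_bounds(3)[OF x] \<beta>] \<beta>u by linarith
  define U2 where "U2 = u x * u (- x)"
  have U2: "0 \<le> U2" "U2 \<le> u 0 * u 0"
    using u_le[of x] u_le[of "- x"] u_nonneg[of "- x"] u_nonneg[of x] u0_pos
    by (auto simp: U2_def intro!: mult_mono)
  \<comment> \<open>Eliminating \<open>V x\<close> from the system leaves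
    \<open>V 0 = r * (1 + \<alpha> * V 0)\<close>, and \<kappa> is the inverse of
    \<open>r\<close>.\<close>
  define r where "r = u 0 + \<beta> * U2 / (1 - \<beta> * u 0)"
  have r_pos: "0 < r" using u0_pos \<beta> \<beta>u U2 by (auto simp: r_def intro!: add_pos_nonneg divide_nonneg_pos)
  have r_inv: "\<kappa> = 1 / r"
  proof -
    have "\<kappa> = (1 - \<beta> * u 0) / (u 0 * (1 - \<beta> * scl x))"
    proof -
      have req: "ratio x = (u 0 - scl x) / u 0"
        using u0_pos by (simp add: ratio_def scl_def power2_eq_square field_simps)
      show ?thesis
        using u0_pos \<beta>s unfolding \<kappa>_def rate_def req by (simp add: field_simps)
    qed
    moreover have "r = u 0 * (1 - \<beta> * scl x) / (1 - \<beta> * u 0)"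
      using u0_pos \<beta>u unfolding r_def U2_def scl_def by (simp add: field_simps)
    ultimately show ?thesis by (simp only: divide_divide_eq_right mult_1)
  qed
  have r_le: "r \<le> u 0 / (1 - \<beta> * u 0)"
  proof -
    have "r \<le> u 0 + \<beta> * (u 0 * u 0) / (1 - \<beta> * u 0)"
      unfolding r_def using U2 \<beta> \<beta>u by (intro add_left_mono divide_right_mono mult_left_mono) auto
    also have "\<dots> = u 0 / (1 - \<beta> * u 0)" using \<beta>u by (simp add: field_simps)
    finally show ?thesis .
  qed
  have "\<alpha> * r \<le> \<alpha> * (u 0 / (1 - \<beta> * u 0))" by (intro mult_left_mono r_le \<alpha>)
  also have "\<dots> < 1" using \<open>\<alpha> * u 0 < 1 - \<beta> * u 0\<close> \<beta>u by (simp add: field_simps)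
  finally have \<alpha>r: "\<alpha> * r < 1" .
  show "\<alpha> < \<kappa>" using \<alpha>r r_pos by (simp add: r_inv field_simps)
  have Vx: "V x * (1 - \<beta> * u 0) = u (- x) * (1 + \<alpha> * V 0)" using V[of x] by (simp add: algebra_simps)
  have V0: "V 0 = u 0 * (1 + \<alpha> * V 0) + \<beta> * (u x * V x)" using V[of 0] by (simp add: algebra_simps)
  have "V x = u (- x) * (1 + \<alpha> * V 0) / (1 - \<beta> * u 0)" using Vx \<beta>u by (simp add: field_simps)
  then have "V 0 = r * (1 + \<alpha> * V 0)"
    using V0 by (simp add: r_def U2_def algebra_simps)
  then have "V 0 * (1 - \<alpha> * r) = r" by (simp add: algebra_simps)
  then have "V 0 = r / (1 - \<alpha> * r)" using \<alpha>r by (simp add: field_simps)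
  also have "\<dots> = 1 / (\<kappa> - \<alpha>)" using \<alpha>r r_pos by (simp add: r_inv field_simps)
  finally show "(\<lambda>k. vertex \<alpha> \<beta> x k 0) sums (1 / (\<kappa> - \<alpha>))"
    using summable_sums[OF summ[of 0]] by (simp add: V_def)
qed

end

section \<open>Local times and inverse local times\<close>

text \<open>Replacing \<open>Z\<close> by \<open>Zj j\<close> changes the integral by at most the
  uniform distance times the total mass \<open>Aj j s\<close>, which stays bounded in
  \<open>j\<close>.\<close>

lemma stieltjes_convergence_uniform:
  fixes A Z :: "real \<Rightarrow> real" and Aj Zj :: "nat \<Rightarrow> real \<Rightarrow> real" and a :: "nat \<Rightarrow> real \<Rightarrow> ennreal"
  assumes a [measurable]: "\<And>j. a j \<in> borel_measurable borel" and s: "0 \<le> s"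
    and Aj: "\<And>j t. 0 \<le> t \<Longrightarrow> t \<le> s \<Longrightarrow> run (a j) 0 t = ennreal (Aj j t)" "\<And>j t. 0 \<le> Aj j t"
    and lim: "\<And>t. 0 \<le> t \<Longrightarrow> t \<le> s \<Longrightarrow> (\<lambda>j. Aj j t) \<longlonglongrightarrow> A t"
    and A: "A 0 = 0" "continuous_on {0..s} A" "mono_on {0..s} A"
    and Z: "continuous_on {0..s} Z" "mono_on {0..s} Z" "\<And>t. 0 \<le> t \<Longrightarrow> t \<le> s \<Longrightarrow> 0 \<le> Z t"
    and Zj: "uniform_limit {0..s} Zj Z sequentially"
    and [measurable]: "\<And>j. (\<lambda>t. ennreal (Zj j t)) \<in> borel_measurable borel"
  defines "T \<equiv> \<lambda>\<zeta>. Inf {t. 0 \<le> t \<and> t \<le> s \<and> \<zeta> \<le> A t}"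
  shows "(\<lambda>j. run (\<lambda>t. ennreal (Zj j t) * a j t) 0 s) \<longlonglongrightarrow>
    (\<integral>\<^sup>+ \<zeta>. (if 0 < \<zeta> \<and> \<zeta> \<le> A s then ennreal (Z (T \<zeta>)) else 0) \<partial>lborel)"
proof -
  define J where "J j = run (\<lambda>t. ennreal (Z t) * a j t) 0 s" for j
  define J' where "J' j = run (\<lambda>t. ennreal (Zj j t) * a j t) 0 s" for j
  define R where "R = (\<integral>\<^sup>+ \<zeta>. (if 0 < \<zeta> \<and> \<zeta> \<le> A s then ennreal (Z (T \<zeta>)) else 0) \<partial>lborel)"
  have J: "J \<longlonglongrightarrow> R"
    unfolding J_def R_def T_def by (rule stieltjes_convergence[OF a s Aj lim A Z])
  define Zc where "Zc t = Z (max 0 (min s t))" for t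
  have "mono Zc"
    unfolding Zc_def using s by (auto intro!: monoI mono_onD[OF Z(2)])
  then have [measurable]: "Zc \<in> borel_measurable borel" by (rule borel_measurable_mono)
  have Zc_eq: "Zc t = Z t" if "0 \<le> t" "t \<le> s" for t using that by (simp add: Zc_def)
  have J_Zc: "J j = run (\<lambda>t. ennreal (Zc t) * a j t) 0 s" for j
    unfolding J_def run_def by (intro nn_integral_cong) (auto simp: Zc_eq)
  have J_fin: "J j \<le> ennreal (Z s) * ennreal (Aj j s)" for j
  proof -
    have "J j \<le> (\<integral>\<^sup>+ t. ennreal (Z s) * (if 0 \<le> t \<and> t \<le> s then a j t else 0) \<partial>lborel)"
      unfolding J_def run_def using mono_onD[OF Z(2)] s
      by (intro nn_integral_mono) (auto intro!: mult_right_mono ennreal_leI)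
    also have "\<dots> = ennreal (Z s) * ennreal (Aj j s)"
      unfolding Aj(1)[OF s order_refl, symmetric] run_def by (rule nn_integral_cmult) measurable
    finally show ?thesis .
  qed
  have close: "\<forall>\<^sub>F j in sequentially. J j \<le> J' j + ennreal (d * Aj j s) \<and> J' j \<le> J j + ennreal (d * Aj j s)"
    if d: "0 < d" for d
    using uniform_limitD[OF Zj d]
  proof eventually_elim
    case (elim j)
    have e: "ennreal (d * Aj j s) = (\<integral>\<^sup>+ t. ennreal d * (if 0 \<le> t \<and> t \<le> s then a j t else 0) \<partial>lborel)"
    proof -
      have "ennreal (d * Aj j s) = ennreal d * run (a j) 0 s" using Aj s d by (simp add: ennreal_mult)
      then show ?thesis unfolding run_def by (simp add: nn_integral_cmult)
    qed
    have le: "ennreal y * z \<le> ennreal y' * z + ennreal d * z" if "\<bar>y - y'\<bar> \<le> d" "0 \<le> y'" for y y' z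
    proof -
      have "ennreal y \<le> ennreal (y' + d)" using that by (intro ennreal_leI) auto
      also have "\<dots> = ennreal y' + ennreal d" using that d by simp
      finally have "ennreal y * z \<le> (ennreal y' + ennreal d) * z" by (rule mult_right_mono) simp
      then show ?thesis by (simp add: distrib_right)
    qed
    \<comment> \<open>\<open>Zj j t\<close> may be negative, where \<open>ennreal\<close> makes it
      0; then the distance \<open>d\<close> alone covers \<open>Z t\<close>.\<close>
    have le': "ennreal y * z \<le> ennreal y' * z + ennreal d * z" if "\<bar>y - y'\<bar> \<le> d" "0 \<le> y" for y y' z
    proof (cases "0 \<le> y'")
      case False
      then have "ennreal y \<le> ennreal d" using that by (intro ennreal_leI) auto
      then show ?thesis using False by (simp add: ennreal_neg mult_right_mono)
    qed (use le that in auto)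
    have "J j \<le> (\<integral>\<^sup>+ t. (if 0 \<le> t \<and> t \<le> s then ennreal (Zj j t) * a j t else 0) + ennreal d * (if 0 \<le> t \<and> t \<le> s then a j t else 0) \<partial>lborel)"
      unfolding J_def run_def using elim Z(3)
      by (intro nn_integral_mono) (auto simp: dist_real_def abs_minus_commute less_imp_le intro!: le')
    also have "\<dots> = J' j + ennreal (d * Aj j s)"
      unfolding e J'_def run_def by (rule nn_integral_add) measurable
    finally have 1: "J j \<le> J' j + ennreal (d * Aj j s)" .
    have "J' j \<le> (\<integral>\<^sup>+ t. (if 0 \<le> t \<and> t \<le> s then ennreal (Zc t) * a j t else 0) + ennreal d * (if 0 \<le> t \<and> t \<le> s then a j t else 0) \<partial>lborel)"
      unfolding J'_def run_def using elim Z(3)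
      by (intro nn_integral_mono) (auto simp: dist_real_def less_imp_le Zc_eq intro!: le)
    also have "\<dots> = J j + ennreal (d * Aj j s)"
      unfolding e J_Zc run_def by (rule nn_integral_add) measurable
    finally show ?case using 1 by blast
  qed
  have J_lt: "J j < \<infinity>" for j
    using J_fin[of j] by (rule le_less_trans) (simp add: ennreal_mult_less_top)
  obtain r where r: "R = ennreal r" "0 \<le> r"
  proof -
    have "R \<le> ennreal (Z s) * ennreal (A s)"
    proof (rule LIMSEQ_le[OF J])
      show "(\<lambda>j. ennreal (Z s) * ennreal (Aj j s)) \<longlonglongrightarrow> ennreal (Z s) * ennreal (A s)"
        by (intro tendsto_mult_ennreal tendsto_const tendsto_ennrealI lim s) auto
    qed (use J_fin in blast)
    also have "\<dots> < \<infinity>" by (simp add: ennreal_mult_less_top)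
    finally show ?thesis using that by (cases R) auto
  qed
  have "Bseq (\<lambda>j. Aj j s)" using lim[OF s order_refl] by (intro convergent_imp_Bseq convergentI)
  then obtain B where B: "0 < B" "\<And>j. Aj j s \<le> B" by (auto simp: Bseq_def abs_le_iff)
  have J'_lt: "\<forall>\<^sub>F j in sequentially. J' j < \<infinity>"
    using close[OF zero_less_one]
  proof eventually_elim
    case (elim j)
    have "J j + ennreal (1 * Aj j s) < \<infinity>" using J_lt[of j] by (simp add: less_top[symmetric])
    then show ?case using elim by (meson le_less_trans)
  qed
  have "(\<lambda>j. enn2real (J' j) - enn2real (J j)) \<longlonglongrightarrow> 0"
  proof (rule LIMSEQ_I)
    fix e :: real assume e: "0 < e"
    define d where "d = e / (2 * B)"
    have d: "0 < d" "d * B < e" using e B by (auto simp: d_def)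
    have "\<forall>\<^sub>F j in sequentially. norm (enn2real (J' j) - enn2real (J j) - 0) < e"
      using close[OF d(1)] J'_lt
    proof eventually_elim
      case (elim j)
      obtain y y' where y: "J j = ennreal y" "0 \<le> y" "J' j = ennreal y'" "0 \<le> y'"
        using J_lt[of j] elim(2) by (cases "J j"; cases "J' j") auto
      have dA: "0 \<le> d * Aj j s" "d * Aj j s < e"
        using d(1) Aj(2)[of j s] le_less_trans[OF mult_left_mono[OF B(2)[of j] less_imp_le[OF d(1)]] d(2)] by auto
      have "ennreal y \<le> ennreal (y' + d * Aj j s)" "ennreal y' \<le> ennreal (y + d * Aj j s)"
        using elim(1) dA y by simp_all
      then have "y \<le> y' + d * Aj j s" "y' \<le> y + d * Aj j s"
        using y dA by (simp_all add: ennreal_le_iff del: ennreal_plus)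
      then show ?case using y dA by auto
    qed
    then show "\<exists>no. \<forall>n\<ge>no. norm (enn2real (J' n) - enn2real (J n) - 0) < e"
      by (simp add: eventually_sequentially)
  qed
  moreover have "(\<lambda>j. enn2real (J j)) \<longlonglongrightarrow> r"
    using tendsto_enn2real[OF J[unfolded r(1)] r(2)] .
  ultimately have "(\<lambda>j. (enn2real (J' j) - enn2real (J j)) + enn2real (J j)) \<longlonglongrightarrow> 0 + r"
    by (intro tendsto_add)
  then have "(\<lambda>j. ennreal (enn2real (J' j))) \<longlonglongrightarrow> R"
    unfolding r(1) by (intro tendsto_ennrealI) simp
  then have "J' \<longlonglongrightarrow> R"
  proof (rule Lim_transform_eventually)
    show "\<forall>\<^sub>F j in sequentially. ennreal (enn2real (J' j)) = J' j"
      using J'_lt by eventually_elim (auto simp: less_top)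
  qed
  then show ?thesis unfolding J'_def[abs_def] R_def .
qed

lemma uniform_limit_power:
  fixes f :: "nat \<Rightarrow> 'b \<Rightarrow> real"
  assumes "uniform_limit S f l F" "bounded (l ` S)"
  shows "uniform_limit S (\<lambda>n x. f n x ^ k) (\<lambda>x. l x ^ k) F"
proof (induction k)
  case 0
  then show ?case by (simp add: uniform_limit_const)
next
  case (Suc k)
  obtain B where B: "\<And>x. x \<in> S \<Longrightarrow> \<bar>l x\<bar> \<le> B" using assms(2) by (auto simp: bounded_iff)
  have "bounded ((\<lambda>x. l x ^ k) ` S)"
    using B by (auto simp: bounded_iff power_abs intro!: exI[of _ "B ^ k"] power_mono)
  then show ?case using uniform_lim_mult[OF assms(1) Suc assms(2)] by simp
qed

text \<open>The exceptional null set is named: on \<open>G\<close> the path properties hold for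
  every outcome, so objects defined by cases on \<open>G\<close> can be measurable in
  \<open>M\<close> itself instead of its completion.\<close>

locale local_time_process = increments_process M X + scale b c \<nu> W
  for M :: "'a measure" and X and b c \<nu> W +
  fixes ell :: "real \<Rightarrow> real \<Rightarrow> 'a \<Rightarrow> real" and G :: "'a set"
  assumes G_sets [measurable]: "G \<in> sets M" and G_AE: "AE \<omega> in M. \<omega> \<in> G"
    and X_laplace: "\<And>t l. 0 \<le> t \<Longrightarrow> 0 \<le> l \<Longrightarrow> (\<integral>\<^sup>+ \<omega>. ennreal (exp (- l * X t \<omega>)) \<partial>M) = ennreal (exp (t * \<Phi> l))"
    and ell_cont: "\<And>\<omega>. \<omega> \<in> G \<Longrightarrow> continuous_on (UNIV \<times> {0..}) (\<lambda>(x, t). ell x t \<omega>)"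
    and ell_nonneg: "\<And>\<omega> x t. \<omega> \<in> G \<Longrightarrow> 0 \<le> t \<Longrightarrow> 0 \<le> ell x t \<omega>"
    and occupation: "\<And>\<omega> t f. \<omega> \<in> G \<Longrightarrow> 0 \<le> t \<Longrightarrow> f \<in> borel_measurable borel \<Longrightarrow>
      (\<integral>\<^sup>+ r\<in>{0..t}. f (X r \<omega>) \<partial>lborel) = (\<integral>\<^sup>+ x. f x * ennreal (ell x t \<omega>) \<partial>lborel)"
begin

lemma resolvent_locale:
  assumes "0 < q"
  shows "resolvent b c \<nu> W q (resolvent_measure q)"
proof
  fix l assume l: "0 < l" "\<Phi> l < q"
  have "(\<integral>\<^sup>+ x. ennreal (exp (- l * x)) \<partial>resolvent_measure q) =
      (\<integral>\<^sup>+ t. disc q t * (\<integral>\<^sup>+ \<omega>. ennreal (exp (- l * X t \<omega>)) \<partial>M) \<partial>lborel)"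
    by (simp add: nn_integral_resolvent_measure nn_integral_distr)
  also have "\<dots> = (\<integral>\<^sup>+ t. ennreal (exp (- (q - \<Phi> l) * t)) * indicator {0..} t \<partial>lborel)"
  proof (intro nn_integral_cong)
    fix t
    have "exp (- q * t) * exp (t * \<Phi> l) = exp (- (q - \<Phi> l) * t)"
      by (simp add: exp_add[symmetric] algebra_simps)
    then show "disc q t * (\<integral>\<^sup>+ \<omega>. ennreal (exp (- l * X t \<omega>)) \<partial>M) = ennreal (exp (- (q - \<Phi> l) * t)) * indicator {0..} t"
      using X_laplace[of t l] l by (cases "0 \<le> t") (simp_all add: disc_def ennreal_mult'[symmetric])
  qed
  also have "\<dots> = ennreal (1 / (q - \<Phi> l))" using l by (intro nn_integral_exp_decay) auto
  finally show "(\<integral>\<^sup>+ x. ennreal (exp (- l * x)) \<partial>resolvent_measure q) = ennreal (1 / (q - \<Phi> l))" .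
qed (use assms resolvent_measure_mass in auto)

text \<open>The value 0 off \<open>G\<close> and the freezing before time 0 make continuity,
  monotonicity and joint measurability hold without exception.\<close>

definition LT :: "real \<Rightarrow> real \<Rightarrow> 'a \<Rightarrow> real" where
  "LT x t \<omega> = (if \<omega> \<in> G then ell x (max t 0) \<omega> else 0)"

definition Lj :: "nat \<Rightarrow> real \<Rightarrow> real \<Rightarrow> 'a \<Rightarrow> real" where
  "Lj j x t \<omega> = enn2real (run (\<lambda>r. unif j x (X r \<omega>)) 0 t)"

lemma path_measurable [measurable]: "\<omega> \<in> space M \<Longrightarrow> (\<lambda>t. X t \<omega>) \<in> borel_measurable borel"
  by (intro X_measurable) auto

lemma G_space: "\<omega> \<in> G \<Longrightarrow> \<omega> \<in> space M"
  using sets.sets_into_space[OF G_sets] by auto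

lemma run_unif_finite: "run (\<lambda>r. unif j x (X r \<omega>)) 0 t < \<infinity>"
proof -
  have "run (\<lambda>r. unif j x (X r \<omega>)) 0 t \<le> (\<integral>\<^sup>+ v. ennreal (real (Suc j)) * indicator {0..t} v \<partial>lborel)"
    unfolding run_def unif_def by (intro nn_integral_mono) (auto simp: indicator_def)
  also have "\<dots> < \<infinity>" by (subst nn_integral_cmult_indicator) (auto simp: ennreal_mult_less_top emeasure_lborel_Icc_eq)
  finally show ?thesis .
qed

lemma run_unif: "run (\<lambda>r. unif j x (X r \<omega>)) 0 t = ennreal (Lj j x t \<omega>)"
  using run_unif_finite[of j x \<omega> t] by (simp add: Lj_def less_top)

lemma Lj_nonneg: "0 \<le> Lj j x t \<omega>"
  by (simp add: Lj_def)

lemma Lj_measurable [measurable (raw)]: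
  assumes [measurable]: "f \<in> borel_measurable N" "g \<in> measurable N M"
  shows "(\<lambda>p. Lj j x (f p) (g p)) \<in> borel_measurable N"
proof -
  have "(\<lambda>p. run (\<lambda>r. unif j x (X r (g p))) 0 (f p)) \<in> borel_measurable N"
    unfolding run_def by measurable
  then show ?thesis unfolding Lj_def by measurable
qed

lemma Lj_occupation:
  assumes \<omega>: "\<omega> \<in> G" and t: "0 \<le> t"
  shows "ennreal (Lj j x t \<omega>) = (\<integral>\<^sup>+ s. indicator {0..1} s * ennreal (ell (x + s / real (Suc j)) t \<omega>) \<partial>lborel)"
proof -
  have "continuous_on UNIV (\<lambda>z::real. (z, t))" by (intro continuous_intros)
  moreover have "range (\<lambda>z::real. (z, t)) \<subseteq> UNIV \<times> {0..}" using t by auto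
  ultimately have "continuous_on UNIV (\<lambda>z. ell z t \<omega>)"
    using continuous_on_compose2[OF ell_cont[OF \<omega>], of UNIV "\<lambda>z. (z, t)"] by simp
  then have [measurable]: "(\<lambda>z. ell z t \<omega>) \<in> borel_measurable borel"
    by (rule borel_measurable_continuous_onI)
  have "ennreal (Lj j x t \<omega>) = (\<integral>\<^sup>+ r\<in>{0..t}. unif j x (X r \<omega>) \<partial>lborel)"
    unfolding run_unif[symmetric] run_def by (intro nn_integral_cong) (auto simp: indicator_def)
  also have "\<dots> = (\<integral>\<^sup>+ z. unif j x z * ennreal (ell z t \<omega>) \<partial>lborel)"
    by (rule occupation[OF \<omega> t]) measurable
  finally show ?thesis by (simp add: nn_integral_unif)
qed

text \<open>By the occupation formula \<open>Lj\<close> averages \<open>ell\<close> over levels just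
  above \<open>x\<close>, and \<open>ell\<close> is uniformly continuous on a compact rectangle.
  Uniformity in time is needed because powers of these functions are integrated against the
  approximate local time at 0.\<close>

lemma Lj_uniform_limit:
  assumes s: "0 \<le> s" and \<omega>: "\<omega> \<in> G"
  shows "uniform_limit {0..s} (\<lambda>j t. Lj j x t \<omega>) (\<lambda>t. LT x t \<omega>) sequentially"
proof (rule uniform_limitI)
  fix e :: real assume e: "0 < e"
  have "uniformly_continuous_on ({x..x + 1} \<times> {0..s}) (\<lambda>(x, t). ell x t \<omega>)"
    by (intro compact_uniformly_continuous continuous_on_subset[OF ell_cont[OF \<omega>]] compact_Times) auto
  then obtain d where d: "0 < d" "\<And>p p'. p \<in> {x..x + 1} \<times> {0..s} \<Longrightarrow> p' \<in> {x..x + 1} \<times> {0..s} \<Longrightarrow> dist p' p < d \<Longrightarrow>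
      dist ((\<lambda>(x, t). ell x t \<omega>) p') ((\<lambda>(x, t). ell x t \<omega>) p) < e / 2"
    using e unfolding uniformly_continuous_on_def by (meson half_gt_zero)
  have "\<forall>\<^sub>F j in sequentially. 1 / real (Suc j) < d"
    using order_tendstoD(2)[OF LIMSEQ_Suc[OF lim_1_over_n] d(1)] by simp
  then show "\<forall>\<^sub>F j in sequentially. \<forall>t\<in>{0..s}. dist (Lj j x t \<omega>) (LT x t \<omega>) < e"
  proof eventually_elim
    case (elim j)
    show ?case
    proof
      fix t assume t: "t \<in> {0..s}"
      have near: "\<bar>ell (x + \<sigma> / real (Suc j)) t \<omega> - ell x t \<omega>\<bar> \<le> e / 2" if \<sigma>: "0 \<le> \<sigma>" "\<sigma> \<le> 1" for \<sigma>
      proof -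
        have 1: "0 \<le> \<sigma> / real (Suc j)" "\<sigma> / real (Suc j) \<le> 1 / real (Suc j)"
          using \<sigma> by (auto intro!: divide_right_mono)
        have 2: "\<sigma> / real (Suc j) \<le> 1" using \<sigma> by (simp add: field_simps)
        have "dist (x + \<sigma> / real (Suc j), t) (x, t) = \<sigma> / real (Suc j)"
          using \<sigma> by (simp add: dist_Pair_Pair dist_real_def del: of_nat_Suc)
        then have "dist (x + \<sigma> / real (Suc j), t) (x, t) < d"
          using elim 1(2) by linarith
        then show ?thesis
          using d(2)[of "(x, t)" "(x + \<sigma> / real (Suc j), t)"] 1 2 t
          by (auto simp: dist_real_def simp del: of_nat_Suc)
      qed
      have near': "ell (x + \<sigma> / real (Suc j)) t \<omega> \<le> ell x t \<omega> + e / 2"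
        "ell x t \<omega> - e / 2 \<le> ell (x + \<sigma> / real (Suc j)) t \<omega>" if "0 \<le> \<sigma>" "\<sigma> \<le> 1" for \<sigma>
        using near[OF that] unfolding abs_le_iff by linarith+
      have one: "(\<integral>\<^sup>+ \<sigma>. indicator {0..1} \<sigma> * ennreal y \<partial>(lborel :: real measure)) = ennreal y" for y
        by (subst nn_integral_multc) auto
      have "ennreal (Lj j x t \<omega>) \<le> (\<integral>\<^sup>+ \<sigma>. indicator {0..1} \<sigma> * ennreal (ell x t \<omega> + e / 2) \<partial>(lborel :: real measure))"
        unfolding Lj_occupation[OF \<omega>, of t j x, OF atLeastAtMost_iff[THEN iffD1, OF t, THEN conjunct1]]
      proof (intro nn_integral_mono)
        fix \<sigma> :: real
        show "indicator {0..1} \<sigma> * ennreal (ell (x + \<sigma> / real (Suc j)) t \<omega>) \<le> indicator {0..1} \<sigma> * ennreal (ell x t \<omega> + e / 2)"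
          using near'[of \<sigma>] by (cases "\<sigma> \<in> {0..1}") (auto intro!: ennreal_leI simp del: of_nat_Suc ennreal_plus)
      qed
      then have 1: "Lj j x t \<omega> \<le> ell x t \<omega> + e / 2"
        using ell_nonneg[OF \<omega>, of t x] t e by (simp add: one del: ennreal_plus)
      have "(\<integral>\<^sup>+ \<sigma>. indicator {0..1} \<sigma> * ennreal (ell x t \<omega> - e / 2) \<partial>(lborel :: real measure)) \<le> ennreal (Lj j x t \<omega>)"
        unfolding Lj_occupation[OF \<omega>, of t j x, OF atLeastAtMost_iff[THEN iffD1, OF t, THEN conjunct1]]
      proof (intro nn_integral_mono)
        fix \<sigma> :: real
        show "indicator {0..1} \<sigma> * ennreal (ell x t \<omega> - e / 2) \<le> indicator {0..1} \<sigma> * ennreal (ell (x + \<sigma> / real (Suc j)) t \<omega>)"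
          using near'[of \<sigma>] by (cases "\<sigma> \<in> {0..1}") (auto intro!: ennreal_leI simp del: of_nat_Suc ennreal_plus)
      qed
      then have "ell x t \<omega> - e / 2 \<le> Lj j x t \<omega>"
        using Lj_nonneg[of j x t \<omega>] by (simp add: one)
      then show "dist (Lj j x t \<omega>) (LT x t \<omega>) < e"
        using 1 t e \<omega> by (simp add: dist_real_def LT_def abs_less_iff)
    qed
  qed
qed

lemma Lj_tendsto:
  assumes "0 \<le> t" "\<omega> \<in> G"
  shows "(\<lambda>j. Lj j x t \<omega>) \<longlonglongrightarrow> LT x t \<omega>"
  using tendsto_uniform_limitI[OF Lj_uniform_limit[OF assms], of t] assms by simp

lemma LT_measurable [measurable (raw)]:
  assumes [measurable]: "f \<in> borel_measurable N" "g \<in> measurable N M"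
  shows "(\<lambda>p. LT x (f p) (g p)) \<in> borel_measurable N"
proof (rule borel_measurable_LIMSEQ_real)
  fix p assume "p \<in> space N"
  show "(\<lambda>j. if g p \<in> G then Lj j x (max (f p) 0) (g p) else 0) \<longlonglongrightarrow> LT x (f p) (g p)"
    using Lj_tendsto[of "max (f p) 0" "g p" x] by (auto simp: LT_def)
qed measurable

lemma LT_nonneg: "0 \<le> LT x t \<omega>"
  by (simp add: LT_def ell_nonneg)

lemma LT_zero: "LT x 0 \<omega> = 0"
proof (cases "\<omega> \<in> G")
  case True
  have "Lj j x 0 \<omega> = 0" for j
  proof -
    have "run (\<lambda>r. unif j x (X r \<omega>)) 0 0 = 0"
      unfolding run_def
    proof (rule nn_integral_0_iff_AE[THEN iffD2])
      have [measurable]: "\<omega> \<in> space M" using True by (rule G_space)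
      show "(\<lambda>v. if 0 \<le> v \<and> v \<le> 0 then unif j x (X v \<omega>) else 0) \<in> borel_measurable lborel" by measurable
      show "AE v in lborel. (if 0 \<le> v \<and> v \<le> 0 then unif j x (X v \<omega>) else 0) = 0"
        using AE_lborel_singleton[of 0] by eventually_elim auto
    qed
    then show ?thesis by (simp add: Lj_def)
  qed
  then show ?thesis using Lj_tendsto[of 0 \<omega> x] True by (simp add: LIMSEQ_const_iff)
qed (simp add: LT_def)

lemma LT_mono:
  assumes "s \<le> t"
  shows "LT x s \<omega> \<le> LT x t \<omega>"
proof (cases "\<omega> \<in> G \<and> 0 \<le> s")
  case True
  have "Lj j x s \<omega> \<le> Lj j x t \<omega>" for j
    unfolding Lj_def using run_mono[OF assms] run_unif_finite by (intro enn2real_mono) auto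
  then show ?thesis
    using Lj_tendsto[of s \<omega> x] Lj_tendsto[of t \<omega> x] True assms by (intro LIMSEQ_le) auto
next
  case False
  then show ?thesis
    using LT_nonneg[of x t \<omega>] LT_zero[of x \<omega>] by (auto simp: LT_def max_def split: if_splits)
qed

lemma LT_continuous: "continuous_on S (\<lambda>t. LT x t \<omega>)"
proof (cases "\<omega> \<in> G")
  case True
  have "continuous_on S (\<lambda>t. (\<lambda>(x, t). ell x t \<omega>) (x, max t 0))"
    by (rule continuous_on_compose2[OF ell_cont[OF True]]) (auto intro!: continuous_intros)
  then show ?thesis using True by (simp add: LT_def)
qed (simp add: LT_def)

text \<open>Integer times keep the event measurable and, by monotonicity, miss nothing. Attaining
  the level, and not merely having it as supremum, corresponds to a finite inverse local
  time.\<close>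

definition reach :: "real \<Rightarrow> 'a \<Rightarrow> bool" where "reach \<zeta> \<omega> \<longleftrightarrow> (\<exists>n::nat. \<zeta> \<le> LT 0 (real n) \<omega>)"

definition TT :: "real \<Rightarrow> 'a \<Rightarrow> real" where
  "TT \<zeta> \<omega> = (if reach \<zeta> \<omega> then Inf {t. 0 \<le> t \<and> \<zeta> \<le> LT 0 t \<omega>} else 0)"

lemma reachI: "\<zeta> \<le> LT 0 t \<omega> \<Longrightarrow> reach \<zeta> \<omega>"
  unfolding reach_def using LT_mono[of t "real (nat \<lceil>t\<rceil>)" 0 \<omega>] by (intro exI[of _ "nat \<lceil>t\<rceil>"]) linarith

text \<open>By continuity the infimum is attained, which makes \<open>TT\<close> adjoint to the
  nondecreasing local time at 0.\<close>

lemma TT: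
  assumes "reach \<zeta> \<omega>"
  shows "0 \<le> TT \<zeta> \<omega>" "\<zeta> \<le> LT 0 (TT \<zeta> \<omega>) \<omega>" "0 \<le> t \<Longrightarrow> \<zeta> \<le> LT 0 t \<omega> \<longleftrightarrow> TT \<zeta> \<omega> \<le> t"
proof -
  let ?S = "{t. 0 \<le> t \<and> \<zeta> \<le> LT 0 t \<omega>}"
  have "?S = {0..} \<inter> (\<lambda>t. LT 0 t \<omega>) -` {\<zeta>..}" by auto
  moreover have "closed ({0..} \<inter> (\<lambda>t. LT 0 t \<omega>) -` {\<zeta>..})"
    by (intro continuous_closed_preimage LT_continuous) auto
  ultimately have "closed ?S" by simp
  moreover have "?S \<noteq> {}"
  proof -
    obtain n :: nat where "\<zeta> \<le> LT 0 (real n) \<omega>" using assms by (auto simp: reach_def)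
    then have "real n \<in> ?S" by simp
    then show ?thesis by blast
  qed
  moreover have bdd: "bdd_below ?S" by (auto intro!: bdd_belowI[of _ 0])
  ultimately have "Inf ?S \<in> ?S" by (intro closed_contains_Inf)
  then show 1: "0 \<le> TT \<zeta> \<omega>" "\<zeta> \<le> LT 0 (TT \<zeta> \<omega>) \<omega>" using assms by (auto simp: TT_def)
  show "\<zeta> \<le> LT 0 t \<omega> \<longleftrightarrow> TT \<zeta> \<omega> \<le> t" if "0 \<le> t"
  proof
    assume "\<zeta> \<le> LT 0 t \<omega>"
    then show "TT \<zeta> \<omega> \<le> t" using that assms bdd by (auto simp: TT_def intro!: cInf_lower)
  next
    assume "TT \<zeta> \<omega> \<le> t"
    then show "\<zeta> \<le> LT 0 t \<omega>" using 1 LT_mono[of "TT \<zeta> \<omega>" t 0 \<omega>] by linarith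
  qed
qed

lemma LT_TT:
  assumes "reach \<zeta> \<omega>" "0 \<le> \<zeta>"
  shows "LT 0 (TT \<zeta> \<omega>) \<omega> = \<zeta>"
proof -
  obtain t where t: "0 \<le> t" "t \<le> TT \<zeta> \<omega>" "LT 0 t \<omega> = \<zeta>"
    using IVT'[of "\<lambda>t. LT 0 t \<omega>" 0 \<zeta> "TT \<zeta> \<omega>"] TT(1,2)[OF assms(1)] assms(2) LT_zero LT_continuous by auto
  then have "TT \<zeta> \<omega> \<le> t" using TT(3)[OF assms(1), of t] by simp
  then show ?thesis using t by simp
qed

lemma TT_restrict:
  assumes "\<zeta> \<le> LT 0 s \<omega>" "0 \<le> s"
  shows "Inf {t. 0 \<le> t \<and> t \<le> s \<and> \<zeta> \<le> LT 0 t \<omega>} = TT \<zeta> \<omega>"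
proof (rule cInf_eq_minimum)
  have r: "reach \<zeta> \<omega>" using assms by (intro reachI)
  then show "TT \<zeta> \<omega> \<in> {t. 0 \<le> t \<and> t \<le> s \<and> \<zeta> \<le> LT 0 t \<omega>}"
    using TT(1,2)[OF r] TT(3)[OF r assms(2)] assms by auto
  show "TT \<zeta> \<omega> \<le> t" if "t \<in> {t. 0 \<le> t \<and> t \<le> s \<and> \<zeta> \<le> LT 0 t \<omega>}" for t
    using TT(3)[OF r, of t] that by auto
qed

lemma reach_measurable [measurable]:
  assumes [measurable]: "f \<in> borel_measurable N" "g \<in> measurable N M"
  shows "Measurable.pred N (\<lambda>p. reach (f p) (g p))"
  unfolding reach_def by measurable

lemma TT_measurable [measurable (raw)]:
  assumes [measurable]: "f \<in> borel_measurable N" "g \<in> measurable N M"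
  shows "(\<lambda>p. TT (f p) (g p)) \<in> borel_measurable N"
proof (rule borel_measurable_iff_le[THEN iffD2], rule allI)
  fix a :: real
  \<comment> \<open>Where the level is not reached \<open>TT\<close> has the default value 0, hence
    the alternative.\<close>
  have "TT \<zeta> \<omega> \<le> a \<longleftrightarrow> 0 \<le> a \<and> (\<not> reach \<zeta> \<omega> \<or> \<zeta> \<le> LT 0 a \<omega>)" for \<zeta> \<omega>
    using TT(1)[of \<zeta> \<omega>] TT(3)[of \<zeta> \<omega> a] reachI[of \<zeta> a \<omega>] by (cases "reach \<zeta> \<omega>") (auto simp: TT_def)
  then have "{p \<in> space N. TT (f p) (g p) \<le> a} =
      {p \<in> space N. 0 \<le> a \<and> (\<not> reach (f p) (g p) \<or> f p \<le> LT 0 a (g p))}" by simp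
  also have "\<dots> \<in> sets N" by measurable
  finally show "{p \<in> space N. TT (f p) (g p) \<le> a} \<in> sets N" .
qed

end

lemma ennreal_fact: "ennreal (fact n) = fact n"
proof -
  have "(fact n :: ennreal) = of_nat (fact n)" by (rule of_nat_fact[symmetric])
  also have "\<dots> = ennreal (real (fact n))" by (rule ennreal_of_nat_eq_real_of_nat)
  finally show ?thesis by (simp only: of_nat_fact)
qed

section \<open>Joint transform of the inverse local time and the local time at a second
  level\<close>

context local_time_process
begin

context
  fixes q :: real
  assumes q: "0 < q"
begin

interpretation R: resolvent b c \<nu> W q "resolvent_measure q"
  by (rule resolvent_locale[OF q])

lemma run_mix:
  assumes \<omega> [measurable]: "\<omega> \<in> space M" and "0 \<le> \<alpha>" "0 \<le> \<beta>"
  shows "run (\<lambda>r. R.mix \<alpha> \<beta> x j (X r \<omega>)) 0 t = ennreal (\<alpha> * Lj j 0 t \<omega> + \<beta> * Lj j x t \<omega>)"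
proof -
  have "run (\<lambda>r. R.mix \<alpha> \<beta> x j (X r \<omega>)) 0 t =
      (\<integral>\<^sup>+ v. ennreal \<alpha> * (if 0 \<le> v \<and> v \<le> t then unif j 0 (X v \<omega>) else 0) +
        ennreal \<beta> * (if 0 \<le> v \<and> v \<le> t then unif j x (X v \<omega>) else 0) \<partial>lborel)"
    unfolding run_def R.mix_def by (intro nn_integral_cong) auto
  also have "\<dots> = ennreal \<alpha> * run (\<lambda>r. unif j 0 (X r \<omega>)) 0 t + ennreal \<beta> * run (\<lambda>r. unif j x (X r \<omega>)) 0 t"
    unfolding run_def by (subst nn_integral_add) (auto simp: nn_integral_cmult)
  also have "\<dots> = ennreal (\<alpha> * Lj j 0 t \<omega> + \<beta> * Lj j x t \<omega>)"
    using assms Lj_nonneg by (simp add: run_unif ennreal_mult)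
  finally show ?thesis .
qed

text \<open>The Stieltjes integral up to time \<open>fst p\<close>, against the local time at 0, of
  the \<open>k\<close>-th power of \<alpha> times the local time at 0 plus \<beta> times that at
  \<open>x\<close>, with the level \<zeta> substituted for time.\<close>

definition limit_functional :: "real \<Rightarrow> real \<Rightarrow> real \<Rightarrow> nat \<Rightarrow> real \<times> 'a \<Rightarrow> ennreal" where
  "limit_functional \<alpha> \<beta> x k p = (\<integral>\<^sup>+ \<zeta>. (if 0 < \<zeta> \<and> \<zeta> \<le> LT 0 (fst p) (snd p)
      then ennreal ((\<alpha> * \<zeta> + \<beta> * LT x (TT \<zeta> (snd p)) (snd p)) ^ k) else 0) \<partial>lborel)"

definition approx_functional :: "real \<Rightarrow> real \<Rightarrow> real \<Rightarrow> nat \<Rightarrow> nat \<Rightarrow> real \<times> 'a \<Rightarrow> ennreal" where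
  "approx_functional \<alpha> \<beta> x k j p = run (\<lambda>t. run (\<lambda>r. R.mix \<alpha> \<beta> x j (X r (snd p))) 0 t ^ k * unif j 0 (X t (snd p))) 0 (fst p)"

lemma functional_measurable [measurable]:
  "limit_functional \<alpha> \<beta> x k \<in> borel_measurable (borel \<Otimes>\<^sub>M M)"
  "approx_functional \<alpha> \<beta> x k j \<in> borel_measurable (borel \<Otimes>\<^sub>M M)"
  unfolding limit_functional_def approx_functional_def run_def by measurable

text \<open>Stieltjes convergence with the local time at 0 as integrator. At time
  \<open>TT \<zeta> \<omega>\<close> that local time equals \<zeta>, so in the limit it enters the
  integrand as the level itself.\<close>

lemma approx_functional_tendsto:
  assumes \<omega>: "\<omega> \<in> G" and s: "0 \<le> s" and "0 \<le> \<alpha>" "0 \<le> \<beta>"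
  shows "(\<lambda>j. approx_functional \<alpha> \<beta> x k j (s, \<omega>)) \<longlonglongrightarrow> limit_functional \<alpha> \<beta> x k (s, \<omega>)"
proof -
  have \<omega>M [measurable]: "\<omega> \<in> space M" using \<omega> by (rule G_space)
  let ?D = "\<lambda>t. \<alpha> * LT 0 t \<omega> + \<beta> * LT x t \<omega>"
  let ?Dj = "\<lambda>j t. \<alpha> * Lj j 0 t \<omega> + \<beta> * Lj j x t \<omega>"
  have D_cont: "continuous_on S ?D" for S by (intro continuous_intros LT_continuous)
  have D_nonneg: "0 \<le> ?D t" for t using assms LT_nonneg by simp
  have D_mono: "?D t \<le> ?D t'" if "t \<le> t'" for t t'
    using assms LT_mono[OF that] by (intro add_mono mult_left_mono) auto
  have "uniform_limit {0..s} ?Dj ?D sequentially"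
    by (intro uniform_limit_add bounded_linear.uniform_limit[OF bounded_linear_mult_right] Lj_uniform_limit s \<omega>)
  then have ul: "uniform_limit {0..s} (\<lambda>j t. ?Dj j t ^ k) (\<lambda>t. ?D t ^ k) sequentially"
    by (rule uniform_limit_power) (intro compact_imp_bounded compact_continuous_image D_cont compact_Icc)
  have "(\<lambda>j. run (\<lambda>t. ennreal (?Dj j t ^ k) * unif j 0 (X t \<omega>)) 0 s) \<longlonglongrightarrow>
    (\<integral>\<^sup>+ \<zeta>. (if 0 < \<zeta> \<and> \<zeta> \<le> LT 0 s \<omega> then ennreal (?D (Inf {t. 0 \<le> t \<and> t \<le> s \<and> \<zeta> \<le> LT 0 t \<omega>}) ^ k) else 0) \<partial>lborel)"
  proof (rule stieltjes_convergence_uniform[where Aj = "\<lambda>j t. Lj j 0 t \<omega>"])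
    show "mono_on {0..s} (\<lambda>t. ?D t ^ k)"
      using D_mono D_nonneg by (auto intro!: mono_onI power_mono)
    show "continuous_on {0..s} (\<lambda>t. ?D t ^ k)" by (intro continuous_on_power D_cont)
    show "(\<lambda>j. Lj j 0 t \<omega>) \<longlonglongrightarrow> LT 0 t \<omega>" if "0 \<le> t" for t
      using Lj_tendsto[OF that \<omega>] .
  qed (use s ul D_nonneg in \<open>auto simp: run_unif Lj_nonneg LT_zero intro!: LT_continuous mono_onI LT_mono\<close>)
  moreover have "run (\<lambda>t. ennreal (?Dj j t ^ k) * unif j 0 (X t \<omega>)) 0 s = approx_functional \<alpha> \<beta> x k j (s, \<omega>)" for j
  proof -
    have "ennreal (?Dj j t ^ k) = run (\<lambda>r. R.mix \<alpha> \<beta> x j (X r \<omega>)) 0 t ^ k" for t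
      using assms Lj_nonneg by (simp add: run_mix[OF \<omega>M] ennreal_power del: ennreal_plus)
    then show ?thesis by (simp add: approx_functional_def)
  qed
  moreover have "(\<integral>\<^sup>+ \<zeta>. (if 0 < \<zeta> \<and> \<zeta> \<le> LT 0 s \<omega> then ennreal (?D (Inf {t. 0 \<le> t \<and> t \<le> s \<and> \<zeta> \<le> LT 0 t \<omega>}) ^ k) else 0) \<partial>lborel) =
      limit_functional \<alpha> \<beta> x k (s, \<omega>)"
    unfolding limit_functional_def
    by (intro nn_integral_cong) (auto simp: TT_restrict[OF _ s] LT_TT reachI)
  ultimately show ?thesis by simp
qed

text \<open>The product of \<open>M\<close> with an exponential time of rate \<open>q\<close>: a
  finite measure, as the passage to the limit by second moments requires.\<close>

definition clock :: "(real \<times> 'a) measure" where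
  "clock = density (lborel \<Otimes>\<^sub>M M) (\<lambda>p. ennreal q * disc q (fst p))"

lemma sets_clock [measurable_cong]: "sets clock = sets (borel \<Otimes>\<^sub>M M)"
  by (simp add: clock_def)

lemma nn_integral_clock:
  assumes [measurable]: "f \<in> borel_measurable (borel \<Otimes>\<^sub>M M)"
  shows "(\<integral>\<^sup>+ p. f p \<partial>clock) = (\<integral>\<^sup>+ \<omega>. (\<integral>\<^sup>+ s. ennreal q * disc q s * f (s, \<omega>) \<partial>lborel) \<partial>M)"
proof -
  interpret P: pair_sigma_finite lborel M ..
  have "(\<integral>\<^sup>+ p. f p \<partial>clock) = (\<integral>\<^sup>+ p. ennreal q * disc q (fst p) * f p \<partial>(lborel \<Otimes>\<^sub>M M))"
    unfolding clock_def by (rule nn_integral_density) measurable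
  also have "\<dots> = (\<integral>\<^sup>+ \<omega>. (\<integral>\<^sup>+ s. ennreal q * disc q s * f (s, \<omega>) \<partial>lborel) \<partial>M)"
    by (subst P.nn_integral_snd[symmetric]) auto
  finally show ?thesis .
qed

lemma finite_clock: "finite_measure clock"
proof (rule finite_measureI)
  have "emeasure clock (space clock) = (\<integral>\<^sup>+ p. 1 \<partial>clock)" by simp
  also have "\<dots> = (\<integral>\<^sup>+ \<omega>. (\<integral>\<^sup>+ s. ennreal q * disc q s * 1 \<partial>lborel) \<partial>M)"
    by (rule nn_integral_clock) simp
  also have "(\<integral>\<^sup>+ s. ennreal q * disc q s * 1 \<partial>lborel) = (\<integral>\<^sup>+ s. (if 0 \<le> s then ennreal q * disc q s else 0) \<partial>lborel)"
    by (intro nn_integral_cong) (auto simp: disc_def)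
  also have "\<dots> = 1" using disc_tail[OF q, of 0] by simp
  finally show "emeasure clock (space clock) \<noteq> \<infinity>" by (simp add: emeasure_space_1)
qed

text \<open>Kac's moment formula: the power is unfolded into ordered times, and the expectation of
  the discounted ordered integral is a kernel chain started at 0.\<close>

lemma expectation_run_power:
  assumes [measurable]: "f \<in> borel_measurable borel" "g \<in> borel_measurable borel"
  shows "(\<integral>\<^sup>+ \<omega>. (\<integral>\<^sup>+ t. disc q t * (run (\<lambda>r. f (X r \<omega>)) 0 t ^ k * g (X t \<omega>)) \<partial>lborel) \<partial>M) =
    fact k * kernel_chain (resolvent_measure q) (replicate k f @ [g]) 0"
proof -
  have "(\<integral>\<^sup>+ \<omega>. (\<integral>\<^sup>+ t. disc q t * (run (\<lambda>r. f (X r \<omega>)) 0 t ^ k * g (X t \<omega>)) \<partial>lborel) \<partial>M) =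
      (\<integral>\<^sup>+ \<omega>. fact k * path_chain q (replicate k f @ [g]) 0 \<omega> \<partial>M)"
  proof (intro nn_integral_cong)
    fix \<omega> assume [measurable]: "\<omega> \<in> space M"
    show "(\<integral>\<^sup>+ t. disc q t * (run (\<lambda>r. f (X r \<omega>)) 0 t ^ k * g (X t \<omega>)) \<partial>lborel) = fact k * path_chain q (replicate k f @ [g]) 0 \<omega>"
      using chain_replicate[of "\<lambda>r. f (X r \<omega>)" "\<lambda>r. g (X r \<omega>)" k q 0]
      by (simp add: path_chain_def)
  qed
  also have "\<dots> = fact k * (\<integral>\<^sup>+ \<omega>. path_chain q (replicate k f @ [g]) 0 \<omega> \<partial>M)"
    by (rule nn_integral_cmult) (intro path_chain_measurable', auto)
  also have "(\<integral>\<^sup>+ \<omega>. path_chain q (replicate k f @ [g]) 0 \<omega> \<partial>M) = kernel_chain (resolvent_measure q) (replicate k f @ [g]) 0"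
    by (rule expectation_path_chain_zero[OF q]) auto
  finally show ?thesis .
qed

lemma approx_functional_integral:
  "(\<integral>\<^sup>+ p. approx_functional \<alpha> \<beta> x k j p \<partial>clock) =
    fact k * kernel_chain (resolvent_measure q) (replicate k (R.mix \<alpha> \<beta> x j) @ [unif j 0]) 0"
proof -
  have "(\<integral>\<^sup>+ p. approx_functional \<alpha> \<beta> x k j p \<partial>clock) =
      (\<integral>\<^sup>+ \<omega>. (\<integral>\<^sup>+ s. ennreal q * disc q s * approx_functional \<alpha> \<beta> x k j (s, \<omega>) \<partial>lborel) \<partial>M)"
    by (rule nn_integral_clock) measurable
  also have "\<dots> = (\<integral>\<^sup>+ \<omega>. (\<integral>\<^sup>+ t. disc q t * (run (\<lambda>r. R.mix \<alpha> \<beta> x j (X r \<omega>)) 0 t ^ k * unif j 0 (X t \<omega>)) \<partial>lborel) \<partial>M)"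
  proof (rule nn_integral_cong)
    fix \<omega> assume [measurable]: "\<omega> \<in> space M"
    show "(\<integral>\<^sup>+ s. ennreal q * disc q s * approx_functional \<alpha> \<beta> x k j (s, \<omega>) \<partial>lborel) =
        (\<integral>\<^sup>+ t. disc q t * (run (\<lambda>r. R.mix \<alpha> \<beta> x j (X r \<omega>)) 0 t ^ k * unif j 0 (X t \<omega>)) \<partial>lborel)"
      unfolding approx_functional_def fst_conv snd_conv by (rule disc_integral_by_parts[OF q, symmetric]) measurable
  qed
  finally show ?thesis by (simp add: expectation_run_power)
qed

text \<open>Here \<open>\<alpha> > 0\<close> enters: with \<open>d\<close> the final value of the
  combined functional, the integral is at most \<open>d ^ k\<close> times the approximate local time
  at 0, hence at most \<open>d ^ Suc k / \<alpha>\<close>. The square is a moment of order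
  \<open>2 * k + 2\<close>, again a kernel chain, now ending in the constant 1, whose integral
  against the resolvent is \<open>1 / q\<close>.\<close>

lemma approx_functional_second_moment:
  assumes \<alpha>: "0 < \<alpha>" and \<beta>: "0 \<le> \<beta>"
  shows "(\<integral>\<^sup>+ p. approx_functional \<alpha> \<beta> x k j p ^ 2 \<partial>clock) \<le>
    ennreal ((1 / \<alpha>\<^sup>2) * (q * (fact (2 * k + 2) * (((\<alpha> + \<beta>) * R.u 0) ^ (2 * k + 2) * (1 / q)))))"
proof -
  let ?m = "2 * k + 2"
  let ?D = "\<lambda>t \<omega>. run (\<lambda>r. R.mix \<alpha> \<beta> x j (X r \<omega>)) 0 t"
  have pw: "approx_functional \<alpha> \<beta> x k j (s, \<omega>) ^ 2 \<le> ennreal (1 / \<alpha>\<^sup>2) * ?D s \<omega> ^ ?m" if \<omega>M: "\<omega> \<in> space M" for s \<omega>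
  proof -
    note [measurable] = \<omega>M
    define d where "d = \<alpha> * Lj j 0 s \<omega> + \<beta> * Lj j x s \<omega>"
    have d: "?D s \<omega> = ennreal d" "0 \<le> d" using run_mix[OF \<omega>M] \<alpha> \<beta> Lj_nonneg by (auto simp: d_def)
    have "approx_functional \<alpha> \<beta> x k j (s, \<omega>) \<le>
        (\<integral>\<^sup>+ t. ?D s \<omega> ^ k * (if 0 \<le> t \<and> t \<le> s then unif j 0 (X t \<omega>) else 0) \<partial>lborel)"
      unfolding approx_functional_def fst_conv snd_conv run_def[of "\<lambda>t. ?D t \<omega> ^ k * unif j 0 (X t \<omega>)"]
      by (intro nn_integral_mono) (auto intro!: mult_right_mono power_mono run_mono)
    also have "\<dots> = ?D s \<omega> ^ k * run (\<lambda>r. unif j 0 (X r \<omega>)) 0 s"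
      unfolding run_def[of "\<lambda>r. unif j 0 (X r \<omega>)"] by (rule nn_integral_cmult) measurable
    also have "\<dots> = ennreal (d ^ k * Lj j 0 s \<omega>)"
      using d Lj_nonneg by (simp add: run_unif ennreal_power ennreal_mult)
    also have "\<dots> \<le> ennreal (d ^ Suc k / \<alpha>)"
    proof (rule ennreal_leI)
      have "\<alpha> * Lj j 0 s \<omega> \<le> d" using \<beta> Lj_nonneg by (simp add: d_def)
      then have "d ^ k * (\<alpha> * Lj j 0 s \<omega>) \<le> d ^ k * d" using d by (intro mult_left_mono) auto
      then show "d ^ k * Lj j 0 s \<omega> \<le> d ^ Suc k / \<alpha>" using \<alpha> by (simp add: field_simps)
    qed
    finally have "approx_functional \<alpha> \<beta> x k j (s, \<omega>) ^ 2 \<le> ennreal (d ^ Suc k / \<alpha>) ^ 2"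
      by (intro power_mono) auto
    also have "\<dots> = ennreal ((1 / \<alpha>\<^sup>2) * d ^ ?m)"
    proof -
      have "(d ^ Suc k)\<^sup>2 = d ^ ?m"
        unfolding power_mult[symmetric] by (intro arg_cong[where f = "\<lambda>n. d ^ n"]) simp
      then have "(d ^ Suc k / \<alpha>)\<^sup>2 = (1 / \<alpha>\<^sup>2) * d ^ ?m"
        by (simp only: power_divide) simp
      then show ?thesis using d \<alpha> by (subst ennreal_power) auto
    qed
    also have "\<dots> = ennreal (1 / \<alpha>\<^sup>2) * ?D s \<omega> ^ ?m"
      using d \<alpha> by (subst ennreal_mult) (auto simp: ennreal_power simp del: power_Suc)
    finally show ?thesis .
  qed
  have mD: "(\<lambda>p. ?D (fst p) (snd p) ^ ?m) \<in> borel_measurable (borel \<Otimes>\<^sub>M M)"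
    unfolding run_def by measurable
  have "(\<integral>\<^sup>+ p. approx_functional \<alpha> \<beta> x k j p ^ 2 \<partial>clock) \<le> (\<integral>\<^sup>+ p. ennreal (1 / \<alpha>\<^sup>2) * ?D (fst p) (snd p) ^ ?m \<partial>clock)"
  proof (intro nn_integral_mono)
    fix p assume "p \<in> space clock"
    then have "snd p \<in> space M" by (auto simp: clock_def space_pair_measure)
    then show "approx_functional \<alpha> \<beta> x k j p ^ 2 \<le> ennreal (1 / \<alpha>\<^sup>2) * ?D (fst p) (snd p) ^ ?m"
      using pw[of "snd p" "fst p"] by simp
  qed
  also have "\<dots> = ennreal (1 / \<alpha>\<^sup>2) * (\<integral>\<^sup>+ p. ?D (fst p) (snd p) ^ ?m \<partial>clock)"
    using mD by (intro nn_integral_cmult) (simp cong: measurable_cong_sets add: sets_clock)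
  also have "(\<integral>\<^sup>+ p. ?D (fst p) (snd p) ^ ?m \<partial>clock) =
      (\<integral>\<^sup>+ \<omega>. (\<integral>\<^sup>+ s. ennreal q * (disc q s * (?D s \<omega> ^ ?m * 1)) \<partial>lborel) \<partial>M)"
    by (subst nn_integral_clock[OF mD]) (simp add: mult.assoc)
  also have "\<dots> = (\<integral>\<^sup>+ \<omega>. ennreal q * (\<integral>\<^sup>+ s. disc q s * (?D s \<omega> ^ ?m * 1) \<partial>lborel) \<partial>M)"
  proof (rule nn_integral_cong)
    fix \<omega> assume [measurable]: "\<omega> \<in> space M"
    show "(\<integral>\<^sup>+ s. ennreal q * (disc q s * (?D s \<omega> ^ ?m * 1)) \<partial>lborel) = ennreal q * (\<integral>\<^sup>+ s. disc q s * (?D s \<omega> ^ ?m * 1) \<partial>lborel)"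
      by (rule nn_integral_cmult) measurable
  qed
  also have "\<dots> = ennreal q * (\<integral>\<^sup>+ \<omega>. (\<integral>\<^sup>+ s. disc q s * (?D s \<omega> ^ ?m * 1) \<partial>lborel) \<partial>M)"
    unfolding run_def by (rule nn_integral_cmult) measurable
  also have "(\<integral>\<^sup>+ \<omega>. (\<integral>\<^sup>+ s. disc q s * (?D s \<omega> ^ ?m * 1) \<partial>lborel) \<partial>M) =
      fact ?m * kernel_chain (resolvent_measure q) (replicate ?m (R.mix \<alpha> \<beta> x j) @ [\<lambda>_. 1]) 0"
    by (rule expectation_run_power) measurable
  also have "ennreal (1 / \<alpha>\<^sup>2) * (ennreal q * (fact ?m * kernel_chain (resolvent_measure q) (replicate ?m (R.mix \<alpha> \<beta> x j) @ [\<lambda>_. 1]) 0))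
      \<le> ennreal (1 / \<alpha>\<^sup>2) * (ennreal q * (ennreal (fact ?m) * ennreal (((\<alpha> + \<beta>) * R.u 0) ^ ?m * (1 / q))))"
  proof (intro mult_left_mono mult_mono)
    show "kernel_chain (resolvent_measure q) (replicate ?m (R.mix \<alpha> \<beta> x j) @ [\<lambda>_. 1]) 0 \<le> ennreal (((\<alpha> + \<beta>) * R.u 0) ^ ?m * (1 / q))"
      using \<alpha> \<beta> q resolvent_measure_mass[OF q] by (intro R.kernel_chain_mix_le) auto
    show "(fact ?m :: ennreal) \<le> ennreal (fact ?m)" by (simp only: ennreal_fact order_refl)
  qed auto
  also have "\<dots> = ennreal ((1 / \<alpha>\<^sup>2) * (q * (fact ?m * (((\<alpha> + \<beta>) * R.u 0) ^ ?m * (1 / q)))))"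
  proof -
    have "0 \<le> ((\<alpha> + \<beta>) * R.u 0) ^ ?m * (1 / q)" "0 \<le> 1 / \<alpha>\<^sup>2" "0 \<le> q" "(0::real) \<le> fact ?m"
      using \<alpha> \<beta> q R.u0_pos by simp_all
    then show ?thesis by (simp only: ennreal_mult mult_nonneg_nonneg)
  qed
  finally show ?thesis .
qed

lemma limit_functional_integral:
  assumes \<alpha>: "0 < \<alpha>" and \<beta>: "0 \<le> \<beta>"
  shows "(\<integral>\<^sup>+ p. limit_functional \<alpha> \<beta> x k p \<partial>clock) = ennreal (fact k * R.vertex \<alpha> \<beta> x k 0)"
proof -
  have "(\<lambda>j. \<integral>\<^sup>+ p. approx_functional \<alpha> \<beta> x k j p \<partial>clock) \<longlonglongrightarrow> (\<integral>\<^sup>+ p. limit_functional \<alpha> \<beta> x k p \<partial>clock)"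
  proof (rule nn_integral_convergence_L2_bounded[OF finite_clock _ _ _ approx_functional_second_moment[OF \<alpha> \<beta>]])
    interpret P: pair_sigma_finite lborel M ..
    have ae: "AE p in lborel \<Otimes>\<^sub>M M. snd p \<in> G"
    proof (rule P.AE_pair_measure)
      show "{p \<in> space (lborel \<Otimes>\<^sub>M M). snd p \<in> G} \<in> sets (lborel \<Otimes>\<^sub>M M)" by measurable
    qed (use G_AE in auto)
    have "AE p in lborel \<Otimes>\<^sub>M M. 0 < ennreal q * disc q (fst p) \<longrightarrow>
        (\<lambda>j. approx_functional \<alpha> \<beta> x k j p) \<longlonglongrightarrow> limit_functional \<alpha> \<beta> x k p"
      using ae
    proof (eventually_elim, intro impI)
      fix p :: "real \<times> 'a" assume "snd p \<in> G" "0 < ennreal q * disc q (fst p)"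
      then show "(\<lambda>j. approx_functional \<alpha> \<beta> x k j p) \<longlonglongrightarrow> limit_functional \<alpha> \<beta> x k p"
        using approx_functional_tendsto[of "snd p" "fst p" \<alpha> \<beta> x k] \<alpha> \<beta> by (auto simp: disc_def split: if_splits)
    qed
    then show "AE p in clock. (\<lambda>j. approx_functional \<alpha> \<beta> x k j p) \<longlonglongrightarrow> limit_functional \<alpha> \<beta> x k p"
      unfolding clock_def by (subst AE_density) auto
  qed auto
  moreover have "(\<lambda>j. \<integral>\<^sup>+ p. approx_functional \<alpha> \<beta> x k j p \<partial>clock) \<longlonglongrightarrow> ennreal (fact k) * ennreal (R.vertex \<alpha> \<beta> x k 0)"
  proof -
    show ?thesis
      unfolding approx_functional_integral ennreal_fact[symmetric] using \<alpha> \<beta>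
      by (intro tendsto_mult_ennreal tendsto_const R.kernel_chain_tendsto[where y = "\<lambda>_. 0"]) auto
  qed
  ultimately have "(\<integral>\<^sup>+ p. limit_functional \<alpha> \<beta> x k p \<partial>clock) = ennreal (fact k) * ennreal (R.vertex \<alpha> \<beta> x k 0)"
    by (rule LIMSEQ_unique)
  then show ?thesis using \<alpha> \<beta> R.vertex_nonneg by (simp add: ennreal_mult)
qed

text \<open>The exponential time is integrated out: a level \<zeta> is counted when
  \<open>TT \<zeta> \<omega>\<close> comes before that time, which has probability
  \<open>exp (- q * TT \<zeta> \<omega>)\<close>.\<close>

lemma inverse_time_moments:
  assumes \<alpha>: "0 < \<alpha>" and \<beta>: "0 \<le> \<beta>"
  shows "(\<integral>\<^sup>+ \<omega>. (\<integral>\<^sup>+ \<zeta>. (if 0 < \<zeta> \<and> reach \<zeta> \<omega> then ennreal (exp (- q * TT \<zeta> \<omega>)) *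
      ennreal ((\<alpha> * \<zeta> + \<beta> * LT x (TT \<zeta> \<omega>) \<omega>) ^ k) else 0) \<partial>lborel) \<partial>M) = ennreal (fact k * R.vertex \<alpha> \<beta> x k 0)"
proof -
  let ?Z = "\<lambda>\<zeta> \<omega>. ennreal ((\<alpha> * \<zeta> + \<beta> * LT x (TT \<zeta> \<omega>) \<omega>) ^ k)"
  have "(\<integral>\<^sup>+ p. limit_functional \<alpha> \<beta> x k p \<partial>clock) =
      (\<integral>\<^sup>+ \<omega>. (\<integral>\<^sup>+ s. ennreal q * disc q s * limit_functional \<alpha> \<beta> x k (s, \<omega>) \<partial>lborel) \<partial>M)"
    by (rule nn_integral_clock) measurable
  also have "\<dots> = (\<integral>\<^sup>+ \<omega>. (\<integral>\<^sup>+ \<zeta>. (if 0 < \<zeta> \<and> reach \<zeta> \<omega> then ennreal (exp (- q * TT \<zeta> \<omega>)) * ?Z \<zeta> \<omega> else 0) \<partial>lborel) \<partial>M)"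
  proof (rule nn_integral_cong)
    fix \<omega> assume [measurable]: "\<omega> \<in> space M"
    have "(\<integral>\<^sup>+ s. ennreal q * disc q s * limit_functional \<alpha> \<beta> x k (s, \<omega>) \<partial>lborel) =
        (\<integral>\<^sup>+ s. (\<integral>\<^sup>+ \<zeta>. ennreal q * disc q s * (if 0 < \<zeta> \<and> \<zeta> \<le> LT 0 s \<omega> then ?Z \<zeta> \<omega> else 0) \<partial>lborel) \<partial>lborel)"
      unfolding limit_functional_def fst_conv snd_conv
      by (intro nn_integral_cong nn_integral_cmult[symmetric]) measurable
    also have "\<dots> = (\<integral>\<^sup>+ \<zeta>. (\<integral>\<^sup>+ s. ennreal q * disc q s * (if 0 < \<zeta> \<and> \<zeta> \<le> LT 0 s \<omega> then ?Z \<zeta> \<omega> else 0) \<partial>lborel) \<partial>lborel)"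
      by (rule lborel_pair.Fubini') measurable
    also have "\<dots> = (\<integral>\<^sup>+ \<zeta>. (if 0 < \<zeta> \<and> reach \<zeta> \<omega> then ennreal (exp (- q * TT \<zeta> \<omega>)) * ?Z \<zeta> \<omega> else 0) \<partial>lborel)"
    proof (intro nn_integral_cong)
      fix \<zeta> :: real
      show "(\<integral>\<^sup>+ s. ennreal q * disc q s * (if 0 < \<zeta> \<and> \<zeta> \<le> LT 0 s \<omega> then ?Z \<zeta> \<omega> else 0) \<partial>lborel) =
          (if 0 < \<zeta> \<and> reach \<zeta> \<omega> then ennreal (exp (- q * TT \<zeta> \<omega>)) * ?Z \<zeta> \<omega> else 0)"
      proof (cases "0 < \<zeta> \<and> reach \<zeta> \<omega>")
        case True
        then have "(\<integral>\<^sup>+ s. ennreal q * disc q s * (if 0 < \<zeta> \<and> \<zeta> \<le> LT 0 s \<omega> then ?Z \<zeta> \<omega> else 0) \<partial>lborel) =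
            (\<integral>\<^sup>+ s. (if TT \<zeta> \<omega> \<le> s then ennreal q * disc q s else 0) * ?Z \<zeta> \<omega> \<partial>lborel)"
          using TT(1,3)[of \<zeta> \<omega>] by (intro nn_integral_cong) (auto simp: disc_def)
        also have "\<dots> = (\<integral>\<^sup>+ s. (if TT \<zeta> \<omega> \<le> s then ennreal q * disc q s else 0) \<partial>lborel) * ?Z \<zeta> \<omega>"
          by (rule nn_integral_multc) measurable
        finally show ?thesis using True disc_tail[OF q TT(1)[of \<zeta> \<omega>]] by simp
      next
        case False
        then have eq: "(\<lambda>s. ennreal q * disc q s * (if 0 < \<zeta> \<and> \<zeta> \<le> LT 0 s \<omega> then ?Z \<zeta> \<omega> else 0)) = (\<lambda>_. 0)"
          using reachI[of \<zeta> _ \<omega>] by (intro ext) auto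
        show ?thesis unfolding eq if_not_P[OF False] by simp
      qed
    qed
    finally show "(\<integral>\<^sup>+ s. ennreal q * disc q s * limit_functional \<alpha> \<beta> x k (s, \<omega>) \<partial>lborel) =
        (\<integral>\<^sup>+ \<zeta>. (if 0 < \<zeta> \<and> reach \<zeta> \<omega> then ennreal (exp (- q * TT \<zeta> \<omega>)) * ?Z \<zeta> \<omega> else 0) \<partial>lborel)" .
  qed
  finally show ?thesis using limit_functional_integral[OF assms] by simp
qed

text \<open>The moments divided by \<open>fact k\<close> are summed termwise, all terms being
  nonnegative. The smallness condition is the convergence of the geometric majorant of the vertex
  weights.\<close>

lemma inverse_time_transform:
  assumes \<alpha>: "0 < \<alpha>" and \<beta>: "0 \<le> \<beta>" and small: "(\<alpha> + \<beta>) * R.u 0 < 1" and x: "0 \<le> x"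
  shows "(\<integral>\<^sup>+ \<omega>. (\<integral>\<^sup>+ \<zeta>. (if 0 < \<zeta> \<and> reach \<zeta> \<omega> then ennreal (exp (- q * TT \<zeta> \<omega>)) *
      ennreal (exp (\<alpha> * \<zeta> + \<beta> * LT x (TT \<zeta> \<omega>) \<omega>)) else 0) \<partial>lborel) \<partial>M) =
    ennreal (1 / ((1 / R.u 0 - R.rate x \<beta>) - \<alpha>))"
proof -
  let ?Y = "\<lambda>\<zeta> \<omega>. \<alpha> * \<zeta> + \<beta> * LT x (TT \<zeta> \<omega>) \<omega>"
  let ?h = "\<lambda>k \<zeta> \<omega>. (if 0 < \<zeta> \<and> reach \<zeta> \<omega> then ennreal (exp (- q * TT \<zeta> \<omega>)) * ennreal (?Y \<zeta> \<omega> ^ k) else 0)"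
  have expand: "(if 0 < \<zeta> \<and> reach \<zeta> \<omega> then ennreal (exp (- q * TT \<zeta> \<omega>)) * ennreal (exp (?Y \<zeta> \<omega>)) else 0) =
      (\<Sum>k. ennreal (1 / fact k) * ?h k \<zeta> \<omega>)" for \<zeta> \<omega>
  proof (cases "0 < \<zeta> \<and> reach \<zeta> \<omega>")
    case True
    have Y: "0 \<le> ?Y \<zeta> \<omega>" using True \<alpha> \<beta> LT_nonneg by simp
    have "(\<lambda>k. ?Y \<zeta> \<omega> ^ k /\<^sub>R fact k) sums exp (?Y \<zeta> \<omega>)" by (rule exp_converges)
    then have s: "(\<lambda>k. 1 / fact k * ?Y \<zeta> \<omega> ^ k) sums exp (?Y \<zeta> \<omega>)" by (simp add: field_simps)
    have "ennreal (exp (?Y \<zeta> \<omega>)) = (\<Sum>k. ennreal (1 / fact k * ?Y \<zeta> \<omega> ^ k))"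
      using s Y by (subst suminf_ennreal2) (auto simp: sums_iff)
    then have "ennreal (exp (- q * TT \<zeta> \<omega>)) * ennreal (exp (?Y \<zeta> \<omega>)) =
        (\<Sum>k. ennreal (exp (- q * TT \<zeta> \<omega>)) * ennreal (1 / fact k * ?Y \<zeta> \<omega> ^ k))"
      by (simp add: ennreal_suminf_cmult)
    also have "\<dots> = (\<Sum>k. ennreal (1 / fact k) * ?h k \<zeta> \<omega>)"
    proof (intro suminf_cong)
      fix k
      have "ennreal (1 / fact k * ?Y \<zeta> \<omega> ^ k) = ennreal (1 / fact k) * ennreal (?Y \<zeta> \<omega> ^ k)"
        using Y by (intro ennreal_mult) auto
      then show "ennreal (exp (- q * TT \<zeta> \<omega>)) * ennreal (1 / fact k * ?Y \<zeta> \<omega> ^ k) = ennreal (1 / fact k) * ?h k \<zeta> \<omega>"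
        using True by (simp add: mult_ac)
    qed
    finally show ?thesis using True by simp
  next
    case False
    show ?thesis unfolding if_not_P[OF False] by simp
  qed
  have "(\<integral>\<^sup>+ \<omega>. (\<integral>\<^sup>+ \<zeta>. (if 0 < \<zeta> \<and> reach \<zeta> \<omega> then ennreal (exp (- q * TT \<zeta> \<omega>)) * ennreal (exp (?Y \<zeta> \<omega>)) else 0) \<partial>lborel) \<partial>M) =
      (\<integral>\<^sup>+ \<omega>. (\<Sum>k. ennreal (1 / fact k) * (\<integral>\<^sup>+ \<zeta>. ?h k \<zeta> \<omega> \<partial>lborel)) \<partial>M)"
  proof (rule nn_integral_cong)
    fix \<omega> assume [measurable]: "\<omega> \<in> space M"
    show "(\<integral>\<^sup>+ \<zeta>. (if 0 < \<zeta> \<and> reach \<zeta> \<omega> then ennreal (exp (- q * TT \<zeta> \<omega>)) * ennreal (exp (?Y \<zeta> \<omega>)) else 0) \<partial>lborel) =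
        (\<Sum>k. ennreal (1 / fact k) * (\<integral>\<^sup>+ \<zeta>. ?h k \<zeta> \<omega> \<partial>lborel))"
      unfolding expand by (subst nn_integral_suminf) (auto simp: nn_integral_cmult)
  qed
  also have "\<dots> = (\<Sum>k. \<integral>\<^sup>+ \<omega>. ennreal (1 / fact k) * (\<integral>\<^sup>+ \<zeta>. ?h k \<zeta> \<omega> \<partial>lborel) \<partial>M)"
    by (rule nn_integral_suminf) measurable
  also have "\<dots> = (\<Sum>k. ennreal (R.vertex \<alpha> \<beta> x k 0))"
  proof (intro suminf_cong)
    fix k
    have "(\<integral>\<^sup>+ \<omega>. ennreal (1 / fact k) * (\<integral>\<^sup>+ \<zeta>. ?h k \<zeta> \<omega> \<partial>lborel) \<partial>M) =
        ennreal (1 / fact k) * (\<integral>\<^sup>+ \<omega>. (\<integral>\<^sup>+ \<zeta>. ?h k \<zeta> \<omega> \<partial>lborel) \<partial>M)"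
      by (rule nn_integral_cmult) measurable
    also have "\<dots> = ennreal (1 / fact k) * ennreal (fact k * R.vertex \<alpha> \<beta> x k 0)"
      by (simp only: inverse_time_moments[OF \<alpha> \<beta>])
    also have "\<dots> = ennreal (R.vertex \<alpha> \<beta> x k 0)"
      using \<alpha> \<beta> R.vertex_nonneg[of \<alpha> \<beta> x k 0] by (subst ennreal_mult[symmetric]) auto
    finally show "(\<integral>\<^sup>+ \<omega>. ennreal (1 / fact k) * (\<integral>\<^sup>+ \<zeta>. ?h k \<zeta> \<omega> \<partial>lborel) \<partial>M) = ennreal (R.vertex \<alpha> \<beta> x k 0)" .
  qed
  also have "\<dots> = ennreal (1 / ((1 / R.u 0 - R.rate x \<beta>) - \<alpha>))"
    using R.vertex_sums(1)[OF less_imp_le[OF \<alpha>] \<beta> small x] R.vertex_nonneg[of \<alpha> \<beta> x] \<alpha> \<beta>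
    by (subst suminf_ennreal2) (auto simp: sums_iff)
  finally show ?thesis .
qed

end

end

section \<open>Moments at inverse local times\<close>

text \<open>Subtracting 1 keeps the bound small for small \<open>y\<close>. In its use below the
  expectation of the right-hand side is then of order \<zeta> for small levels, as the factor
  \<open>max \<zeta> (\<zeta> powr p)\<close> demands.\<close>

lemma powr_le_exp_minus_one:
  fixes y p :: real
  assumes y: "0 \<le> y" and p: "1 \<le> p"
  shows "y powr p \<le> fact (nat \<lceil>p\<rceil>) * (exp y - 1)"
proof -
  define n where "n = nat \<lceil>p\<rceil>"
  have n: "1 \<le> n" "p \<le> real n" using p by (auto simp: n_def le_nat_iff one_le_ceiling)
  have f: "1 \<le> (fact n :: real)" by (rule fact_ge_1)
  have e: "0 \<le> exp y - 1" "y \<le> exp y - 1" using y exp_ge_add_one_self[of y] by linarith+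
  show ?thesis
  proof (cases "y \<le> 1")
    case True
    have "y powr p \<le> y powr 1" using y True p by (intro powr_mono') auto
    also have "\<dots> \<le> exp y - 1" using e y by simp
    also have "\<dots> \<le> fact n * (exp y - 1)" using f e(1) by (simp add: mult_le_cancel_right1)
    finally show ?thesis by (simp add: n_def)
  next
    case False
    have "y powr p \<le> y powr real n" using False n by (intro powr_mono) auto
    also have "\<dots> = fact n * (y ^ n / fact n)" using False by (simp add: powr_realpow)
    also have "\<dots> \<le> fact n * (exp y - 1)"
    proof (intro mult_left_mono)
      have s: "(\<lambda>i. y ^ i / fact i) sums exp y"
        using exp_converges[of y] by (simp add: field_simps)
      \<comment> \<open>Keeping the terms 0 and \<open>n\<close> of the series, distinct as
        \<open>n\<close> is positive, leaves the \<open>n\<close>-th one below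
        \<open>exp y - 1\<close>.\<close>
      have "(\<Sum>i\<in>{0, n}. y ^ i / fact i) \<le> exp y"
        using sum_le_suminf[OF sums_summable[OF s], of "{0, n}"] sums_unique[OF s] y by auto
      then show "y ^ n / fact n \<le> exp y - 1" using n by simp
    qed simp
    finally show ?thesis by (simp add: n_def)
  qed
qed

context local_time_process
begin

abbreviation Y :: "real \<Rightarrow> real \<Rightarrow> 'a \<Rightarrow> real" where "Y x \<zeta> \<omega> \<equiv> LT x (TT \<zeta> \<omega>) \<omega>"

definition weighted :: "real \<Rightarrow> real \<Rightarrow> 'a measure" where
  "weighted q \<zeta> = density M (\<lambda>\<omega>. if reach \<zeta> \<omega> then ennreal (exp (- q * TT \<zeta> \<omega>)) else 0)"

lemma sets_weighted [simp, measurable_cong]: "sets (weighted q \<zeta>) = sets M"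
  by (simp add: weighted_def)

lemma nn_integral_weighted:
  assumes [measurable]: "f \<in> borel_measurable M"
  shows "(\<integral>\<^sup>+ \<omega>. f \<omega> \<partial>weighted q \<zeta>) = (\<integral>\<^sup>+ \<omega>. (if reach \<zeta> \<omega> then ennreal (exp (- q * TT \<zeta> \<omega>)) * f \<omega> else 0) \<partial>M)"
proof -
  have "(\<integral>\<^sup>+ \<omega>. f \<omega> \<partial>weighted q \<zeta>) = (\<integral>\<^sup>+ \<omega>. (if reach \<zeta> \<omega> then ennreal (exp (- q * TT \<zeta> \<omega>)) else 0) * f \<omega> \<partial>M)"
    unfolding weighted_def by (rule nn_integral_density) measurable
  then show ?thesis by (simp add: if_distrib[of "\<lambda>x. x * _"] cong: if_cong)
qed

lemma reach_anti: "reach \<zeta>' \<omega> \<Longrightarrow> \<zeta> \<le> \<zeta>' \<Longrightarrow> reach \<zeta> \<omega>"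
  unfolding reach_def by (auto intro: order_trans)

context
  fixes q :: real
  assumes q: "0 < q"
begin

interpretation R: resolvent b c \<nu> W q "resolvent_measure q"
  by (rule resolvent_locale[OF q])

text \<open>For fixed \<beta> both sides are functions of the level with the same Laplace transform,
  its variable being \<open>- \<alpha>\<close>. The exceptional null set of levels depends on
  \<beta>.\<close>

lemma exp_moment_AE:
  assumes \<beta>: "0 \<le> \<beta>" "\<beta> * R.u 0 < 1" and x: "0 \<le> x"
  shows "AE \<zeta> in lborel. 0 < \<zeta> \<longrightarrow>
    (\<integral>\<^sup>+ \<omega>. ennreal (exp (\<beta> * Y x \<zeta> \<omega>)) \<partial>weighted q \<zeta>) = ennreal (exp (- (1 / R.u 0 - R.rate x \<beta>) * \<zeta>))"
proof -
  define \<kappa> where "\<kappa> = 1 / R.u 0 - R.rate x \<beta>"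
  define h where "h \<zeta> \<omega> = (if 0 < \<zeta> \<and> reach \<zeta> \<omega> then ennreal (exp (- q * TT \<zeta> \<omega>)) * ennreal (exp (\<beta> * Y x \<zeta> \<omega>)) else 0)" for \<zeta> \<omega>
  define f where "f \<zeta> = (\<integral>\<^sup>+ \<omega>. h \<zeta> \<omega> \<partial>M)" for \<zeta>
  define g where "g \<zeta> = (if 0 < \<zeta> then ennreal (exp (- \<kappa> * \<zeta>)) else 0)" for \<zeta>
  have [measurable]: "(\<lambda>p. h (fst p) (snd p)) \<in> borel_measurable (borel \<Otimes>\<^sub>M M)"
    unfolding h_def by measurable
  have [measurable]: "f \<in> borel_measurable borel" "g \<in> borel_measurable borel"
    unfolding f_def g_def h_def by measurable
  \<comment> \<open>The bound that \<open>(\<alpha> + \<beta>) * u 0 < 1\<close> puts on \<alpha>;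
    the transforms are compared on the interval from \<open>- \<alpha>0\<close> to 0.\<close>
  define \<alpha>0 where "\<alpha>0 = 1 / R.u 0 - \<beta>"
  have \<alpha>0: "0 < \<alpha>0" using \<beta> R.u0_pos by (simp add: \<alpha>0_def field_simps)
  have small: "(\<alpha> + \<beta>) * R.u 0 < 1" if "\<alpha> < \<alpha>0" for \<alpha>
    using that R.u0_pos by (simp add: \<alpha>0_def field_simps)
  have f_transf: "(\<integral>\<^sup>+ \<zeta>. ennreal (exp (- l * \<zeta>)) \<partial>density lborel f) = ennreal (1 / (\<kappa> - (- l)))" if l: "- \<alpha>0 < l" "l < 0" for l
  proof -
    have "(\<integral>\<^sup>+ \<zeta>. ennreal (exp (- l * \<zeta>)) \<partial>density lborel f) = (\<integral>\<^sup>+ \<zeta>. f \<zeta> * ennreal (exp (- l * \<zeta>)) \<partial>lborel)"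
      by (rule nn_integral_density) measurable
    also have "\<dots> = (\<integral>\<^sup>+ \<zeta>. (\<integral>\<^sup>+ \<omega>. h \<zeta> \<omega> * ennreal (exp (- l * \<zeta>)) \<partial>M) \<partial>lborel)"
      unfolding f_def h_def by (intro nn_integral_cong nn_integral_multc[symmetric]) measurable
    also have "\<dots> = (\<integral>\<^sup>+ \<omega>. (\<integral>\<^sup>+ \<zeta>. h \<zeta> \<omega> * ennreal (exp (- l * \<zeta>)) \<partial>lborel) \<partial>M)"
    proof -
      interpret P: pair_sigma_finite lborel M ..
      show ?thesis unfolding h_def by (rule P.Fubini'[symmetric]) measurable
    qed
    also have "\<dots> = (\<integral>\<^sup>+ \<omega>. (\<integral>\<^sup>+ \<zeta>. (if 0 < \<zeta> \<and> reach \<zeta> \<omega> then ennreal (exp (- q * TT \<zeta> \<omega>)) *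
        ennreal (exp ((- l) * \<zeta> + \<beta> * LT x (TT \<zeta> \<omega>) \<omega>)) else 0) \<partial>lborel) \<partial>M)"
    proof (intro nn_integral_cong)
      fix \<omega> and \<zeta> :: real
      have "ennreal (exp (\<beta> * Y x \<zeta> \<omega>)) * ennreal (exp (- l * \<zeta>)) = ennreal (exp ((- l) * \<zeta> + \<beta> * LT x (TT \<zeta> \<omega>) \<omega>))"
        by (simp add: ennreal_mult'[symmetric] exp_add[symmetric])
      then show "h \<zeta> \<omega> * ennreal (exp (- l * \<zeta>)) = (if 0 < \<zeta> \<and> reach \<zeta> \<omega> then ennreal (exp (- q * TT \<zeta> \<omega>)) *
          ennreal (exp ((- l) * \<zeta> + \<beta> * LT x (TT \<zeta> \<omega>) \<omega>)) else 0)"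
        by (simp add: h_def mult.assoc)
    qed
    also have "\<dots> = ennreal (1 / (\<kappa> - (- l)))"
      unfolding \<kappa>_def using l small[of "- l"] by (intro inverse_time_transform q \<beta> x) auto
    finally show ?thesis .
  qed
  have g_transf: "(\<integral>\<^sup>+ \<zeta>. ennreal (exp (- l * \<zeta>)) \<partial>density lborel g) = ennreal (1 / (\<kappa> - (- l)))" if l: "- \<alpha>0 < l" "l < 0" for l
  proof -
    have "- l < \<kappa>"
      unfolding \<kappa>_def using l small[of "- l"] by (intro R.vertex_sums(2) \<beta> x) auto
    then have pos: "0 < \<kappa> + l" by simp
    have "(\<integral>\<^sup>+ \<zeta>. ennreal (exp (- l * \<zeta>)) \<partial>density lborel g) = (\<integral>\<^sup>+ \<zeta>. g \<zeta> * ennreal (exp (- l * \<zeta>)) \<partial>lborel)"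
      by (rule nn_integral_density) measurable
    also have "\<dots> = (\<integral>\<^sup>+ \<zeta>. ennreal (exp (- (\<kappa> + l) * \<zeta>)) * indicator {0..} \<zeta> \<partial>lborel)"
    proof (intro nn_integral_cong_AE)
      show "AE \<zeta> in lborel. g \<zeta> * ennreal (exp (- l * \<zeta>)) = ennreal (exp (- (\<kappa> + l) * \<zeta>)) * indicator {0..} \<zeta>"
        using AE_lborel_singleton[of 0]
      proof eventually_elim
        case (elim \<zeta>)
        have "exp (- \<kappa> * \<zeta>) * exp (- l * \<zeta>) = exp (- (\<kappa> + l) * \<zeta>)"
          by (simp add: exp_add[symmetric] algebra_simps)
        then show ?case using elim by (auto simp: g_def indicator_def ennreal_mult'[symmetric])
      qed
    qed
    also have "\<dots> = ennreal (1 / (\<kappa> + l))" by (rule nn_integral_exp_decay[OF pos])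
    finally show ?thesis by simp
  qed
  have "density lborel f = density lborel g"
  proof (rule laplace_transform_unique[of _ _ "- \<alpha>0" 0])
    fix l assume l: "- \<alpha>0 < l" "l < 0"
    show "(\<integral>\<^sup>+ \<zeta>. ennreal (exp (- l * \<zeta>)) \<partial>density lborel f) < \<infinity>"
      unfolding f_transf[OF l] by simp
    show "(\<integral>\<^sup>+ \<zeta>. ennreal (exp (- l * \<zeta>)) \<partial>density lborel f) = (\<integral>\<^sup>+ \<zeta>. ennreal (exp (- l * \<zeta>)) \<partial>density lborel g)"
      unfolding f_transf[OF l] g_transf[OF l] ..
  qed (use \<alpha>0 in auto)
  then have "AE \<zeta> in lborel. f \<zeta> = g \<zeta>"
    by (subst (asm) sigma_finite_measure.density_unique_iff[OF sigma_finite_lborel]) auto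
  then show ?thesis
  proof eventually_elim
    case (elim \<zeta>)
    show ?case
    proof
      assume "0 < \<zeta>"
      have "(\<integral>\<^sup>+ \<omega>. ennreal (exp (\<beta> * Y x \<zeta> \<omega>)) \<partial>weighted q \<zeta>) =
          (\<integral>\<^sup>+ \<omega>. (if reach \<zeta> \<omega> then ennreal (exp (- q * TT \<zeta> \<omega>)) * ennreal (exp (\<beta> * Y x \<zeta> \<omega>)) else 0) \<partial>M)"
        by (rule nn_integral_weighted) measurable
      also have "\<dots> = f \<zeta>" using \<open>0 < \<zeta>\<close> by (simp add: f_def h_def)
      finally show "(\<integral>\<^sup>+ \<omega>. ennreal (exp (\<beta> * Y x \<zeta> \<omega>)) \<partial>weighted q \<zeta>) = ennreal (exp (- (1 / R.u 0 - R.rate x \<beta>) * \<zeta>))"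
        using elim \<open>0 < \<zeta>\<close> by (simp add: g_def \<kappa>_def)
    qed
  qed
qed

lemma rate_zero: "R.rate x 0 = 0"
  by (simp add: R.rate_def)

text \<open>Countably many exponents \<open>t j\<close> share one null set of levels; off it,
  analytic continuation reaches every \<open>s\<close> before the pole of the exponent at
  \<open>1 / scl x\<close>. The radius \<open>1 / u 0\<close> is thereby replaced by one that can be
  bounded below independently of \<open>q\<close>.\<close>

lemma exp_moment_AE_all:
  assumes x: "0 \<le> x"
  shows "AE \<zeta> in lborel. 0 < \<zeta> \<longrightarrow> (\<forall>s. 0 \<le> s \<and> s * R.scl x < 1 \<longrightarrow>
    (\<integral>\<^sup>+ \<omega>. ennreal (exp (s * Y x \<zeta> \<omega>)) \<partial>weighted q \<zeta>) = ennreal (exp (- (1 / R.u 0 - R.rate x s) * \<zeta>)))"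
proof -
  \<comment> \<open>Chosen so that \<open>t j * u 0 < 1\<close>, the range of
    \<open>exp_moment_AE\<close>, and \<open>t j < 1\<close>, which serves the case without a pole
    below.\<close>
  define t where "t j = 1 / (R.u 0 + 1 + real j)" for j :: nat
  have t_pos: "0 < t j" for j using R.u0_pos by (simp add: t_def)
  have t_u: "t j * R.u 0 < 1" for j using R.u0_pos by (simp add: t_def field_simps)
  have t_1: "t j < 1" for j using R.u0_pos by (simp add: t_def field_simps)
  have "(\<lambda>j. 1 / (C + real j)) \<longlonglongrightarrow> 0" if "0 < C" for C :: real
    using that by real_asymp
  then have t_lim: "t \<longlonglongrightarrow> 0" unfolding t_def using R.u0_pos by simp
  have scl: "0 \<le> R.scl x" "R.scl x \<le> R.u 0" using R.scl_bounds[OF x] by auto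
  have "AE \<zeta> in lborel. \<forall>j. 0 < \<zeta> \<longrightarrow>
    (\<integral>\<^sup>+ \<omega>. ennreal (exp (t j * Y x \<zeta> \<omega>)) \<partial>weighted q \<zeta>) = ennreal (exp (- (1 / R.u 0 - R.rate x (t j)) * \<zeta>))"
    unfolding AE_all_countable using t_pos t_u by (intro allI exp_moment_AE x) (auto intro: less_imp_le)
  \<comment> \<open>The exponent 0 is treated separately, since continuation concerns positive
    exponents; it yields the mass of the weighted measure.\<close>
  moreover have "AE \<zeta> in lborel. 0 < \<zeta> \<longrightarrow>
    (\<integral>\<^sup>+ \<omega>. ennreal (exp (0 * Y x \<zeta> \<omega>)) \<partial>weighted q \<zeta>) = ennreal (exp (- (1 / R.u 0 - R.rate x 0) * \<zeta>))"
    by (rule exp_moment_AE[OF _ _ x]) auto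
  ultimately show ?thesis
  proof eventually_elim
    case (elim \<zeta>)
    show ?case
    proof (intro impI allI, elim conjE)
      fix s :: real assume \<zeta>: "0 < \<zeta>" and s: "0 \<le> s" "s * R.scl x < 1"
      show "(\<integral>\<^sup>+ \<omega>. ennreal (exp (s * Y x \<zeta> \<omega>)) \<partial>weighted q \<zeta>) = ennreal (exp (- (1 / R.u 0 - R.rate x s) * \<zeta>))"
      proof (cases "s = 0")
        case True
        then show ?thesis using elim(2) \<zeta> by simp
      next
        case False
        \<comment> \<open>Without a pole \<open>g\<close> is entire, and \<open>s + 1\<close>
          exceeds both \<open>s\<close> and every \<open>t j\<close>.\<close>
        define Rad where "Rad = (if R.scl x = 0 then s + 1 else 1 / R.scl x)"
        define g where "g w = exp (- complex_of_real \<zeta> * (1 / of_real (R.u 0) - of_real (R.ratio x) * w / (1 - w * of_real (R.scl x))))" for w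
        have rad: "r * R.scl x < 1" if "r < Rad" for r
          using that scl by (auto simp: Rad_def field_simps split: if_splits)
        show ?thesis
        proof (rule exp_moment_continuation[where g = g and R = Rad and t = t and G = "\<lambda>s. exp (- (1 / R.u 0 - R.rate x s) * \<zeta>)"])
          show "(\<lambda>\<omega>. Y x \<zeta> \<omega>) \<in> borel_measurable (weighted q \<zeta>)" by measurable
          show "0 \<le> Y x \<zeta> \<omega>" for \<omega> by (rule LT_nonneg)
          show "g holomorphic_on ball 0 Rad"
          proof -
            have "1 - w * complex_of_real (R.scl x) \<noteq> 0" if "w \<in> ball 0 Rad" for w
            proof
              assume "1 - w * complex_of_real (R.scl x) = 0"
              then have "norm (w * complex_of_real (R.scl x)) = 1" by simp
              moreover have "norm w * R.scl x < 1" using that by (intro rad) simp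
              ultimately show False using scl by (simp add: norm_mult)
            qed
            then show ?thesis unfolding g_def using R.u0_pos by (intro holomorphic_intros) auto
          qed
          show "t j < Rad" for j
          proof (cases "R.scl x = 0")
            case True
            then show ?thesis using t_1[of j] s by (simp add: Rad_def)
          next
            case False
            have "t j * R.scl x < 1" using mult_left_mono[OF scl(2) less_imp_le[OF t_pos[of j]]] t_u[of j] by linarith
            then show ?thesis using False scl by (simp add: Rad_def field_simps)
          qed
          show "(\<integral>\<^sup>+ \<omega>. ennreal (exp (t j * Y x \<zeta> \<omega>)) \<partial>weighted q \<zeta>) = ennreal (exp (- (1 / R.u 0 - R.rate x (t j)) * \<zeta>))" for j
            using elim(1) \<zeta> by blast
          show "g (of_real r) = of_real (exp (- (1 / R.u 0 - R.rate x r) * \<zeta>))" for r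
          proof -
            have "g (of_real r) = exp (of_real (- \<zeta> * (1 / R.u 0 - R.ratio x * r / (1 - r * R.scl x))))"
              unfolding g_def by simp
            also have "\<dots> = of_real (exp (- \<zeta> * (1 / R.u 0 - R.ratio x * r / (1 - r * R.scl x))))"
              by (rule exp_of_real)
            finally show ?thesis unfolding R.rate_def by (simp add: algebra_simps)
          qed
          show "0 < s" "s < Rad" using False s scl by (auto simp: Rad_def field_simps)
        qed (use t_pos t_lim in auto)
      qed
    qed
  qed
qed

text \<open>The factor \<open>exp (- \<zeta> / u 0)\<close>, the mass of the weighted measure, is
  kept apart: it carries all dependence on \<open>q\<close> and will be absorbed by the probability
  of reaching the level.\<close>

lemma power_moment_AE:
  assumes x: "0 \<le> x" and p: "1 \<le> p"
  shows "AE \<zeta> in lborel. 0 < \<zeta> \<longrightarrow>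
    (\<integral>\<^sup>+ \<omega>. ennreal (Y x \<zeta> \<omega> powr p) \<partial>weighted q \<zeta>) \<le>
      ennreal (4 * fact (nat \<lceil>p\<rceil>) * 2 powr (p - 1) * max \<zeta> (\<zeta> powr p) * (1 + 2 * W x) powr (p - 1) * exp (- \<zeta> / R.u 0)) \<and>
    (\<integral>\<^sup>+ \<omega>. 1 \<partial>weighted q \<zeta>) = ennreal (exp (- \<zeta> / R.u 0))"
  using exp_moment_AE_all[OF x]
proof eventually_elim
  case (elim \<zeta>)
  show ?case
  proof
    assume \<zeta>: "0 < \<zeta>"
    let ?N = "weighted q \<zeta>"
    define m where "m = R.scl x"
    have m: "0 \<le> m" "m \<le> 2 * W x" using R.scl_bounds[OF x] by (auto simp: m_def)
    define mx where "mx = max 1 \<zeta>"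
    have mx: "1 \<le> mx" "\<zeta> \<le> mx" by (auto simp: mx_def)
    \<comment> \<open>The exponent \<open>s = 1 / (2 * d)\<close> is then at most half the pole, so
      \<open>rate x s\<close> is at most \<open>2 * s\<close>, and \<open>2 * s * \<zeta>\<close> is
      at most 1, so \<open>exp r - 1\<close> is bounded by a multiple of
      \<open>s * \<zeta>\<close>.\<close>
    define d where "d = (1 + m) * mx"
    have d: "0 < d" "m \<le> d" "\<zeta> \<le> d"
    proof -
      show "0 < d" using m mx by (simp add: d_def)
      have "(1 + m) * 1 \<le> d" "1 * mx \<le> d" unfolding d_def using m mx by (auto intro!: mult_mono)
      then show "m \<le> d" "\<zeta> \<le> d" using mx by auto
    qed
    define s where "s = 1 / (2 * d)"
    have s: "0 < s" and sm: "s * m \<le> 1 / 2" and s\<zeta>: "2 * s * \<zeta> \<le> 1"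
      using d by (simp_all add: s_def field_simps)
    define r where "r = R.rate x s * \<zeta>"
    have rate: "0 \<le> R.rate x s" "R.rate x s \<le> 2 * s"
    proof -
      have d: "1 / 2 \<le> 1 - s * R.scl x" using sm by (simp add: m_def)
      then show "0 \<le> R.rate x s" using R.ratio_bounds(1)[of x] s by (simp add: R.rate_def)
      have "R.ratio x * s / (1 - s * R.scl x) \<le> 1 * s / (1 / 2)"
        using d s R.ratio_bounds[of x] by (intro frac_le mult_right_mono) auto
      then show "R.rate x s \<le> 2 * s" by (simp add: R.rate_def)
    qed
    have r: "0 \<le> r" "r \<le> 2 * s * \<zeta>" using rate \<zeta> by (auto simp: r_def)
    have "exp r \<le> 1 + r + r\<^sup>2" using r s\<zeta> by (intro exp_bound) auto
    moreover have "r\<^sup>2 \<le> r" using r s\<zeta> by (simp add: power2_eq_square mult_left_le)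
    ultimately have er: "exp r - 1 \<le> 4 * s * \<zeta>" using r by linarith
    have e0: "(\<integral>\<^sup>+ \<omega>. 1 \<partial>?N) = ennreal (exp (- \<zeta> / R.u 0))"
      using elim \<zeta> by (auto simp: rate_zero dest!: spec[of _ 0])
    have es: "(\<integral>\<^sup>+ \<omega>. ennreal (exp (s * Y x \<zeta> \<omega>)) \<partial>?N) = ennreal (exp (- \<zeta> / R.u 0) * exp r)"
    proof -
      have "(\<integral>\<^sup>+ \<omega>. ennreal (exp (s * Y x \<zeta> \<omega>)) \<partial>?N) = ennreal (exp (- (1 / R.u 0 - R.rate x s) * \<zeta>))"
        using elim \<zeta> s sm by (simp add: m_def)
      also have "exp (- (1 / R.u 0 - R.rate x s) * \<zeta>) = exp (- \<zeta> / R.u 0) * exp r"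
        by (simp add: r_def exp_add[symmetric] algebra_simps)
      finally show ?thesis .
    qed
    define I where "I = (\<integral>\<^sup>+ \<omega>. ennreal (exp (s * Y x \<zeta> \<omega>) - 1) \<partial>?N)"
    have "I + (\<integral>\<^sup>+ \<omega>. 1 \<partial>?N) = (\<integral>\<^sup>+ \<omega>. ennreal (exp (s * Y x \<zeta> \<omega>) - 1) + 1 \<partial>?N)"
      unfolding I_def by (rule nn_integral_add[symmetric]) measurable
    also have "\<dots> = (\<integral>\<^sup>+ \<omega>. ennreal (exp (s * Y x \<zeta> \<omega>)) \<partial>?N)"
    proof (intro nn_integral_cong)
      fix \<omega>
      have "ennreal (exp (s * Y x \<zeta> \<omega>) - 1 + 1) = ennreal (exp (s * Y x \<zeta> \<omega>) - 1) + ennreal 1"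
        using s LT_nonneg by (intro ennreal_plus) auto
      then show "ennreal (exp (s * Y x \<zeta> \<omega>) - 1) + 1 = ennreal (exp (s * Y x \<zeta> \<omega>))" by simp
    qed
    finally have "I + ennreal (exp (- \<zeta> / R.u 0)) = ennreal (exp (- \<zeta> / R.u 0) * exp r)"
      by (simp only: e0 es)
    then have "I = ennreal (exp (- \<zeta> / R.u 0) * exp r) - ennreal (exp (- \<zeta> / R.u 0))"
      by (metis ennreal_add_diff_cancel_right ennreal_neq_top)
    also have "\<dots> = ennreal (exp (- \<zeta> / R.u 0) * (exp r - 1))"
      by (subst ennreal_minus) (auto simp: algebra_simps)
    also have "\<dots> \<le> ennreal (exp (- \<zeta> / R.u 0) * (4 * s * \<zeta>))"
      by (intro ennreal_leI mult_left_mono er) auto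
    finally have I: "I \<le> ennreal (exp (- \<zeta> / R.u 0) * (4 * s * \<zeta>))" .
    define C where "C = s powr (- p) * fact (nat \<lceil>p\<rceil>)"
    have C: "0 \<le> C" by (simp add: C_def)
    have "(\<integral>\<^sup>+ \<omega>. ennreal (Y x \<zeta> \<omega> powr p) \<partial>?N) \<le> (\<integral>\<^sup>+ \<omega>. ennreal C * ennreal (exp (s * Y x \<zeta> \<omega>) - 1) \<partial>?N)"
    proof (intro nn_integral_mono)
      fix \<omega>
      have y: "0 \<le> Y x \<zeta> \<omega>" by (rule LT_nonneg)
      have "Y x \<zeta> \<omega> powr p = s powr (- p) * (s * Y x \<zeta> \<omega>) powr p"
        using s y by (simp add: powr_mult powr_minus field_simps)
      also have "\<dots> \<le> s powr (- p) * (fact (nat \<lceil>p\<rceil>) * (exp (s * Y x \<zeta> \<omega>) - 1))"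
        using s y p by (intro mult_left_mono powr_le_exp_minus_one) auto
      finally have "Y x \<zeta> \<omega> powr p \<le> C * (exp (s * Y x \<zeta> \<omega>) - 1)" by (simp add: C_def)
      then show "ennreal (Y x \<zeta> \<omega> powr p) \<le> ennreal C * ennreal (exp (s * Y x \<zeta> \<omega>) - 1)"
        using C by (simp add: ennreal_mult'[symmetric] ennreal_leI)
    qed
    also have "\<dots> = ennreal C * I" unfolding I_def by (rule nn_integral_cmult) measurable
    also have "\<dots> \<le> ennreal C * ennreal (exp (- \<zeta> / R.u 0) * (4 * s * \<zeta>))" by (intro mult_left_mono I) simp
    also have "\<dots> = ennreal (C * (exp (- \<zeta> / R.u 0) * (4 * s * \<zeta>)))" using C by (simp add: ennreal_mult')
    also have "\<dots> \<le> ennreal (4 * fact (nat \<lceil>p\<rceil>) * 2 powr (p - 1) * max \<zeta> (\<zeta> powr p) * (1 + 2 * W x) powr (p - 1) * exp (- \<zeta> / R.u 0))"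
    proof (rule ennreal_leI)
      \<comment> \<open>Rescaling by \<open>s\<close> costs \<open>s powr (- p)\<close>; the factor
        \<open>s\<close> gained from \<open>exp r - 1\<close> lowers the resulting power of
        \<open>d\<close> to \<open>p - 1\<close>.\<close>
      have "s powr (- p) * s = s powr (1 - p)" using s by (simp add: powr_diff powr_minus field_simps)
      also have "\<dots> = (2 * d) powr (p - 1)"
        using d by (simp add: s_def powr_divide powr_diff field_simps)
      also have "\<dots> = 2 powr (p - 1) * (1 + m) powr (p - 1) * mx powr (p - 1)"
        using m mx by (simp add: d_def powr_mult)
      finally have ss: "s powr (- p) * s = 2 powr (p - 1) * (1 + m) powr (p - 1) * mx powr (p - 1)" .
      have mm: "(1 + m) powr (p - 1) \<le> (1 + 2 * W x) powr (p - 1)" using m p by (intro powr_mono2) auto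
      have mz: "mx powr (p - 1) * \<zeta> \<le> max \<zeta> (\<zeta> powr p)"
      proof (cases "\<zeta> \<le> 1")
        case True then show ?thesis by (simp add: mx_def)
      next
        case False
        then have "mx powr (p - 1) * \<zeta> = \<zeta> powr p" by (simp add: mx_def powr_diff)
        then show ?thesis by simp
      qed
      have "C * (exp (- \<zeta> / R.u 0) * (4 * s * \<zeta>)) = 4 * fact (nat \<lceil>p\<rceil>) * (s powr (- p) * s) * \<zeta> * exp (- \<zeta> / R.u 0)"
        by (simp add: C_def)
      also have "\<dots> = 4 * fact (nat \<lceil>p\<rceil>) * 2 powr (p - 1) * (mx powr (p - 1) * \<zeta>) * (1 + m) powr (p - 1) * exp (- \<zeta> / R.u 0)"
        unfolding ss by (simp only: mult_ac)
      also have "\<dots> \<le> 4 * fact (nat \<lceil>p\<rceil>) * 2 powr (p - 1) * max \<zeta> (\<zeta> powr p) * (1 + 2 * W x) powr (p - 1) * exp (- \<zeta> / R.u 0)"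
        using mz mm \<zeta> by (intro mult_right_mono mult_mono mult_left_mono) auto
      finally show "C * (exp (- \<zeta> / R.u 0) * (4 * s * \<zeta>)) \<le>
        4 * fact (nat \<lceil>p\<rceil>) * 2 powr (p - 1) * max \<zeta> (\<zeta> powr p) * (1 + 2 * W x) powr (p - 1) * exp (- \<zeta> / R.u 0)" .
    qed
    finally show "(\<integral>\<^sup>+ \<omega>. ennreal (Y x \<zeta> \<omega> powr p) \<partial>?N) \<le>
      ennreal (4 * fact (nat \<lceil>p\<rceil>) * 2 powr (p - 1) * max \<zeta> (\<zeta> powr p) * (1 + 2 * W x) powr (p - 1) * exp (- \<zeta> / R.u 0)) \<and>
      (\<integral>\<^sup>+ \<omega>. 1 \<partial>?N) = ennreal (exp (- \<zeta> / R.u 0))"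
      using e0 by blast
  qed
qed

text \<open>The good levels are taken above \<zeta>, because reaching a higher level implies
  reaching \<zeta>; the discount is at most 1.\<close>

lemma exp_le_reach_probability:
  assumes \<zeta>: "0 < \<zeta>"
  shows "ennreal (exp (- \<zeta> / R.u 0)) \<le> emeasure M {\<omega> \<in> space M. reach \<zeta> \<omega>}"
proof -
  have ae: "AE \<zeta> in lborel. 0 < \<zeta> \<longrightarrow> (\<integral>\<^sup>+ \<omega>. 1 \<partial>weighted q \<zeta>) = ennreal (exp (- \<zeta> / R.u 0))"
    using power_moment_AE[of 0 1] by auto
  obtain s where s: "\<And>n. 0 < s n \<longrightarrow> (\<integral>\<^sup>+ \<omega>. 1 \<partial>weighted q (s n)) = ennreal (exp (- s n / R.u 0))" "\<And>n. \<zeta> < s n" "s \<longlonglongrightarrow> \<zeta>"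
    by (rule AE_lborel_seq_above[OF ae, of \<zeta>]) blast
  have le: "ennreal (exp (- s n / R.u 0)) \<le> emeasure M {\<omega> \<in> space M. reach \<zeta> \<omega>}" for n
  proof -
    have "ennreal (exp (- s n / R.u 0)) = (\<integral>\<^sup>+ \<omega>. 1 \<partial>weighted q (s n))"
      using s(1,2)[of n] \<zeta> by simp
    also have "\<dots> = (\<integral>\<^sup>+ \<omega>. (if reach (s n) \<omega> then ennreal (exp (- q * TT (s n) \<omega>)) * 1 else 0) \<partial>M)"
      by (rule nn_integral_weighted) simp
    also have "\<dots> \<le> (\<integral>\<^sup>+ \<omega>. indicator {\<omega> \<in> space M. reach \<zeta> \<omega>} \<omega> \<partial>M)"
    proof (intro nn_integral_mono)
      fix \<omega> assume "\<omega> \<in> space M"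
      then show "(if reach (s n) \<omega> then ennreal (exp (- q * TT (s n) \<omega>)) * 1 else 0) \<le> indicator {\<omega> \<in> space M. reach \<zeta> \<omega>} \<omega>"
        using reach_anti[of "s n" \<omega> \<zeta>] s(2)[of n] TT(1)[of "s n" \<omega>] q by (auto simp: indicator_def)
    qed
    also have "\<dots> = emeasure M {\<omega> \<in> space M. reach \<zeta> \<omega>}" by (rule nn_integral_indicator) measurable
    finally show ?thesis .
  qed
  have "(\<lambda>n. ennreal (exp (- s n / R.u 0))) \<longlonglongrightarrow> ennreal (exp (- \<zeta> / R.u 0))"
    using R.u0_pos by (intro tendsto_ennrealI tendsto_exp tendsto_divide tendsto_minus s(3) tendsto_const) auto
  then show ?thesis by (rule LIMSEQ_le_const2) (use le in auto)
qed

text \<open>Here the good levels approach \<zeta> from below: the hitting times of a continuous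
  nondecreasing function are left-continuous in the level, so the integrands converge and Fatou's
  lemma applies.\<close>

lemma discounted_moment_le:
  assumes \<zeta>: "0 < \<zeta>" and x: "0 \<le> x" and p: "1 \<le> p"
  defines "K \<equiv> 4 * fact (nat \<lceil>p\<rceil>) * 2 powr (p - 1) * max \<zeta> (\<zeta> powr p) * (1 + 2 * W x) powr (p - 1)"
  shows "(\<integral>\<^sup>+ \<omega>. (if reach \<zeta> \<omega> then ennreal (exp (- q * TT \<zeta> \<omega>)) * ennreal (Y x \<zeta> \<omega> powr p) else 0) \<partial>M) \<le>
    ennreal K * emeasure M {\<omega> \<in> space M. reach \<zeta> \<omega>}"
proof -
  define B where "B z = 4 * fact (nat \<lceil>p\<rceil>) * 2 powr (p - 1) * max z (z powr p) * (1 + 2 * W x) powr (p - 1) * exp (- z / R.u 0)" for z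
  let ?h = "\<lambda>z \<omega>. (if reach z \<omega> then ennreal (exp (- q * TT z \<omega>)) * ennreal (Y x z \<omega> powr p) else 0)"
  have "AE z in lborel. 0 < z \<longrightarrow> (\<integral>\<^sup>+ \<omega>. ?h z \<omega> \<partial>M) \<le> ennreal (B z)"
    using power_moment_AE[OF x p]
  proof eventually_elim
    case (elim z)
    have "(\<integral>\<^sup>+ \<omega>. ennreal (Y x z \<omega> powr p) \<partial>weighted q z) = (\<integral>\<^sup>+ \<omega>. ?h z \<omega> \<partial>M)"
      by (rule nn_integral_weighted) measurable
    then show ?case using elim by (simp add: B_def)
  qed
  note ae = this
  obtain s where
    s: "\<And>n. 0 < s n \<longrightarrow> (\<integral>\<^sup>+ \<omega>. ?h (s n) \<omega> \<partial>M) \<le> ennreal (B (s n))" "\<And>n. s n < \<zeta>" "s \<longlonglongrightarrow> \<zeta>"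
    by (rule AE_lborel_seq_below[OF ae, of \<zeta>]) blast
  have conv: "(\<lambda>n. ?h (s n) \<omega>) \<longlonglongrightarrow> ?h \<zeta> \<omega>" if r: "reach \<zeta> \<omega>" for \<omega>
  proof -
    have rn: "reach (s n) \<omega>" for n using reach_anti[OF r] s(2)[of n] by (auto intro: less_imp_le)
    have T_lim: "(\<lambda>n. TT (s n) \<omega>) \<longlonglongrightarrow> TT \<zeta> \<omega>"
    proof (rule order_tendstoI)
      fix a assume a: "a < TT \<zeta> \<omega>"
      show "\<forall>\<^sub>F n in sequentially. a < TT (s n) \<omega>"
      proof (cases "a < 0")
        case True
        then show ?thesis using TT(1)[OF rn] by (intro always_eventually) (auto intro: less_le_trans)
      next
        case False
        then have "LT 0 a \<omega> < \<zeta>" using a TT(3)[OF r, of a] by (simp add: not_le[symmetric])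
        then have "\<forall>\<^sub>F n in sequentially. LT 0 a \<omega> < s n" using s(3) by (rule order_tendstoD(1)[rotated])
        then show ?thesis using False TT(3)[OF rn, of a] by (auto elim!: eventually_mono simp: not_le[symmetric])
      qed
    next
      fix a assume a: "TT \<zeta> \<omega> < a"
      have "TT (s n) \<omega> \<le> TT \<zeta> \<omega>" for n
        using TT(3)[OF rn, of "TT \<zeta> \<omega>" n] TT(1,2)[OF r] s(2)[of n] by auto
      then show "\<forall>\<^sub>F n in sequentially. TT (s n) \<omega> < a" using a by (intro always_eventually) (auto intro: le_less_trans)
    qed
    have "isCont (\<lambda>t. LT x t \<omega>) (TT \<zeta> \<omega>)"
      using LT_continuous[of UNIV x \<omega>] by (simp add: continuous_on_eq_continuous_at)
    then have Y_lim: "(\<lambda>n. Y x (s n) \<omega>) \<longlonglongrightarrow> Y x \<zeta> \<omega>" by (rule isCont_tendsto_compose[OF _ T_lim])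
    have "(\<lambda>n. Y x (s n) \<omega> powr p) \<longlonglongrightarrow> Y x \<zeta> \<omega> powr p"
      using p LT_nonneg by (intro tendsto_powr' Y_lim tendsto_const) auto
    then have "(\<lambda>n. ennreal (exp (- q * TT (s n) \<omega>)) * ennreal (Y x (s n) \<omega> powr p)) \<longlonglongrightarrow>
        ennreal (exp (- q * TT \<zeta> \<omega>)) * ennreal (Y x \<zeta> \<omega> powr p)"
      by (intro tendsto_mult_ennreal tendsto_ennrealI tendsto_exp tendsto_mult tendsto_const T_lim) auto
    then show ?thesis using r rn by simp
  qed
  have "(\<integral>\<^sup>+ \<omega>. ?h \<zeta> \<omega> \<partial>M) \<le> (\<integral>\<^sup>+ \<omega>. liminf (\<lambda>n. ?h (s n) \<omega>) \<partial>M)"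
  proof (intro nn_integral_mono)
    fix \<omega>
    show "?h \<zeta> \<omega> \<le> liminf (\<lambda>n. ?h (s n) \<omega>)"
    proof (cases "reach \<zeta> \<omega>")
      case True
      from lim_imp_Liminf[OF _ conv[OF True]] show ?thesis by simp
    qed simp
  qed
  also have "\<dots> \<le> liminf (\<lambda>n. \<integral>\<^sup>+ \<omega>. ?h (s n) \<omega> \<partial>M)"
    by (rule nn_integral_liminf) measurable
  also have "\<dots> \<le> liminf (\<lambda>n. ennreal (B (s n)))"
  proof (rule Liminf_mono)
    show "\<forall>\<^sub>F n in sequentially. (\<integral>\<^sup>+ \<omega>. ?h (s n) \<omega> \<partial>M) \<le> ennreal (B (s n))"
      using order_tendstoD(1)[OF s(3) \<zeta>] by eventually_elim (use s(1) in blast)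
  qed
  also have "\<dots> = ennreal (B \<zeta>)"
  proof (rule lim_imp_Liminf)
    show "(\<lambda>n. ennreal (B (s n))) \<longlonglongrightarrow> ennreal (B \<zeta>)"
      unfolding B_def using \<zeta> R.u0_pos
      by (intro tendsto_ennrealI tendsto_mult tendsto_const tendsto_max tendsto_powr tendsto_exp tendsto_divide tendsto_minus s(3)) auto
  qed simp
  also have "B \<zeta> = K * exp (- \<zeta> / R.u 0)" by (simp add: B_def K_def)
  also have "ennreal \<dots> = ennreal K * ennreal (exp (- \<zeta> / R.u 0))"
    using \<zeta> by (intro ennreal_mult) (auto simp: K_def)
  also have "\<dots> \<le> ennreal K * emeasure M {\<omega> \<in> space M. reach \<zeta> \<omega>}"
    by (intro mult_left_mono exp_le_reach_probability \<zeta>) simp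
  finally show ?thesis .
qed

end

lemma reach_probability_pos:
  assumes "0 < \<zeta>"
  shows "0 < emeasure M {\<omega> \<in> space M. reach \<zeta> \<omega>}"
  using exp_le_reach_probability[OF zero_less_one assms] by (rule less_le_trans[rotated]) simp

text \<open>\<open>K\<close> does not involve \<open>q\<close>, so Fatou's lemma along
  \<open>q = 1 / Suc n\<close> removes the discount.\<close>

lemma moment_le:
  assumes \<zeta>: "0 < \<zeta>" and x: "0 \<le> x" and p: "1 \<le> p"
  defines "K \<equiv> 4 * fact (nat \<lceil>p\<rceil>) * 2 powr (p - 1) * max \<zeta> (\<zeta> powr p) * (1 + 2 * W x) powr (p - 1)"
  shows "(\<integral>\<^sup>+ \<omega>. (if reach \<zeta> \<omega> then ennreal (Y x \<zeta> \<omega> powr p) else 0) \<partial>M) \<le>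
    ennreal K * emeasure M {\<omega> \<in> space M. reach \<zeta> \<omega>}"
proof -
  let ?h = "\<lambda>n \<omega>. (if reach \<zeta> \<omega> then ennreal (exp (- (1 / real (Suc n)) * TT \<zeta> \<omega>)) * ennreal (Y x \<zeta> \<omega> powr p) else 0)"
  have "(\<integral>\<^sup>+ \<omega>. (if reach \<zeta> \<omega> then ennreal (Y x \<zeta> \<omega> powr p) else 0) \<partial>M) = (\<integral>\<^sup>+ \<omega>. liminf (\<lambda>n. ?h n \<omega>) \<partial>M)"
  proof (intro nn_integral_cong)
    fix \<omega>
    have "(\<lambda>n. - (1 / real (Suc n)) * TT \<zeta> \<omega>) \<longlonglongrightarrow> - 0 * TT \<zeta> \<omega>"
      by (intro tendsto_mult tendsto_const tendsto_minus LIMSEQ_Suc[OF lim_1_over_n])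
    then have "(\<lambda>n. exp (- (1 / real (Suc n)) * TT \<zeta> \<omega>)) \<longlonglongrightarrow> exp (- 0 * TT \<zeta> \<omega>)"
      by (rule tendsto_exp)
    then have "(\<lambda>n. ennreal (exp (- (1 / real (Suc n)) * TT \<zeta> \<omega>)) * ennreal (Y x \<zeta> \<omega> powr p)) \<longlonglongrightarrow>
        ennreal (exp (- 0 * TT \<zeta> \<omega>)) * ennreal (Y x \<zeta> \<omega> powr p)"
      by (intro tendsto_mult_ennreal tendsto_ennrealI tendsto_const) auto
    then have "(\<lambda>n. ?h n \<omega>) \<longlonglongrightarrow> (if reach \<zeta> \<omega> then ennreal (Y x \<zeta> \<omega> powr p) else 0)"
      by (cases "reach \<zeta> \<omega>") simp_all
    from lim_imp_Liminf[OF _ this]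
    show "(if reach \<zeta> \<omega> then ennreal (Y x \<zeta> \<omega> powr p) else 0) = liminf (\<lambda>n. ?h n \<omega>)" by simp
  qed
  also have "\<dots> \<le> liminf (\<lambda>n. \<integral>\<^sup>+ \<omega>. ?h n \<omega> \<partial>M)"
    by (rule nn_integral_liminf) measurable
  also have "\<dots> \<le> liminf (\<lambda>n. ennreal K * emeasure M {\<omega> \<in> space M. reach \<zeta> \<omega>})"
    unfolding K_def by (intro Liminf_mono always_eventually allI discounted_moment_le \<zeta> x p) simp
  also have "\<dots> = ennreal K * emeasure M {\<omega> \<in> space M. reach \<zeta> \<omega>}"
    by (rule Liminf_const) simp
  finally show ?thesis .
qed

end

section \<open>Conditioning on a finite inverse local time\<close>

context local_time_process
begin

lemma inverse_local_time_eq: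
  assumes \<zeta>: "0 < \<zeta>" and L: "\<And>s. 0 \<le> s \<Longrightarrow> L 0 s \<omega> = LT 0 s \<omega>"
  shows "inverse_local_time L \<zeta> \<omega> = (if reach \<zeta> \<omega> then ereal (TT \<zeta> \<omega>) else \<infinity>)"
proof (cases "reach \<zeta> \<omega>")
  case True
  note T = TT[OF True]
  let ?S = "{s. 0 \<le> s \<and> \<zeta> \<le> L 0 s \<omega>}"
  have mem: "TT \<zeta> \<omega> \<in> ?S" using T(1,2) L by simp
  have "ereal \<zeta> \<le> ereal (L 0 (TT \<zeta> \<omega>) \<omega>)" using mem by simp
  also have "\<dots> \<le> (SUP s\<in>{0..}. ereal (L 0 s \<omega>))" using T(1) by (intro SUP_upper) simp
  finally have "ereal \<zeta> \<le> (SUP s\<in>{0..}. ereal (L 0 s \<omega>))" .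
  moreover have "Inf (ereal ` ?S) = ereal (TT \<zeta> \<omega>)"
  proof (rule antisym)
    show "Inf (ereal ` ?S) \<le> ereal (TT \<zeta> \<omega>)" using mem by (intro Inf_lower) blast
    show "ereal (TT \<zeta> \<omega>) \<le> Inf (ereal ` ?S)" using T(3) L by (intro Inf_greatest) auto
  qed
  ultimately show ?thesis using True by (simp add: inverse_local_time_def)
next
  case False
  then have empty: "{s. 0 \<le> s \<and> \<zeta> \<le> L 0 s \<omega>} = {}" using reachI[of \<zeta> _ \<omega>] L by auto
  show ?thesis unfolding inverse_local_time_def empty using False by (simp add: top_ereal_def)
qed

text \<open>The conditioning event is defined from \<open>L\<close> and agrees with an event of
  \<open>M\<close> on \<open>G\<close>; off \<open>G\<close> it may be any subset of a null
  set.\<close>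

lemma completion_sets_cong:
  assumes "A \<in> sets M" "E \<subseteq> space M" "\<And>\<omega>. \<omega> \<in> G \<Longrightarrow> \<omega> \<in> E \<longleftrightarrow> \<omega> \<in> A"
  shows "E \<in> sets (completion M)"
proof -
  have "space M - G \<in> null_sets M"
  proof (rule AE_iff_null_sets[THEN iffD2])
    show "AE \<omega> in M. \<omega> \<notin> space M - G" using G_AE by eventually_elim auto
  qed measurable
  then have "space M - G \<in> null_sets (completion M)" by (rule null_sets_completionI)
  then have "E - G \<in> null_sets (completion M)"
    by (rule null_sets_completion_subset[rotated]) (use assms(2) in auto)
  then have "E - G \<in> sets (completion M)" by auto
  moreover have "E = (A \<inter> G) \<union> (E - G)" using assms(3) by auto
  moreover have "A \<inter> G \<in> sets (completion M)" using assms(1) by (intro sets_completionI_sets) auto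
  ultimately show ?thesis by (metis sets.Un)
qed

text \<open>At level 0 the inverse local time is 0 and the local times have not started. The bound
  to be proved is 0 there too, so this case needs an exact value.\<close>

lemma conditioned_moment_zero:
  assumes L: "\<And>\<omega> x t. \<omega> \<in> G \<Longrightarrow> 0 \<le> t \<Longrightarrow> L x t \<omega> = ell x t \<omega>"
  shows "(\<integral>\<^sup>+ \<omega>. ennreal (\<bar>stopped_local_time L 0 x \<omega>\<bar> powr p) \<partial>conditioned_measure M L 0) = 0"
proof -
  let ?E = "{\<omega> \<in> space M. inverse_local_time L 0 \<omega> < \<infinity>}"
  have L': "L x t \<omega> = LT x t \<omega>" if "\<omega> \<in> G" "0 \<le> t" for \<omega> x t
    using L[OF that] that by (simp add: LT_def)
  have inv: "inverse_local_time L 0 \<omega> = 0" if \<omega>: "\<omega> \<in> G" for \<omega>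
  proof -
    let ?S = "{s. 0 \<le> s \<and> 0 \<le> L 0 s \<omega>}"
    have mem: "0 \<in> ?S" using L'[OF \<omega>, of 0 0] LT_zero by simp
    have "ereal 0 \<le> ereal (L 0 0 \<omega>)" using mem by simp
    also have "\<dots> \<le> (SUP s\<in>{0..}. ereal (L 0 s \<omega>))" by (intro SUP_upper) simp
    finally have "ereal 0 \<le> (SUP s\<in>{0..}. ereal (L 0 s \<omega>))" .
    moreover have "Inf (ereal ` ?S) = ereal 0"
    proof (rule antisym)
      show "Inf (ereal ` ?S) \<le> ereal 0" using mem by (intro Inf_lower) blast
      show "ereal 0 \<le> Inf (ereal ` ?S)" by (intro Inf_greatest) auto
    qed
    ultimately show ?thesis by (simp add: inverse_local_time_def zero_ereal_def)
  qed
  have E_sets: "?E \<in> sets (completion M)"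
    using inv G_space by (intro completion_sets_cong[of "space M"]) auto
  have "AE \<omega> in completion M. \<omega> \<in> G" using G_AE by (rule AE_completion)
  then have "AE \<omega> in completion M. \<omega> \<in> ?E \<longrightarrow> ennreal (\<bar>stopped_local_time L 0 x \<omega>\<bar> powr p) = 0"
    by eventually_elim (simp add: stopped_local_time_def inv L' LT_zero)
  then have "AE \<omega> in conditioned_measure M L 0. ennreal (\<bar>stopped_local_time L 0 x \<omega>\<bar> powr p) = 0"
    unfolding conditioned_measure_def by (intro AE_uniform_measureI E_sets)
  then have "(\<integral>\<^sup>+ \<omega>. ennreal (\<bar>stopped_local_time L 0 x \<omega>\<bar> powr p) \<partial>conditioned_measure M L 0) =
      (\<integral>\<^sup>+ \<omega>. 0 \<partial>conditioned_measure M L 0)"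
    by (intro nn_integral_cong_AE)
  then show ?thesis by simp
qed

lemma conditioned_moment_le:
  assumes L: "\<And>\<omega> x t. \<omega> \<in> G \<Longrightarrow> 0 \<le> t \<Longrightarrow> L x t \<omega> = ell x t \<omega>"
    and \<zeta>: "0 < \<zeta>" and x: "0 \<le> x" and p: "1 \<le> p"
  shows "(\<integral>\<^sup>+ \<omega>. ennreal (\<bar>stopped_local_time L \<zeta> x \<omega>\<bar> powr p) \<partial>conditioned_measure M L \<zeta>) \<le>
    ennreal (4 * fact (nat \<lceil>p\<rceil>) * 2 powr (p - 1) * max \<zeta> (\<zeta> powr p) * (1 + 2 * W x) powr (p - 1))"
proof -
  define K where "K = 4 * fact (nat \<lceil>p\<rceil>) * 2 powr (p - 1) * max \<zeta> (\<zeta> powr p) * (1 + 2 * W x) powr (p - 1)"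
  let ?E = "{\<omega> \<in> space M. inverse_local_time L \<zeta> \<omega> < \<infinity>}"
  let ?E' = "{\<omega> \<in> space M. reach \<zeta> \<omega>}"
  let ?g = "\<lambda>\<omega>. if reach \<zeta> \<omega> then ennreal (Y x \<zeta> \<omega> powr p) else 0"
  have [measurable]: "?E' \<in> sets M" by measurable
  have L': "L x t \<omega> = LT x t \<omega>" if "\<omega> \<in> G" "0 \<le> t" for \<omega> x t
    using L[OF that] that by (simp add: LT_def)
  have inv: "inverse_local_time L \<zeta> \<omega> = (if reach \<zeta> \<omega> then ereal (TT \<zeta> \<omega>) else \<infinity>)" if "\<omega> \<in> G" for \<omega>
    using L'[OF that] by (intro inverse_local_time_eq \<zeta>) auto
  have G_compl: "AE \<omega> in completion M. \<omega> \<in> G" using G_AE by (rule AE_completion)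
  have E_sets: "?E \<in> sets (completion M)"
    using inv by (intro completion_sets_cong[of ?E']) auto
  have E_eq: "emeasure (completion M) ?E = emeasure M ?E'"
  proof -
    have "emeasure (completion M) ?E = emeasure (completion M) ?E'"
    proof (rule emeasure_eq_AE)
      show "AE \<omega> in completion M. \<omega> \<in> ?E \<longleftrightarrow> \<omega> \<in> ?E'"
        using G_compl by eventually_elim (simp add: inv)
      show "?E \<in> sets (completion M)" by (rule E_sets)
      show "?E' \<in> sets (completion M)" by (intro sets_completionI_sets) auto
    qed
    also have "\<dots> = emeasure M ?E'" by simp
    finally show ?thesis .
  qed
  have P: "0 < emeasure M ?E'" "emeasure M ?E' < \<infinity>"
    using reach_probability_pos[OF \<zeta>] emeasure_finite[of ?E'] by (auto simp: less_top[symmetric])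
  have "(\<integral>\<^sup>+ \<omega>. ennreal (\<bar>stopped_local_time L \<zeta> x \<omega>\<bar> powr p) \<partial>conditioned_measure M L \<zeta>) =
      (\<integral>\<^sup>+ \<omega>. ?g \<omega> \<partial>conditioned_measure M L \<zeta>)"
  proof (intro nn_integral_cong_AE)
    have "AE \<omega> in completion M. \<omega> \<in> ?E \<longrightarrow> ennreal (\<bar>stopped_local_time L \<zeta> x \<omega>\<bar> powr p) = ?g \<omega>"
      using G_compl
    proof eventually_elim
      case (elim \<omega>)
      show ?case
      proof
        assume "\<omega> \<in> ?E"
        then have r: "reach \<zeta> \<omega>" using inv[OF elim] by (auto split: if_splits)
        then show "ennreal (\<bar>stopped_local_time L \<zeta> x \<omega>\<bar> powr p) = ?g \<omega>"
          using inv[OF elim] L'[OF elim TT(1)[OF r]] LT_nonneg by (simp add: stopped_local_time_def)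
      qed
    qed
    then show "AE \<omega> in conditioned_measure M L \<zeta>. ennreal (\<bar>stopped_local_time L \<zeta> x \<omega>\<bar> powr p) = ?g \<omega>"
      unfolding conditioned_measure_def by (intro AE_uniform_measureI E_sets)
  qed
  also have "\<dots> = (\<integral>\<^sup>+ \<omega>. ?g \<omega> * indicator ?E \<omega> \<partial>completion M) / emeasure (completion M) ?E"
    unfolding conditioned_measure_def
    by (rule nn_integral_uniform_measure[OF _ E_sets]) (intro measurable_completion, measurable)
  also have "\<dots> \<le> ennreal K * emeasure M ?E' / emeasure (completion M) ?E"
  proof (rule divide_right_mono_ennreal)
    have "(\<integral>\<^sup>+ \<omega>. ?g \<omega> * indicator ?E \<omega> \<partial>completion M) \<le> (\<integral>\<^sup>+ \<omega>. ?g \<omega> \<partial>completion M)"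
      by (intro nn_integral_mono) (auto simp: indicator_def)
    also have "\<dots> = (\<integral>\<^sup>+ \<omega>. ?g \<omega> \<partial>M)" by (rule nn_integral_completion)
    also have "\<dots> \<le> ennreal K * emeasure M ?E'"
      unfolding K_def by (rule moment_le[OF \<zeta> x p])
    finally show "(\<integral>\<^sup>+ \<omega>. ?g \<omega> * indicator ?E \<omega> \<partial>completion M) \<le> ennreal K * emeasure M ?E'" .
  qed
  \<comment> \<open>The probability of the conditioning event cancels; it is positive by
    \<open>reach_probability_pos\<close>.\<close>
  also have "\<dots> = ennreal K"
    unfolding E_eq using P by (intro ennreal_mult_divide_eq) auto
  finally show ?thesis by (simp add: K_def)
qed

end

section \<open>A jointly measurable version of the process\<close>

lemma cadlag_approx:
  assumes "cadlag g" "0 \<le> t"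
  shows "(\<lambda>n. g ((real_of_int \<lfloor>real (Suc n) * t\<rfloor> + 1) / real (Suc n))) \<longlonglongrightarrow> g t"
proof -
  let ?a = "\<lambda>n. (real_of_int \<lfloor>real (Suc n) * t\<rfloor> + 1) / real (Suc n)"
  \<comment> \<open>Adding 1 to the floor makes the grid point strictly larger than
    \<open>t\<close>, so that the right limit in \<open>cadlag\<close> applies.\<close>
  have gt: "t < ?a n" for n
  proof -
    have "real (Suc n) * t < \<lfloor>real (Suc n) * t\<rfloor> + 1" by linarith
    then show ?thesis by (simp add: field_simps)
  qed
  have le: "?a n \<le> t + 1 / real (Suc n)" for n
  proof -
    have "real_of_int \<lfloor>real (Suc n) * t\<rfloor> + 1 \<le> real (Suc n) * t + 1" by linarith
    then have "?a n \<le> (real (Suc n) * t + 1) / real (Suc n)" by (rule divide_right_mono) simp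
    also have "\<dots> = t + 1 / real (Suc n)" by (simp add: field_simps)
    finally show ?thesis .
  qed
  have "(\<lambda>n. t + 1 / real (Suc n)) \<longlonglongrightarrow> t + 0"
    by (intro tendsto_add tendsto_const LIMSEQ_Suc[OF lim_1_over_n])
  then have "?a \<longlonglongrightarrow> t"
    by (intro tendsto_sandwich[of "\<lambda>_. t" ?a sequentially "\<lambda>n. t + 1 / real (Suc n)" t] always_eventually allI)
      (use gt le in \<open>auto intro: less_imp_le\<close>)
  moreover have "\<forall>n. ?a n \<in> {t<..} \<and> ?a n \<noteq> t"
    using gt by (metis greaterThan_iff less_irrefl)
  ultimately have "filterlim ?a (at_right t) sequentially"
    unfolding filterlim_at by (intro conjI always_eventually)
  moreover have "(g \<longlongrightarrow> g t) (at_right t)" using assms by (simp add: cadlag_def)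
  ultimately show ?thesis by (rule filterlim_compose[rotated])
qed

text \<open>The version \<open>X\<close> is 0 off \<open>G\<close> and frozen before time 0, so
  every path is right-continuous and \<open>X\<close> is a limit of processes that are step
  functions of time. Laws of increments are unaffected, and independence is recovered from the joint
  law of the increments.\<close>

lemma local_time_processI:
  fixes M :: "'a measure"
  assumes "0 \<le> b" "0 < c" and sp: "spectrally_positive_levy M b c \<nu> \<xi>" and W: "scale_function b c \<nu> W"
    and L: "local_times M \<xi> L"
  obtains X G where "local_time_process M X b c \<nu> W L G"
proof -
  have jump: "jump_measure \<nu>" and levy: "levy_process M \<xi>"
    and lap: "\<And>t l. 0 \<le> t \<Longrightarrow> 0 \<le> l \<Longrightarrow> has_bochner_integral M (\<lambda>\<omega>. exp (- l * \<xi> t \<omega>)) (exp (t * laplace_exponent b c \<nu> l))"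
    using sp by (auto simp: spectrally_positive_levy_def)
  interpret prob_space M using levy by (simp add: levy_process_def)
  have \<xi>_meas: "\<xi> t \<in> borel_measurable M" if "0 \<le> t" for t using levy that by (simp add: levy_process_def)
  define good where "good \<omega> \<longleftrightarrow> cadlag (\<lambda>t. \<xi> t \<omega>) \<and>
    continuous_on (UNIV \<times> {0..}) (\<lambda>(x, t). L x t \<omega>) \<and>
    (\<forall>x. \<forall>t\<ge>0. 0 \<le> L x t \<omega>) \<and>
    (\<forall>t\<ge>0. \<forall>f::real \<Rightarrow> ennreal. f \<in> borel_measurable borel \<longrightarrow>
      (\<integral>\<^sup>+ r\<in>{0..t}. f (\<xi> r \<omega>) \<partial>lborel) = (\<integral>\<^sup>+ x. f x * ennreal (L x t \<omega>) \<partial>lborel))" for \<omega>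
  have "AE \<omega> in M. cadlag (\<lambda>t. \<xi> t \<omega>)" using levy by (simp add: levy_process_def)
  moreover have "AE \<omega> in M. continuous_on (UNIV \<times> {0..}) (\<lambda>(x, t). L x t \<omega>) \<and>
       (\<forall>x. \<forall>t\<ge>0. 0 \<le> L x t \<omega>) \<and>
       (\<forall>t\<ge>0. \<forall>f::real \<Rightarrow> ennreal. f \<in> borel_measurable borel \<longrightarrow>
          (\<integral>\<^sup>+ r\<in>{0..t}. f (\<xi> r \<omega>) \<partial>lborel) = (\<integral>\<^sup>+ x. f x * ennreal (L x t \<omega>) \<partial>lborel))"
    using L by (simp add: local_times_def)
  ultimately have "AE \<omega> in M. good \<omega>" by eventually_elim (simp add: good_def)
  \<comment> \<open>The good outcomes need not form a measurable set; a measurable null set covering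
    the others is removed.\<close>
  then obtain N where N: "{\<omega> \<in> space M. \<not> good \<omega>} \<subseteq> N" "emeasure M N = 0" "N \<in> sets M" by (rule AE_E)
  define G where "G = space M - N"
  have G [measurable]: "G \<in> sets M" and G_good: "\<And>\<omega>. \<omega> \<in> G \<Longrightarrow> good \<omega>" using N by (auto simp: G_def)
  have G_AE: "AE \<omega> in M. \<omega> \<in> G"
    using N by (intro AE_I[of _ _ N]) (auto simp: G_def)
  define X where "X t \<omega> = (if \<omega> \<in> G then \<xi> (max t 0) \<omega> else 0)" for t \<omega>
  have X_AE: "AE \<omega> in M. X t \<omega> = \<xi> t \<omega>" if "0 \<le> t" for t
    using G_AE by eventually_elim (use that in \<open>simp add: X_def\<close>)
  have X_meas [measurable]: "X t \<in> borel_measurable M" for t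
    unfolding X_def using \<xi>_meas[of "max t 0"] by measurable
  have X_distr: "distr M borel (X t) = distr M borel (\<xi> t)" if "0 \<le> t" for t
    using X_AE[OF that] \<xi>_meas[OF that] by (intro distr_cong_AE) auto
  have "local_time_process M X b c \<nu> W L G"
  proof
    show "(\<lambda>p. X (fst p) (snd p)) \<in> borel_measurable (borel \<Otimes>\<^sub>M M)"
    proof (rule borel_measurable_LIMSEQ_real)
      let ?k = "\<lambda>n p. \<lfloor>real (Suc n) * max (fst p) 0\<rfloor>"
      fix p :: "real \<times> 'a"
      show "(\<lambda>n. X ((real_of_int (?k n p) + 1) / real (Suc n)) (snd p)) \<longlonglongrightarrow> X (fst p) (snd p)"
      proof (cases "snd p \<in> G")
        case True
        have "0 \<le> (real_of_int (?k n p) + 1) / real (Suc n)" for n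
          by (intro divide_nonneg_nonneg add_nonneg_nonneg) auto
        then have "X ((real_of_int (?k n p) + 1) / real (Suc n)) (snd p) = \<xi> ((real_of_int (?k n p) + 1) / real (Suc n)) (snd p)" for n
          using True by (simp add: X_def max_absorb1)
        moreover have "cadlag (\<lambda>t. \<xi> t (snd p))" using G_good[OF True] by (simp add: good_def)
        from cadlag_approx[OF this, of "max (fst p) 0"]
        have "(\<lambda>n. \<xi> ((real_of_int (?k n p) + 1) / real (Suc n)) (snd p)) \<longlonglongrightarrow> \<xi> (max (fst p) 0) (snd p)" by simp
        ultimately show ?thesis using True by (simp add: X_def)
      qed (simp add: X_def)
    next
      fix n
      have "(\<lambda>p. X ((real_of_int i + 1) / real (Suc n)) (snd p)) \<in> borel_measurable (borel \<Otimes>\<^sub>M M)" for i :: int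
        by measurable
      then show "(\<lambda>p. X ((real_of_int \<lfloor>real (Suc n) * max (fst p) 0\<rfloor> + 1) / real (Suc n)) (snd p)) \<in> borel_measurable (borel \<Otimes>\<^sub>M M)"
        by (rule measurable_compose_countable[where f = "\<lambda>i p. X ((real_of_int i + 1) / real (Suc n)) (snd p)"]) measurable
    qed
    have "AE \<omega> in M. \<xi> 0 \<omega> = 0" using levy by (simp add: levy_process_def)
    then show "AE \<omega> in M. X 0 \<omega> = 0" using X_AE[OF order_refl] by eventually_elim simp
    show "indep_vars (\<lambda>_. borel) (\<lambda>i \<omega>. X (t (Suc i)) \<omega> - X (t i) \<omega>) {..<n}"
      if t: "0 \<le> t 0" "mono_on {..n} t" for n :: nat and t
    \<comment> \<open>The characterisation of independence by a product of laws requires a nonempty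
      index set.\<close>
    proof (cases "n = 0")
      case True
      then show ?thesis by (simp add: indep_vars_def indep_sets_def)
    next
      case False
      have tpos: "0 \<le> t i" if "i \<le> n" for i using mono_onD[OF t(2), of 0 i] t(1) that by auto
      let ?D = "\<lambda>i \<omega>. \<xi> (t (Suc i)) \<omega> - \<xi> (t i) \<omega>" and ?D' = "\<lambda>i \<omega>. X (t (Suc i)) \<omega> - X (t i) \<omega>"
      have D_meas: "?D i \<in> borel_measurable M" if "i < n" for i
        using that by (intro borel_measurable_diff \<xi>_meas tpos) auto
      have D_AE: "AE \<omega> in M. ?D' i \<omega> = ?D i \<omega>" if "i < n" for i
        using X_AE[of "t (Suc i)"] X_AE[of "t i"] tpos[of i] tpos[of "Suc i"] that by (auto elim: eventually_elim2)
      have ne: "{..<n} \<noteq> {}" using False by auto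
      have ind: "indep_vars (\<lambda>_. borel) ?D {..<n}" using levy t by (simp add: levy_process_def)
      have "AE \<omega> in M. \<forall>i\<in>{..<n}. ?D' i \<omega> = ?D i \<omega>"
        using D_AE by (subst AE_ball_countable) auto
      then have "distr M (PiM {..<n} (\<lambda>_. borel)) (\<lambda>\<omega>. \<lambda>i\<in>{..<n}. ?D' i \<omega>) = distr M (PiM {..<n} (\<lambda>_. borel)) (\<lambda>\<omega>. \<lambda>i\<in>{..<n}. ?D i \<omega>)"
        using D_meas by (intro distr_cong_AE measurable_restrict) (auto elim!: eventually_mono simp: fun_eq_iff)
      also have "\<dots> = (\<Pi>\<^sub>M i\<in>{..<n}. distr M borel (?D i))"
        using ind D_meas by (subst (asm) indep_vars_iff_distr_eq_PiM'[OF ne]) auto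
      also have "\<dots> = (\<Pi>\<^sub>M i\<in>{..<n}. distr M borel (?D' i))"
      proof (intro PiM_cong refl distr_cong_AE)
        fix i assume "i \<in> {..<n}"
        then show "AE \<omega> in M. ?D i \<omega> = ?D' i \<omega>" using D_AE[of i] by (auto elim!: eventually_mono)
      qed (use D_meas in auto)
      finally show ?thesis by (subst indep_vars_iff_distr_eq_PiM'[OF ne]) auto
    qed
    show "distr M borel (\<lambda>\<omega>. X (s + h) \<omega> - X s \<omega>) = distr M borel (X h)" if "0 \<le> s" "0 \<le> h" for s h
    proof -
      have "AE \<omega> in M. X (s + h) \<omega> - X s \<omega> = \<xi> (s + h) \<omega> - \<xi> s \<omega>"
        using X_AE[of "s + h"] X_AE[of s] that by (auto elim: eventually_elim2)
      then have "distr M borel (\<lambda>\<omega>. X (s + h) \<omega> - X s \<omega>) = distr M borel (\<lambda>\<omega>. \<xi> (s + h) \<omega> - \<xi> s \<omega>)"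
        using that \<xi>_meas[of "s + h"] \<xi>_meas[of s] by (intro distr_cong_AE borel_measurable_diff) auto
      also have "\<dots> = distr M borel (\<xi> h)" using levy that by (simp add: levy_process_def)
      also have "\<dots> = distr M borel (X h)" using X_distr[OF that(2)] by simp
      finally show ?thesis .
    qed
    show "(\<integral>\<^sup>+ \<omega>. ennreal (exp (- l * X t \<omega>)) \<partial>M) = ennreal (exp (t * laplace_exponent b c \<nu> l))" if "0 \<le> t" "0 \<le> l" for t l
    proof -
      have "(\<integral>\<^sup>+ \<omega>. ennreal (exp (- l * X t \<omega>)) \<partial>M) = (\<integral>\<^sup>+ \<omega>. ennreal (exp (- l * \<xi> t \<omega>)) \<partial>M)"
        using X_AE[OF that(1)] by (intro nn_integral_cong_AE) (auto elim: eventually_mono)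
      also have "\<dots> = ennreal (exp (t * laplace_exponent b c \<nu> l))"
        using lap[OF that] by (subst nn_integral_eq_integral) (auto simp: has_bochner_integral_iff)
      finally show ?thesis .
    qed
    fix \<omega> assume \<omega>: "\<omega> \<in> G"
    then have g: "good \<omega>" by (rule G_good)
    then show "continuous_on (UNIV \<times> {0..}) (\<lambda>(x, t). L x t \<omega>)" by (simp add: good_def)
    show "0 \<le> L x t \<omega>" if "0 \<le> t" for x t using g that by (simp add: good_def)
    show "(\<integral>\<^sup>+ r\<in>{0..t}. f (X r \<omega>) \<partial>lborel) = (\<integral>\<^sup>+ x. f x * ennreal (L x t \<omega>) \<partial>lborel)"
      if "0 \<le> t" "f \<in> borel_measurable borel" for t and f :: "real \<Rightarrow> ennreal"
    proof -
      have "(\<integral>\<^sup>+ r\<in>{0..t}. f (X r \<omega>) \<partial>lborel) = (\<integral>\<^sup>+ r\<in>{0..t}. f (\<xi> r \<omega>) \<partial>lborel)"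
        using \<omega> by (intro nn_integral_cong) (auto simp: X_def indicator_def max_absorb1)
      also have "\<dots> = (\<integral>\<^sup>+ x. f x * ennreal (L x t \<omega>) \<partial>lborel)" using g that by (simp add: good_def)
      finally show ?thesis .
    qed
  qed (use assms(1,2) jump W G_AE G in auto)
  then show thesis by (rule that)
qed

theorem theorem1p8:
  fixes M :: "'a measure" and b c :: real and \<nu> :: "real measure"
    and \<xi> :: "real \<Rightarrow> 'a \<Rightarrow> real" and W :: "real \<Rightarrow> real"
    and L :: "real \<Rightarrow> real \<Rightarrow> 'a \<Rightarrow> real"
  assumes "0 \<le> b" and "0 < c"
    and "spectrally_positive_levy M b c \<nu> \<xi>"
    and "scale_function b c \<nu> W"
    and "local_times M \<xi> L"
  shows "\<forall>p\<ge>(1::real). \<exists>C>(0::real). \<forall>\<zeta>\<ge>0. \<forall>x\<ge>0.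
    (\<integral>\<^sup>+ \<omega>. ennreal (\<bar>stopped_local_time L \<zeta> x \<omega>\<bar> powr p) \<partial>conditioned_measure M L \<zeta>)
      \<le> ennreal (C * max \<zeta> (\<zeta> powr p) * (1 + W x) powr (2 * p - 2))"
proof (intro allI impI)
  fix p :: real assume p: "1 \<le> p"
  obtain X G where "local_time_process M X b c \<nu> W L G"
    by (rule local_time_processI[OF assms])
  then interpret local_time_process M X b c \<nu> W L G .
  \<comment> \<open>The first power of 2 comes from \<open>conditioned_moment_le\<close>; the second
    pays for replacing \<open>1 + 2 * W x\<close> by \<open>2 * (1 + W x)\<close>.\<close>
  define C where "C = 4 * fact (nat \<lceil>p\<rceil>) * 2 powr (p - 1) * 2 powr (p - 1)"
  have C: "0 < C" by (simp add: C_def)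
  have "(\<integral>\<^sup>+ \<omega>. ennreal (\<bar>stopped_local_time L \<zeta> x \<omega>\<bar> powr p) \<partial>conditioned_measure M L \<zeta>)
      \<le> ennreal (C * max \<zeta> (\<zeta> powr p) * (1 + W x) powr (2 * p - 2))" if \<zeta>: "0 \<le> \<zeta>" and x: "0 \<le> x" for \<zeta> x
  proof (cases "\<zeta> = 0")
    case True
    then show ?thesis by (simp add: conditioned_moment_zero)
  next
    case False
    then have "(\<integral>\<^sup>+ \<omega>. ennreal (\<bar>stopped_local_time L \<zeta> x \<omega>\<bar> powr p) \<partial>conditioned_measure M L \<zeta>) \<le>
        ennreal (4 * fact (nat \<lceil>p\<rceil>) * 2 powr (p - 1) * max \<zeta> (\<zeta> powr p) * (1 + 2 * W x) powr (p - 1))"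
      using \<zeta> x p by (intro conditioned_moment_le) auto
    also have "\<dots> \<le> ennreal (C * max \<zeta> (\<zeta> powr p) * (1 + W x) powr (2 * p - 2))"
    proof (rule ennreal_leI)
      have W: "0 \<le> W x" by (rule W_nonneg)
      have "(1 + 2 * W x) powr (p - 1) \<le> (2 * (1 + W x)) powr (p - 1)"
        using W p by (intro powr_mono2) auto
      also have "\<dots> = 2 powr (p - 1) * (1 + W x) powr (p - 1)" by (rule powr_mult)
      \<comment> \<open>As \<open>1 + W x\<close> and \<open>p\<close> are at least 1, the exponent
        may grow from \<open>p - 1\<close> to \<open>2 * p - 2\<close>.\<close>
      also have "\<dots> \<le> 2 powr (p - 1) * (1 + W x) powr (2 * p - 2)"
        using W p by (intro mult_left_mono powr_mono) auto
      finally have "4 * fact (nat \<lceil>p\<rceil>) * 2 powr (p - 1) * max \<zeta> (\<zeta> powr p) * (1 + 2 * W x) powr (p - 1) \<le>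
          4 * fact (nat \<lceil>p\<rceil>) * 2 powr (p - 1) * max \<zeta> (\<zeta> powr p) * (2 powr (p - 1) * (1 + W x) powr (2 * p - 2))"
        using \<zeta> by (intro mult_left_mono) auto
      then show "4 * fact (nat \<lceil>p\<rceil>) * 2 powr (p - 1) * max \<zeta> (\<zeta> powr p) * (1 + 2 * W x) powr (p - 1) \<le>
          C * max \<zeta> (\<zeta> powr p) * (1 + W x) powr (2 * p - 2)"
        by (simp add: C_def mult_ac)
    qed
    finally show ?thesis .
  qed
  with C show "\<exists>C>0. \<forall>\<zeta>\<ge>0. \<forall>x\<ge>0.
    (\<integral>\<^sup>+ \<omega>. ennreal (\<bar>stopped_local_time L \<zeta> x \<omega>\<bar> powr p) \<partial>conditioned_measure M L \<zeta>)
      \<le> ennreal (C * max \<zeta> (\<zeta> powr p) * (1 + W x) powr (2 * p - 2))"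
    by blast
qed

end
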